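(* Let $\mathfrak{G}$ be an étale groupoid whose unit space is homeomorphic to the Cantor set. If $\mathfrak{G}$ is expansive and has infinite orbits (every $\mathfrak{G}$-orbit is infinite), then $\mathsf{A}(\mathfrak{G})$ is finitely generated.
   Context: A groupoid $\mathfrak{G}$ is a small category in which every morphism is invertible, identified with its set of morphisms; $\mathsf{s}(\gamma)=\gamma^{-1}\gamma$ and $\mathsf{r}(\gamma)=\gamma\gamma^{-1}$ are the source and range, $\gamma_1\gamma_2$ is defined iff $\mathsf{s}(\gamma_1)=\mathsf{r}(\gamma_2)$, and $\mathfrak{G}^{(0)}$ is the set of units (elements $\gamma\gamma^{-1}$). A topological groupoid is a groupoid with a topology for which multiplication and inversion are continuous (not assumed Hausdorff). A bisection is a compact open subset $F\subset\mathfrak{G}$ such that $\mathsf{s}:F\to\mathsf{s}(F)$ and $\mathsf{r}:F\to\mathsf{r}(F)$ are homeomorphisms onto open subsets of $\mathfrak{G}^{(0)}$. $\mathfrak{G}$ is étale if bisections form a basis of its topology. Throughout, groupoids are étale and $\mathfrak{G}^{(0)}$ is homeomorphic to the Cantor set. Subsets are multiplied by $AB=\{ab: a\in A, b\in B, ab \text{ defined}\}$, and $A^{-1}=\{a^{-1}:a\in A\}$. The $\mathfrak{G}$-orbit of a unit $x$ is $\{\mathsf{r}(\gamma):\mathsf{s}(\gamma)=x\}$. A generating set is a compact set $S\subset\mathfrak{G}$ with $\mathfrak{G}=\bigcup_{n\ge1}(S\cup S^{-1})^n$; $\mathfrak{G}$ is compactly generated if one exists. A finite cover $\mathcal{S}$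 of a compact open generating set $S$ by bisections is expansive if $\bigcup_{n\ge1}(\mathcal{S}\cup\mathcal{S}^{-1})^n$ is a basis of the topology of $\mathfrak{G}$, where $\mathcal{S}^{-1}=\{F^{-1}:F\in\mathcal{S}\}$ and $(\mathcal{S}\cup\mathcal{S}^{-1})^n$ is the set of all products of $n$ bisections from $\mathcal{S}\cup\mathcal{S}^{-1}$. $\mathfrak{G}$ is expansive if it is compactly generated and some compact open generating set of $\mathfrak{G}$ has an expansive finite cover by bisections. The topological full group $\mathsf{F}(\mathfrak{G})$ is the group, under multiplication of subsets, of all bisections $F$ with $\mathsf{s}(F)=\mathsf{r}(F)=\mathfrak{G}^{(0)}$. A multisection of degree $d$ is a collection $\mathcal{F}=\{F_{i,j}\}_{i,j=1}^d$ of $d^2$ bisections such that $F_{i_2,i_3}F_{i_1,i_2}=F_{i_1,i_3}$ for all $i_1,i_2,i_3$ and the $F_{i,i}$ are pairwise disjoint subsets of $\mathfrak{G}^{(0)}$. Its domain is $U=\bigcup_i F_{i,i}$. For a permutation $\pi$ of $\{1,\dots,d\}$ put $\mathcal{F}_\pi=\bigcup_{i=1}^d F_{i,\pi(i)}\cup(\mathfrak{G}^{(0)}\setminus U)\in\mathsf{F}(\mathfrak{G})$, and let $\mathsf{A}(\mathcal{F})=\{\mathcal{F}_\pi:\pi\text{ even}\}$. The group $\mathsf{A}(\mathfrak{G})$ is the subgroup of $\mathsf{F}(\mathfrak{G})$ generated by the union of $\mathsf{A}(\mathcal{F})$ over all multisections $\mathcal{F}$ of degree $3$. *)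

theory Defs
  imports "HOL-Analysis.Analysis" "HOL-Algebra.Algebra" "HOL-Combinatorics.Permutations"
begin

section \<open>Topological groupoids\<close>

text \<open>
  A groupoid is identified with its set of morphisms, which is the underlying set of the
  abstract topology \<open>gtop G\<close>; no separation axiom is imposed.  The values of \<open>gmult G\<close> are
  relevant only on composable pairs.
\<close>

record 'a topgpd =
  gtop :: "'a topology"
  gmult :: "'a \<Rightarrow> 'a \<Rightarrow> 'a"
  ginv :: "'a \<Rightarrow> 'a"

definition arrows :: "'a topgpd \<Rightarrow> 'a set"
  where "arrows G = topspace (gtop G)"

definition src :: "'a topgpd \<Rightarrow> 'a \<Rightarrow> 'a"
  where "src G x = gmult G (ginv G x) x"

definition rng :: "'a topgpd \<Rightarrow> 'a \<Rightarrow> 'a"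
  where "rng G x = gmult G x (ginv G x)"

definition gunits :: "'a topgpd \<Rightarrow> 'a set"
  where "gunits G = rng G ` arrows G"

definition composable :: "'a topgpd \<Rightarrow> ('a \<times> 'a) set"
  where "composable G = {(x, y). x \<in> arrows G \<and> y \<in> arrows G \<and> src G x = rng G y}"

text \<open>
  The category axioms, where each object is identified with its identity morphism.  That
  \<open>ginv G x\<close> is a two-sided inverse of \<open>x\<close> is built into the definitions of \<open>src\<close> and \<open>rng\<close>
  together with the last axiom, which gives its endpoints.
\<close>

locale groupoid =
  fixes G :: "'a topgpd" (structure)
  assumes inv_closed: "x \<in> arrows G \<Longrightarrow> ginv G x \<in> arrows G"
    and mult_closed: "(x, y) \<in> composable G \<Longrightarrow> gmult G x y \<in> arrows G"
    and src_closed: "x \<in> arrows G \<Longrightarrow> src G x \<in> arrows G"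
    and rng_closed: "x \<in> arrows G \<Longrightarrow> rng G x \<in> arrows G"
    and src_endpoints:
      "x \<in> arrows G \<Longrightarrow> src G (src G x) = src G x \<and> rng G (src G x) = src G x"
    and rng_endpoints:
      "x \<in> arrows G \<Longrightarrow> src G (rng G x) = rng G x \<and> rng G (rng G x) = rng G x"
    and mult_endpoints:
      "(x, y) \<in> composable G \<Longrightarrow>
         src G (gmult G x y) = src G y \<and> rng G (gmult G x y) = rng G x"
    and mult_assoc:
      "(x, y) \<in> composable G \<Longrightarrow> (y, z) \<in> composable G \<Longrightarrow>
         gmult G (gmult G x y) z = gmult G x (gmult G y z)"
    and mult_src: "x \<in> arrows G \<Longrightarrow> gmult G x (src G x) = x"
    and rng_mult: "x \<in> arrows G \<Longrightarrow> gmult G (rng G x) x = x"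
    and inv_endpoints:
      "x \<in> arrows G \<Longrightarrow> src G (ginv G x) = rng G x \<and> rng G (ginv G x) = src G x"

locale topological_groupoid = groupoid +
  assumes continuous_mult:
      "continuous_map (subtopology (prod_topology (gtop G) (gtop G)) (composable G)) (gtop G)
         (\<lambda>(x, y). gmult G x y)"
    and continuous_inv: "continuous_map (gtop G) (gtop G) (ginv G)"

definition unit_topology :: "'a topgpd \<Rightarrow> 'a topology"
  where "unit_topology G = subtopology (gtop G) (gunits G)"

definition bisection :: "'a topgpd \<Rightarrow> 'a set \<Rightarrow> bool"
  where "bisection G F \<longleftrightarrow>
    compactin (gtop G) F \<and> openin (gtop G) F \<and>
    openin (unit_topology G) (src G ` F) \<and>
    homeomorphic_map (subtopology (gtop G) F) (subtopology (unit_topology G) (src G ` F)) (src G) \<and>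
    openin (unit_topology G) (rng G ` F) \<and>
    homeomorphic_map (subtopology (gtop G) F) (subtopology (unit_topology G) (rng G ` F)) (rng G)"

definition topology_basis :: "'a topology \<Rightarrow> 'a set set \<Rightarrow> bool"
  where "topology_basis T \<B> \<longleftrightarrow> openin T = arbitrary union_of (\<lambda>W. W \<in> \<B>)"

locale etale_groupoid = topological_groupoid +
  assumes bisections_basis: "topology_basis (gtop G) {F. bisection G F}"

definition cantor_space :: "(nat \<Rightarrow> bool) topology"
  where "cantor_space = product_topology (\<lambda>_. discrete_topology UNIV) UNIV"

definition orbit_of :: "'a topgpd \<Rightarrow> 'a \<Rightarrow> 'a set"
  where "orbit_of G x = rng G ` {g \<in> arrows G. src G g = x}"

definition infinite_orbits :: "'a topgpd \<Rightarrow> bool"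
  where "infinite_orbits G \<longleftrightarrow> (\<forall>x \<in> gunits G. infinite (orbit_of G x))"

section \<open>Compact generation and expansivity\<close>

definition gset_mult :: "'a topgpd \<Rightarrow> 'a set \<Rightarrow> 'a set \<Rightarrow> 'a set"
  where "gset_mult G A B = {gmult G a b |a b. a \<in> A \<and> b \<in> B \<and> (a, b) \<in> composable G}"

definition gset_inv :: "'a topgpd \<Rightarrow> 'a set \<Rightarrow> 'a set"
  where "gset_inv G A = ginv G ` A"

text \<open>
  Only exponents \<open>n \<ge> 1\<close> are used for the next two notions; the values at \<open>0\<close> are neutral
  for the product, so that the first powers of \<open>A\<close> and \<open>\<S>\<close> are \<open>A\<close> and \<open>\<S>\<close>.
\<close>

primrec gset_pow :: "'a topgpd \<Rightarrow> 'a set \<Rightarrow> nat \<Rightarrow> 'a set" where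
  "gset_pow G A 0 = gunits G"
| "gset_pow G A (Suc n) = gset_mult G (gset_pow G A n) A"

primrec family_pow :: "'a topgpd \<Rightarrow> 'a set set \<Rightarrow> nat \<Rightarrow> 'a set set" where
  "family_pow G \<S> 0 = {gunits G}"
| "family_pow G \<S> (Suc n) = {gset_mult G P F |P F. P \<in> family_pow G \<S> n \<and> F \<in> \<S>}"

definition generating_set :: "'a topgpd \<Rightarrow> 'a set \<Rightarrow> bool"
  where "generating_set G S \<longleftrightarrow>
    compactin (gtop G) S \<and> arrows G = (\<Union>n\<in>{1..}. gset_pow G (S \<union> gset_inv G S) n)"

definition compactly_generated :: "'a topgpd \<Rightarrow> bool"
  where "compactly_generated G \<longleftrightarrow> (\<exists>S. generating_set G S)"

definition expansive_cover :: "'a topgpd \<Rightarrow> 'a set \<Rightarrow> 'a set set \<Rightarrow> bool"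
  where "expansive_cover G S \<S> \<longleftrightarrow>
    finite \<S> \<and> (\<forall>F\<in>\<S>. bisection G F) \<and> S \<subseteq> \<Union>\<S> \<and>
    topology_basis (gtop G) (\<Union>n\<in>{1..}. family_pow G (\<S> \<union> gset_inv G ` \<S>) n)"

definition expansive :: "'a topgpd \<Rightarrow> bool"
  where "expansive G \<longleftrightarrow>
    compactly_generated G \<and>
    (\<exists>S \<S>. generating_set G S \<and> openin (gtop G) S \<and> expansive_cover G S \<S>)"

section \<open>The topological full group and its alternating subgroup\<close>

definition full_group :: "'a topgpd \<Rightarrow> 'a set monoid"
  where "full_group G =
    \<lparr>carrier = {F. bisection G F \<and> src G ` F = gunits G \<and> rng G ` F = gunits G},
     mult = gset_mult G,
     one = gunits G\<rparr>"

definition multisection :: "'a topgpd \<Rightarrow> nat \<Rightarrow> (nat \<Rightarrow> nat \<Rightarrow> 'a set) \<Rightarrow> bool"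
  where "multisection G d \<F> \<longleftrightarrow>
    (\<forall>i\<in>{1..d}. \<forall>j\<in>{1..d}. bisection G (\<F> i j)) \<and>
    (\<forall>i\<in>{1..d}. \<forall>j\<in>{1..d}. \<forall>k\<in>{1..d}. gset_mult G (\<F> j k) (\<F> i j) = \<F> i k) \<and>
    (\<forall>i\<in>{1..d}. \<F> i i \<subseteq> gunits G) \<and>
    disjoint_family_on (\<lambda>i. \<F> i i) {1..d}"

definition multisection_perm ::
    "'a topgpd \<Rightarrow> nat \<Rightarrow> (nat \<Rightarrow> nat \<Rightarrow> 'a set) \<Rightarrow> (nat \<Rightarrow> nat) \<Rightarrow> 'a set"
  where "multisection_perm G d \<F> \<pi> =
    (\<Union>i\<in>{1..d}. \<F> i (\<pi> i)) \<union> (gunits G - (\<Union>i\<in>{1..d}. \<F> i i))"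

definition multisection_alt :: "'a topgpd \<Rightarrow> nat \<Rightarrow> (nat \<Rightarrow> nat \<Rightarrow> 'a set) \<Rightarrow> 'a set set"
  where "multisection_alt G d \<F> =
    {multisection_perm G d \<F> \<pi> |\<pi>. \<pi> permutes {1..d} \<and> evenperm \<pi>}"

definition alt_full_group :: "'a topgpd \<Rightarrow> 'a set monoid"
  where "alt_full_group G =
    (full_group G)
      \<lparr>carrier := generate (full_group G) (\<Union>\<F>\<in>{\<F>. multisection G 3 \<F>}. multisection_alt G 3 \<F>)\<rparr>"

definition finitely_generated_group :: "('b, 'm) monoid_scheme \<Rightarrow> bool"
  where "finitely_generated_group H \<longleftrightarrow>
    (\<exists>T. finite T \<and> T \<subseteq> carrier H \<and> generate H T = carrier H)"

end

theory Submission
  imports Defs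
begin

text \<open>
  The full group acts faithfully on the arrows by left multiplication, commuting with right
  multiplication, so a 3-cycle over a clopen set \<open>W\<close> is determined by the triples of germs
  \<open>(b\<^sub>1 y, b\<^sub>2 y, b\<^sub>3 y)\<close>, \<open>y \<in> W\<close>, that it permutes.  If two such 3-cycles over \<open>W\<close> and \<open>W'\<close> share
  exactly one section, their commutator is a 3-cycle over \<open>W \<inter> W'\<close>.

  By compactness and infinite orbits, the unit space is covered by finitely many clopen sets, each
  carrying seven sections whose ranges have distinct colours for a fixed finite colouring of the
  unit space.  Let \<open>H\<close> be generated by the 3-cycles of these sections and by finitely many 3-cycles
  that link the sections at the two ends of each bisection \<open>F\<close> of the expansive cover.  The sets to
  which the 3-cycles can be restricted inside \<open>H\<close> form a ring, by commutators, and this ring is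
  stable under pulling back along each \<open>F\<close>.  Hence it contains the sources of all products of
  bisections of the cover and, by expansivity, all clopen sets.

  Thus \<open>H\<close> contains all sufficiently small restrictions of the generating 3-cycles.  Commutators
  with the links propagate this to every triple of germs with common source and distinct ranges,
  because products of the cover generate the groupoid.  Every 3-cycle of a multisection is then a
  finite product of small ones in \<open>H\<close>.
\<close>

section \<open>Groupoid algebra and the action on arrows\<close>

text \<open>The obstacle is that restricting a cycle to a smaller clopen set is not a group
  operation, while infinitely many clopen sets have to be reached from finitely many generators.
  Commutators supply restrictions, but each needs supports that meet in a single section. Inside one
  star this is automatic; between sections over different clopen sets it is not. A colouring fixed
  in advance repairs this: sections of distinct colours have disjoint ranges whatever their bases
  are. Seven sections suffice because three colours of another star can be avoided and four sections
  remain, which one linking step and two further commutators use up; in the germ argument seven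
  ranges outnumber the at most six that must be avoided. Units alone would not carry the action,
  since isotropy is invisible on the unit space. The arrow space need not be Hausdorff, so two
  bisections agree on a set that is open but perhaps not closed; all cutting is therefore done along
  clopen sets of units, and germs are compared only in small neighbourhoods of their source.\<close>

context groupoid
begin

abbreviation arr ("\<AA>") where "\<AA> \<equiv> arrows G"
abbreviation unt ("\<UU>") where "\<UU> \<equiv> gunits G"
abbreviation sr ("\<s>") where "\<s> \<equiv> src G"
abbreviation rg ("\<r>") where "\<r> \<equiv> rng G"
abbreviation iv ("\<i>") where "\<i> \<equiv> ginv G"
abbreviation mu (infixl "\<star>" 70) where "x \<star> y \<equiv> gmult G x y"

lemma composable_iff [simp]: "(x, y) \<in> composable G \<longleftrightarrow> x \<in> \<AA> \<and> y \<in> \<AA> \<and> \<s> x = \<r> y"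
  by (auto simp: composable_def)

lemma closed [simp, intro]:
  "x \<in> \<AA> \<Longrightarrow> \<i> x \<in> \<AA>" "x \<in> \<AA> \<Longrightarrow> \<s> x \<in> \<AA>" "x \<in> \<AA> \<Longrightarrow> \<r> x \<in> \<AA>"
  "x \<in> \<AA> \<Longrightarrow> y \<in> \<AA> \<Longrightarrow> \<s> x = \<r> y \<Longrightarrow> x \<star> y \<in> \<AA>"
  using inv_closed src_closed rng_closed mult_closed by auto

lemma endpoints [simp]:
  "x \<in> \<AA> \<Longrightarrow> \<s> (\<i> x) = \<r> x" "x \<in> \<AA> \<Longrightarrow> \<r> (\<i> x) = \<s> x"
  "x \<in> \<AA> \<Longrightarrow> \<s> (\<s> x) = \<s> x" "x \<in> \<AA> \<Longrightarrow> \<r> (\<s> x) = \<s> x"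
  "x \<in> \<AA> \<Longrightarrow> \<s> (\<r> x) = \<r> x" "x \<in> \<AA> \<Longrightarrow> \<r> (\<r> x) = \<r> x"
  "x \<in> \<AA> \<Longrightarrow> y \<in> \<AA> \<Longrightarrow> \<s> x = \<r> y \<Longrightarrow> \<s> (x \<star> y) = \<s> y"
  "x \<in> \<AA> \<Longrightarrow> y \<in> \<AA> \<Longrightarrow> \<s> x = \<r> y \<Longrightarrow> \<r> (x \<star> y) = \<r> x"
  using inv_endpoints src_endpoints rng_endpoints mult_endpoints by auto

lemma assoc: "x \<in> \<AA> \<Longrightarrow> y \<in> \<AA> \<Longrightarrow> z \<in> \<AA> \<Longrightarrow> \<s> x = \<r> y \<Longrightarrow> \<s> y = \<r> z \<Longrightarrow>
    (x \<star> y) \<star> z = x \<star> (y \<star> z)"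
  using mult_assoc by auto

lemma mult_unit [simp]: "x \<in> \<AA> \<Longrightarrow> x \<star> \<s> x = x" "x \<in> \<AA> \<Longrightarrow> \<r> x \<star> x = x"
  using mult_src rng_mult by auto

lemma inv_mult [simp]: "\<i> x \<star> x = \<s> x" "x \<star> \<i> x = \<r> x"
  by (auto simp: src_def rng_def)

lemma inv_inv [simp]: assumes "x \<in> \<AA>" shows "\<i> (\<i> x) = x"
proof -
  have "\<i> (\<i> x) = \<i> (\<i> x) \<star> \<s> (\<i> (\<i> x))" using assms by (metis closed(1) mult_unit(1))
  also have "\<dots> = \<i> (\<i> x) \<star> (\<i> x \<star> x)" using assms by simp
  also have "\<dots> = (\<i> (\<i> x) \<star> \<i> x) \<star> x" using assms by (subst assoc) auto
  also have "\<dots> = x" using assms by simp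
  finally show ?thesis .
qed

lemma unitD: assumes "u \<in> \<UU>" shows "u \<in> \<AA>" "\<s> u = u" "\<r> u = u"
  using assms by (auto simp: gunits_def)

lemma unitI [simp, intro]: "x \<in> \<AA> \<Longrightarrow> \<r> x \<in> \<UU>" "x \<in> \<AA> \<Longrightarrow> \<s> x \<in> \<UU>"
  by (auto simp: gunits_def) (metis closed(1) endpoints(2) image_eqI)

lemma units_subset: "\<UU> \<subseteq> \<AA>" using unitD by auto

lemma src_unit_mult: "u \<in> \<UU> \<Longrightarrow> x \<in> \<AA> \<Longrightarrow> \<s> x = u \<Longrightarrow> x \<star> u = x"
  by auto

lemma cancel [simp]:
  "x \<in> \<AA> \<Longrightarrow> y \<in> \<AA> \<Longrightarrow> \<s> x = \<r> y \<Longrightarrow> \<i> x \<star> (x \<star> y) = y"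
  "x \<in> \<AA> \<Longrightarrow> y \<in> \<AA> \<Longrightarrow> \<r> x = \<r> y \<Longrightarrow> x \<star> (\<i> x \<star> y) = y"
  "x \<in> \<AA> \<Longrightarrow> y \<in> \<AA> \<Longrightarrow> \<s> y = \<r> x \<Longrightarrow> (y \<star> x) \<star> \<i> x = y"
  "x \<in> \<AA> \<Longrightarrow> y \<in> \<AA> \<Longrightarrow> \<s> y = \<s> x \<Longrightarrow> (y \<star> \<i> x) \<star> x = y"
proof -
  assume "x \<in> \<AA>" "y \<in> \<AA>"
  then show "\<s> x = \<r> y \<Longrightarrow> \<i> x \<star> (x \<star> y) = y" "\<r> x = \<r> y \<Longrightarrow> x \<star> (\<i> x \<star> y) = y"
    by (simp_all flip: assoc)
  show "\<s> y = \<r> x \<Longrightarrow> (y \<star> x) \<star> \<i> x = y" "\<s> y = \<s> x \<Longrightarrow> (y \<star> \<i> x) \<star> x = y"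
    using \<open>x \<in> \<AA>\<close> \<open>y \<in> \<AA>\<close> mult_unit(1)[of y] by (simp_all add: assoc)
qed

section \<open>Slices and the action by left multiplication\<close>

text \<open>The algebraic half of being a bisection. Products and inverses are computed for slices
  first, so that topology only has to supply compactness and openness
  (\<open>bisection_iff\<close>).\<close>

definition slice where "slice F \<longleftrightarrow> F \<subseteq> \<AA> \<and> inj_on \<s> F \<and> inj_on \<r> F"

text \<open>The inverse of \<open>src\<close> on a slice. Outside the sources of \<open>F\<close>
  the value is unspecified, which is why membership of \<open>y\<close> in the source set is carried
  along.\<close>

definition sec where "sec F y = (THE f. f \<in> F \<and> \<s> f = y)"

lemma slice_subset: "slice F \<Longrightarrow> f \<in> F \<Longrightarrow> f \<in> \<AA>" by (auto simp: slice_def)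

lemma slice_src_inj: "slice F \<Longrightarrow> f \<in> F \<Longrightarrow> g \<in> F \<Longrightarrow> \<s> f = \<s> g \<Longrightarrow> f = g"
  by (auto simp: slice_def inj_on_def)

lemma slice_rng_inj: "slice F \<Longrightarrow> f \<in> F \<Longrightarrow> g \<in> F \<Longrightarrow> \<r> f = \<r> g \<Longrightarrow> f = g"
  by (auto simp: slice_def inj_on_def)

lemma sec_eq [simp]: assumes "slice F" "f \<in> F" shows "sec F (\<s> f) = f"
  unfolding sec_def using assms slice_src_inj[OF assms(1)] by (intro the_equality) auto

lemma sec_eqI: assumes "slice F" "f \<in> F" "\<s> f = y" shows "sec F y = f"
  using assms by auto

lemma secD: assumes "slice F" "y \<in> \<s> ` F"
  shows "sec F y \<in> F" "\<s> (sec F y) = y" "sec F y \<in> \<AA>"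
  using assms slice_subset by auto

text \<open>For a unit \<open>u\<close> the value \<open>act F u\<close> is the arrow of
  \<open>F\<close> over \<open>u\<close>, not merely its range, so isotropy is not lost.\<close>

definition act where "act F g = sec F (\<r> g) \<star> g"

definition full where "full F \<longleftrightarrow> slice F \<and> \<s> ` F = \<UU> \<and> \<r> ` F = \<UU>"

lemma fullD: assumes "full F" "g \<in> \<AA>"
  shows "sec F (\<r> g) \<in> F" "\<s> (sec F (\<r> g)) = \<r> g" "sec F (\<r> g) \<in> \<AA>"
  using assms secD[of F "\<r> g"] by (auto simp: full_def)

lemma full_slice: "full F \<Longrightarrow> slice F" by (simp add: full_def)

lemma full_mem: "full F \<Longrightarrow> f \<in> F \<Longrightarrow> f \<in> \<AA>" using full_slice slice_subset by blast

lemma act_closed [simp]: assumes "full F" "g \<in> \<AA>"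
  shows "act F g \<in> \<AA>" "\<s> (act F g) = \<s> g" "\<r> (act F g) = \<r> (sec F (\<r> g))"
  using fullD[OF assms] assms by (auto simp: act_def)

lemma act_eq: assumes "full F" "f \<in> F" "g \<in> \<AA>" "\<s> f = \<r> g" shows "act F g = f \<star> g"
  using assms by (simp add: act_def sec_eqI full_slice)

text \<open>Only the range of \<open>g\<close> selects the arrow of \<open>F\<close>, and
  \<open>g \<star> h\<close> has the same range. The action on one arrow therefore determines it on
  every arrow with that range.\<close>

lemma act_mult: assumes "full F" "g \<in> \<AA>" "h \<in> \<AA>" "\<s> g = \<r> h" shows "act F (g \<star> h) = act F g \<star> h"
  using fullD[OF assms(1,2)] assms by (auto simp: act_def assoc)

lemma act_units: "g \<in> \<AA> \<Longrightarrow> full \<UU>" "g \<in> \<AA> \<Longrightarrow> act \<UU> g = g"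
proof -
  show \<UU>: "full \<UU>" using units_subset by (auto simp: full_def slice_def inj_on_def unitD)
  show "g \<in> \<AA> \<Longrightarrow> act \<UU> g = g" by (subst act_eq[OF \<UU>, of "\<r> g"]) auto
qed

section \<open>Products and inverses of slices\<close>

lemma gset_multI: "a \<in> A \<Longrightarrow> b \<in> B \<Longrightarrow> a \<in> \<AA> \<Longrightarrow> b \<in> \<AA> \<Longrightarrow> \<s> a = \<r> b \<Longrightarrow> a \<star> b \<in> gset_mult G A B"
  by (auto simp: gset_mult_def)

lemma gset_multE: assumes "g \<in> gset_mult G A B"
  obtains a b where "a \<in> A" "b \<in> B" "a \<in> \<AA>" "b \<in> \<AA>" "\<s> a = \<r> b" "g = a \<star> b"
  using assms by (auto simp: gset_mult_def)

lemma gset_mult_assoc: "gset_mult G (gset_mult G A B) C = gset_mult G A (gset_mult G B C)"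
proof (intro equalityI subsetI)
  fix g assume "g \<in> gset_mult G (gset_mult G A B) C"
  then obtain a b c where "a \<in> A" "b \<in> B" "c \<in> C" "a \<in> \<AA>" "b \<in> \<AA>" "c \<in> \<AA>" "\<s> a = \<r> b" "\<s> b = \<r> c"
    "g = (a \<star> b) \<star> c" by (auto elim!: gset_multE)
  then show "g \<in> gset_mult G A (gset_mult G B C)" by (auto simp: assoc intro!: gset_multI)
next
  fix g assume "g \<in> gset_mult G A (gset_mult G B C)"
  then obtain a b c where "a \<in> A" "b \<in> B" "c \<in> C" "a \<in> \<AA>" "b \<in> \<AA>" "c \<in> \<AA>" "\<s> a = \<r> b" "\<s> b = \<r> c"
    "g = a \<star> (b \<star> c)" by (auto elim!: gset_multE)
  then show "g \<in> gset_mult G (gset_mult G A B) C" by (auto simp: assoc[symmetric] intro!: gset_multI)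
qed

lemma slice_mult: assumes "slice A" "slice B" shows "slice (gset_mult G A B)"
  unfolding slice_def
proof (intro conjI inj_onI subsetI)
  fix x assume "x \<in> gset_mult G A B" then show "x \<in> \<AA>" by (auto elim!: gset_multE)
next
  fix x y assume "x \<in> gset_mult G A B" "y \<in> gset_mult G A B" "\<s> x = \<s> y"
  then obtain a b c d where *: "a \<in> A" "b \<in> B" "a \<in> \<AA>" "b \<in> \<AA>" "\<s> a = \<r> b" "x = a \<star> b"
     "c \<in> A" "d \<in> B" "c \<in> \<AA>" "d \<in> \<AA>" "\<s> c = \<r> d" "y = c \<star> d" "\<s> b = \<s> d" by (auto elim!: gset_multE)
  then have "b = d" using slice_src_inj[OF assms(2)] by auto
  then show "x = y" using slice_src_inj[OF assms(1)] * by metis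
next
  fix x y assume "x \<in> gset_mult G A B" "y \<in> gset_mult G A B" "\<r> x = \<r> y"
  then obtain a b c d where *: "a \<in> A" "b \<in> B" "a \<in> \<AA>" "b \<in> \<AA>" "\<s> a = \<r> b" "x = a \<star> b"
     "c \<in> A" "d \<in> B" "c \<in> \<AA>" "d \<in> \<AA>" "\<s> c = \<r> d" "y = c \<star> d" "\<r> a = \<r> c" by (auto elim!: gset_multE)
  then have "a = c" using slice_rng_inj[OF assms(1)] by auto
  then show "x = y" using slice_rng_inj[OF assms(2)] * by metis
qed

lemma slice_inv: assumes "slice A" shows "slice (gset_inv G A)"
  using assms unfolding slice_def gset_inv_def by (auto simp: inj_on_def subset_iff)

lemma inv_image: assumes "A \<subseteq> \<AA>" shows "\<s> ` gset_inv G A = \<r> ` A" "\<r> ` gset_inv G A = \<s> ` A"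
  using assms by (force simp: gset_inv_def image_iff)+

lemma sec_mult: assumes "slice A" "slice B" "y \<in> \<s> ` B" "\<r> (sec B y) \<in> \<s> ` A"
  shows "sec (gset_mult G A B) y = sec A (\<r> (sec B y)) \<star> sec B y"
  using secD[OF assms(1,4)] secD[OF assms(2,3)]
  by (intro sec_eqI slice_mult assms gset_multI) auto

lemma src_image_mult: assumes "slice A" "slice B"
  shows "\<s> ` gset_mult G A B = {y \<in> \<s> ` B. \<r> (sec B y) \<in> \<s> ` A}"
proof (intro equalityI subsetI)
  fix x assume "x \<in> \<s> ` gset_mult G A B"
  then obtain a b where "a \<in> A" "b \<in> B" "a \<in> \<AA>" "b \<in> \<AA>" "\<s> a = \<r> b" "x = \<s> b" by (auto elim!: gset_multE)
  then show "x \<in> {y \<in> \<s> ` B. \<r> (sec B y) \<in> \<s> ` A}" using assms by (auto simp: image_iff) metis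
next
  fix y assume "y \<in> {y \<in> \<s> ` B. \<r> (sec B y) \<in> \<s> ` A}"
  then obtain a b where "a \<in> A" "b \<in> B" "\<s> a = \<r> b" "y = \<s> b" using assms by auto
  then show "y \<in> \<s> ` gset_mult G A B"
    using slice_subset[OF assms(1)] slice_subset[OF assms(2)]
    by (intro image_eqI[of _ _ "a \<star> b"] gset_multI) auto
qed

lemma full_mult: assumes "full A" "full B" shows "full (gset_mult G A B)"
proof -
  have "\<r> ` gset_mult G A B = \<UU>"
  proof (intro equalityI subsetI)
    fix x assume "x \<in> \<UU>"
    then obtain a where a: "a \<in> A" "x = \<r> a" using assms(1) by (metis full_def image_iff)
    then have "a \<in> \<AA>" using assms full_mem by blast
    then have "\<s> a \<in> \<UU>" by auto
    then obtain b where b: "b \<in> B" "\<s> a = \<r> b" using assms(2) by (metis full_def image_iff)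
    then have "b \<in> \<AA>" using assms full_mem by blast
    then show "x \<in> \<r> ` gset_mult G A B" using a b \<open>a \<in> \<AA>\<close> by (intro image_eqI[of _ _ "a \<star> b"] gset_multI) auto
  qed (auto elim!: gset_multE)
  moreover have "\<s> ` gset_mult G A B = \<UU>"
    using assms(1) secD[OF full_slice[OF assms(2)]] assms(2)
    by (auto simp: src_image_mult full_slice full_def)
  ultimately show ?thesis using assms slice_mult by (simp add: full_def)
qed

lemma full_inv: "full A \<Longrightarrow> full (gset_inv G A)"
  using inv_image[of A] slice_inv[of A] by (auto simp: full_def slice_def)

lemma act_comp: assumes "full A" "full B" "g \<in> \<AA>" shows "act (gset_mult G A B) g = act A (act B g)"
proof -
  let ?b = "sec B (\<r> g)" 
  have b: "?b \<in> B" "?b \<in> \<AA>" "\<s> ?b = \<r> g" using fullD[OF assms(2,3)] by auto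
  let ?a = "sec A (\<r> ?b)" 
  have a: "?a \<in> A" "?a \<in> \<AA>" "\<s> ?a = \<r> ?b" using fullD[OF assms(1) b(2)] by auto
  have "act (gset_mult G A B) g = (?a \<star> ?b) \<star> g"
    using a b assms by (intro act_eq full_mult gset_multI) auto
  also have "\<dots> = ?a \<star> (?b \<star> g)" using a b assms by (simp add: assoc)
  also have "\<dots> = act A (act B g)" using a b assms by (simp add: act_def)
  finally show ?thesis .
qed

text \<open>Two arrows of a slice with equal range coincide, so an inverse \<open>\<i> a\<close> is
  composable only with \<open>a\<close> itself.\<close>

lemma inv_gset_mult: assumes "slice A" shows "gset_mult G (gset_inv G A) A = \<s> ` A"
proof (intro equalityI subsetI)
  fix x assume "x \<in> gset_mult G (gset_inv G A) A"
  then obtain a b where ab: "a \<in> A" "b \<in> A" "\<s> (\<i> a) = \<r> b" "b \<in> \<AA>" "x = \<i> a \<star> b"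
    by (auto elim!: gset_multE simp: gset_inv_def)
  moreover have "a \<in> \<AA>" using slice_subset[OF assms ab(1)] .
  ultimately have "a = b" using slice_rng_inj[OF assms] by simp
  then show "x \<in> \<s> ` A" using ab by simp
next
  fix x assume "x \<in> \<s> ` A"
  then obtain a where a: "a \<in> A" "x = \<s> a" by blast
  then have "\<i> a \<star> a \<in> gset_mult G (gset_inv G A) A" using slice_subset[OF assms a(1)]
    by (intro gset_multI) (auto simp: gset_inv_def)
  then show "x \<in> gset_mult G (gset_inv G A) A" using a by simp
qed

lemma gset_mult_inv: assumes "slice A" shows "gset_mult G A (gset_inv G A) = \<r> ` A"
proof -
  have A: "A \<subseteq> \<AA>" using assms by (simp add: slice_def)
  then have "gset_inv G (gset_inv G A) = A" unfolding gset_inv_def by (force simp: image_iff)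
  then show ?thesis using inv_gset_mult[OF slice_inv[OF assms]] inv_image(1)[OF A] by simp
qed

lemma act_inv: assumes "full A" "g \<in> \<AA>" shows "act (gset_inv G A) (act A g) = g"
  using act_comp[OF full_inv[OF assms(1)] assms] inv_gset_mult[OF full_slice[OF assms(1)]] act_units assms
  by (simp add: full_def)

lemma units_gset_mult: assumes "A \<subseteq> \<AA>" "\<r> ` A \<subseteq> V" "V \<subseteq> \<UU>" shows "gset_mult G V A = A"
proof (intro equalityI subsetI)
  fix x assume "x \<in> gset_mult G V A"
  then obtain v a where v: "v \<in> V" "a \<in> A" "\<s> v = \<r> a" "a \<in> \<AA>" "x = v \<star> a" by (elim gset_multE)
  then have "v = \<r> a" using assms(3) unitD(2)[of v] by auto
  then show "x \<in> A" using v by simp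
next
  fix x assume x: "x \<in> A"
  then have xA: "x \<in> \<AA>" using assms(1) by blast
  have "\<r> x \<star> x \<in> gset_mult G V A" by (rule gset_multI) (use x xA assms(2) in auto)
  then show "x \<in> gset_mult G V A" using xA by simp
qed

text \<open>A full slice is the image of the units under its own action, so passing from subsets to
  maps on arrows loses nothing. \<open>is_cycle_unique\<close> rests on this.\<close>

lemma act_ext: assumes "full A" "full B" "\<And>u. u \<in> \<UU> \<Longrightarrow> act A u = act B u" shows "A = B"
proof -
  have *: "F = act F ` \<UU>" if "full F" for F
  proof (intro equalityI subsetI)
    fix f assume "f \<in> F"
    then have "f \<in> \<AA>" using that full_mem by blast
    then have "f = act F (\<s> f)" using that \<open>f \<in> F\<close> act_eq[of F f "\<s> f"] by auto
    then show "f \<in> act F ` \<UU>" using \<open>f \<in> \<AA>\<close> by blast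
  next
    fix f assume "f \<in> act F ` \<UU>"
    then obtain u where u: "u \<in> \<UU>" "f = act F u" by auto
    then have "u \<in> \<AA>" "\<r> u = u" using unitD by auto
    then have "f = sec F u" using u fullD[OF that, of u] by (auto simp: act_def src_unit_mult)
    then show "f \<in> F" using fullD[OF that \<open>u \<in> \<AA>\<close>] \<open>\<r> u = u\<close> by auto
  qed
  show ?thesis using *[OF assms(1)] *[OF assms(2)] assms(3) by (metis image_cong)
qed

end

section \<open>Bisections and clopen sets of units\<close>

lemma topology_basisD:
  assumes "topology_basis T \<B>" "openin T U" "x \<in> U"
  obtains W where "W \<in> \<B>" "x \<in> W" "W \<subseteq> U"
proof -
  have "(arbitrary union_of (\<lambda>W. W \<in> \<B>)) U" using assms(1,2) by (simp add: topology_basis_def)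
  then obtain \<U> where "\<U> \<subseteq> \<B>" "\<Union>\<U> = U" by (auto simp: union_of_def arbitrary_def)
  then show ?thesis using that assms(3) by blast
qed

text \<open>A basic box of the product is closed as well, every factor being discrete.\<close>

lemma cantor_space_clopen_basis:
  assumes "openin cantor_space U" "x \<in> U"
  shows "\<exists>K. openin cantor_space K \<and> closedin cantor_space K \<and> x \<in> K \<and> K \<subseteq> U"
proof -
  obtain B where "finite {i. B i \<noteq> UNIV}" "x \<in> Pi\<^sub>E UNIV B" "Pi\<^sub>E UNIV B \<subseteq> U"
    using assms unfolding cantor_space_def openin_product_topology_alt by fastforce
  moreover from this have "openin cantor_space (Pi\<^sub>E UNIV B)" "closedin cantor_space (Pi\<^sub>E UNIV B)"
    by (auto simp: cantor_space_def openin_PiE_gen closedin_product_topology)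
  ultimately show ?thesis by blast
qed

lemma homeomorphic_space_clopen_basis:
  assumes "S homeomorphic_space T"
    and T: "\<And>U x. openin T U \<Longrightarrow> x \<in> U \<Longrightarrow> \<exists>K. openin T K \<and> closedin T K \<and> x \<in> K \<and> K \<subseteq> U"
    and "openin S U" "x \<in> U"
  shows "\<exists>K. openin S K \<and> closedin S K \<and> x \<in> K \<and> K \<subseteq> U"
proof -
  obtain f g where fg: "homeomorphic_maps S T f g" using assms(1) unfolding homeomorphic_space_def by blast
  then have f: "homeomorphic_map S T f" unfolding homeomorphic_map_maps by blast
  have sub: "U \<subseteq> topspace S" using openin_subset[OF assms(3)] .
  have "openin T (f ` U)" using homeomorphic_map_openness_eq[OF f, of U] assms(3) by simp
  then obtain K where K: "openin T K" "closedin T K" "f x \<in> K" "K \<subseteq> f ` U"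
    using T[of "f ` U" "f x"] assms(4) by blast
  let ?K = "{y \<in> topspace S. f y \<in> K}"
  have cont: "continuous_map S T f" using homeomorphic_imp_continuous_map[OF f] .
  have inj: "inj_on f (topspace S)" using f unfolding homeomorphic_eq_everything_map by blast
  have "openin S ?K" "closedin S ?K"
    using openin_continuous_map_preimage[OF cont K(1)] closedin_continuous_map_preimage[OF cont K(2)] .
  moreover have "x \<in> ?K" using K assms(4) sub by auto
  moreover have "?K \<subseteq> U"
  proof
    fix y assume "y \<in> ?K"
    then have y: "y \<in> topspace S" "f y \<in> f ` U" using K(4) by auto
    then obtain u where "u \<in> U" "f y = f u" by auto
    then show "y \<in> U" using inj_onD[OF inj, of y u] y sub by auto
  qed
  ultimately show ?thesis by blast
qed

locale cantor_groupoid = etale_groupoid +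
  assumes cantor: "unit_topology G homeomorphic_space cantor_space"

context etale_groupoid
begin

abbreviation "T \<equiv> gtop G"
abbreviation "UT \<equiv> unit_topology G"

lemma topspaces [simp]: "topspace T = \<AA>" "topspace UT = \<UU>"
  using units_subset by (auto simp: arrows_def unit_topology_def)

lemma cont_mult_pair:
  assumes "continuous_map S T f" "continuous_map S T g" "\<And>x. x \<in> topspace S \<Longrightarrow> \<s> (f x) = \<r> (g x)"
  shows "continuous_map S T (\<lambda>x. f x \<star> g x)"
proof -
  have "f x \<in> \<AA>" "g x \<in> \<AA>" if "x \<in> topspace S" for x
    using continuous_map_image_subset_topspace[OF assms(1)] continuous_map_image_subset_topspace[OF assms(2)] that
    by auto
  then have "(\<lambda>x. (f x, g x)) \<in> topspace S \<rightarrow> composable G" using assms(3) by auto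
  then have "continuous_map S (subtopology (prod_topology T T) (composable G)) (\<lambda>x. (f x, g x))"
    unfolding continuous_map_in_subtopology using assms(1,2)
    by (auto intro: continuous_map_pairedI)
  from continuous_map_compose[OF this continuous_mult] show ?thesis by (simp add: o_def)
qed

lemma cont_src: "continuous_map T UT \<s>" and cont_rng: "continuous_map T UT \<r>"
proof -
  have "continuous_map T T \<s>" "continuous_map T T \<r>"
    using cont_mult_pair[OF continuous_inv continuous_map_id] cont_mult_pair[OF continuous_map_id continuous_inv]
    by (simp_all add: id_def)
  then show "continuous_map T UT \<s>" "continuous_map T UT \<r>"
    by (auto simp: unit_topology_def continuous_map_in_subtopology)
qed

lemma bisection_slice: assumes "bisection G F" shows "slice F"
proof -
  have "F \<subseteq> \<AA>" using assms openin_subset[of T F] by (auto simp: bisection_def)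
  moreover have "topspace (subtopology T F) = F" using \<open>F \<subseteq> \<AA>\<close> by auto
  ultimately show ?thesis using assms
    by (auto simp: bisection_def slice_def homeomorphic_eq_everything_map)
qed

lemma bisection_basis: assumes "openin T U" "x \<in> U"
  obtains F where "bisection G F" "x \<in> F" "F \<subseteq> U"
proof -
  obtain F where "F \<in> {F. bisection G F}" "x \<in> F" "F \<subseteq> U"
    by (rule topology_basisD[OF bisections_basis assms])
  then show ?thesis using that by blast
qed

text \<open>Bisections form a basis and have open sources and ranges, so both maps are open.\<close>

lemma open_src_image: assumes "openin T U" shows "openin UT (\<s> ` U)" 
  and open_rng_image: "openin UT (\<r> ` U)"
proof -
  have *: "openin UT (f ` U)" if f: "\<And>F. bisection G F \<Longrightarrow> homeomorphic_map (subtopology T F) (subtopology UT (f ` F)) f"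
     "\<And>F. bisection G F \<Longrightarrow> openin UT (f ` F)" for f
  proof (rule openin_subopen[THEN iffD2], intro ballI, elim imageE)
    fix z x assume x: "z = f x" "x \<in> U"
    then obtain F where F: "bisection G F" "x \<in> F" "F \<subseteq> U" using bisection_basis[OF assms] by metis
    then show "\<exists>S. openin UT S \<and> z \<in> S \<and> S \<subseteq> f ` U"
      unfolding x by (intro exI[of _ "f ` F"] conjI f(2) imageI image_mono)
  qed
  show "openin UT (\<s> ` U)" "openin UT (\<r> ` U)" by (rule *; unfold bisection_def; elim conjE; assumption)+
qed

lemma arrow_bisection: assumes "g \<in> \<AA>" obtains F where "bisection G F" "g \<in> F"
proof -
  have "openin T \<AA>" using openin_topspace[of T] by simp
  then show ?thesis by (rule bisection_basis) (use assms that in blast)+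
qed

text \<open>A set open in the unit space has an open preimage under \<open>src\<close>. Inside a
  bisection \<open>F\<close> around a unit this preimage can be cut back to units: an arrow of
  \<open>F\<close> whose source also lies in \<open>F\<close> equals that source, because
  \<open>src\<close> is injective on \<open>F\<close>.\<close>

lemma open_units: "openin T \<UU>"
proof (rule openin_subopen[THEN iffD2], intro ballI)
  fix x assume x: "x \<in> \<UU>"
  then obtain F where F: "bisection G F" "x \<in> F" using arrow_bisection unitD by metis
  have FY: "F \<subseteq> \<AA>" "slice F" using F bisection_slice slice_def by auto
  let ?V = "F \<inter> \<UU>"
  have V: "openin UT ?V" unfolding unit_topology_def using F by (auto simp: openin_subtopology bisection_def)
  then have "openin T {f \<in> \<AA>. \<s> f \<in> ?V}"
    using openin_continuous_map_preimage[OF cont_src V] by simp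
  moreover have "{f \<in> \<AA>. \<s> f \<in> ?V} \<inter> F = ?V"
  proof (intro equalityI subsetI)
    fix f assume "f \<in> {f \<in> \<AA>. \<s> f \<in> ?V} \<inter> F"
    then have "f = \<s> f" "\<s> f \<in> \<UU>" using slice_src_inj[OF FY(2), of f "\<s> f"] by auto
    then show "f \<in> ?V" using \<open>f \<in> _\<close> by auto
  qed (use unitD FY(1) in auto)
  ultimately have "openin T ?V" using F(1) openin_Int by (fastforce simp: bisection_def)
  then show "\<exists>S. openin T S \<and> x \<in> S \<and> S \<subseteq> \<UU>" using F x by blast
qed

lemma openin_UT: "openin UT U \<longleftrightarrow> openin T U \<and> U \<subseteq> \<UU>"
  unfolding unit_topology_def by (rule openin_open_subtopology[OF open_units])

text \<open>Source and range are continuous and open, so injectivity on an open set already makes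
  them homeomorphisms onto open images.\<close>

lemma bisection_iff: "bisection G F \<longleftrightarrow> compactin T F \<and> openin T F \<and> slice F"
proof
  assume F: "compactin T F \<and> openin T F \<and> slice F"
  then have FY: "F \<subseteq> \<AA>" by (auto simp: slice_def)
  have *: "homeomorphic_map (subtopology T F) (subtopology UT (f ` F)) f"
    if f: "continuous_map T UT f" "\<And>U. openin T U \<Longrightarrow> openin UT (f ` U)" "inj_on f F" for f
  proof (rule bijective_open_imp_homeomorphic_map)
    have fX: "f ` F \<subseteq> \<UU>" using f(2)[of F] F openin_subset by fastforce
    show "continuous_map (subtopology T F) (subtopology UT (f ` F)) f"
      using f(1) by (auto simp: continuous_map_in_subtopology continuous_map_from_subtopology)
    show "open_map (subtopology T F) (subtopology UT (f ` F)) f"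
      unfolding open_map_def using F f(2) openin_open_subtopology[of T F]
        openin_open_subtopology[of UT "f ` F"] by auto
    show "f ` topspace (subtopology T F) = topspace (subtopology UT (f ` F))" using FY fX by auto
    show "inj_on f (topspace (subtopology T F))" using f(3) FY by (auto simp: Int_absorb1)
  qed
  show "bisection G F" unfolding bisection_def using F *[OF cont_src] *[OF cont_rng] open_src_image open_rng_image
    by (auto simp: slice_def)
qed (auto simp: bisection_slice bisection_def)

end

context cantor_groupoid
begin

text \<open>The clopen subsets of the unit space (\<open>clop_iff\<close>), phrased by compactness
  in the arrow space to match \<open>bisection_iff\<close>. Within the arrow space such a set need
  not be closed.\<close>

definition clop where "clop U \<longleftrightarrow> openin T U \<and> compactin T U \<and> U \<subseteq> \<UU>"

lemma compact_UT: "compact_space UT" and Hausdorff_UT: "Hausdorff_space UT"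
proof -
  have "compact_space cantor_space" "Hausdorff_space cantor_space"
    by (auto simp: cantor_space_def compact_space_product_topology Hausdorff_space_product_topology
      compact_space_discrete_topology)
  then show "compact_space UT" "Hausdorff_space UT"
    using cantor homeomorphic_compact_space homeomorphic_Hausdorff_space by blast+
qed

lemma clop_iff: "clop U \<longleftrightarrow> openin UT U \<and> closedin UT U"
proof -
  have "compactin T U \<and> U \<subseteq> \<UU> \<longleftrightarrow> compactin UT U" by (auto simp: unit_topology_def compactin_subtopology)
  then show ?thesis unfolding clop_def openin_UT
    using closedin_compact_space[OF compact_UT] compactin_imp_closedin[OF Hausdorff_UT] by blast
qed

lemma clop_subset: "clop U \<Longrightarrow> u \<in> U \<Longrightarrow> u \<in> \<UU>" by (auto simp: clop_def)

lemma clop_ops [intro]: "clop \<UU>" "clop {}" "clop U \<Longrightarrow> clop V \<Longrightarrow> clop (U \<inter> V)"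
  "clop U \<Longrightarrow> clop V \<Longrightarrow> clop (U \<union> V)" "clop U \<Longrightarrow> clop V \<Longrightarrow> clop (U - V)"
  using openin_topspace[of UT] closedin_topspace[of UT] by (auto simp: clop_iff)

lemma clop_basis: assumes "openin T U" "x \<in> U" "x \<in> \<UU>"
  obtains K where "clop K" "x \<in> K" "K \<subseteq> U"
proof -
  have "openin UT (U \<inter> \<UU>)" using assms open_units by (auto simp: openin_UT)
  then have "\<exists>K. openin UT K \<and> closedin UT K \<and> x \<in> K \<and> K \<subseteq> U \<inter> \<UU>"
    by (intro homeomorphic_space_clopen_basis[OF cantor cantor_space_clopen_basis]) (use assms in auto)
  then show ?thesis using that by (auto simp: clop_iff)
qed

lemma clop_separate: assumes "x \<in> \<UU>" "y \<in> \<UU>" "x \<noteq> y"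
  obtains K where "clop K" "x \<in> K" "y \<notin> K"
proof -
  obtain U where "openin UT U" "x \<in> U" "y \<notin> U"
    using Hausdorff_UT[unfolded Hausdorff_space_def, rule_format, of x y] assms by (auto simp: disjnt_iff)
  then have "openin T U" by (simp add: openin_UT)
  then obtain K where "clop K" "x \<in> K" "K \<subseteq> U" by (rule clop_basis) (use \<open>x \<in> U\<close> assms in auto)
  then show ?thesis using that \<open>y \<notin> U\<close> by blast
qed

lemma clop_compact: assumes "clop U" "\<And>x. x \<in> U \<Longrightarrow> \<exists>V. clop V \<and> x \<in> V \<and> P V"
  obtains \<V> where "finite \<V>" "\<And>V. V \<in> \<V> \<Longrightarrow> clop V \<and> P V" "U \<subseteq> \<Union>\<V>"
proof -
  have "compactin T U" using assms by (simp add: clop_def)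
  moreover have "U \<subseteq> \<Union>{V. clop V \<and> P V}" using assms by blast
  ultimately obtain \<V> where "finite \<V>" "\<V> \<subseteq> {V. clop V \<and> P V}" "U \<subseteq> \<Union>\<V>"
    using compactinD[of T U "{V. clop V \<and> P V}"] by (auto simp: clop_def)
  then show ?thesis using that by blast
qed

lemma bisection_clop: assumes "bisection G F" shows "clop (\<s> ` F)" "clop (\<r> ` F)"
proof -
  have F: "compactin T F" "openin T F" using assms by (auto simp: bisection_iff)
  have "compactin UT (\<s> ` F)" "compactin UT (\<r> ` F)"
    using image_compactin[OF F(1) cont_src] image_compactin[OF F(1) cont_rng] by auto
  then show "clop (\<s> ` F)" "clop (\<r> ` F)" 
    using open_src_image[OF F(2)] open_rng_image[OF F(2)] compactin_imp_closedin[OF Hausdorff_UT]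
    by (auto simp: clop_iff)
qed

lemma clop_bisection: assumes "clop U" shows "bisection G U"
  using assms units_subset by (auto simp: clop_def bisection_iff slice_def inj_on_def unitD subset_iff)

definition restr where "restr F U = {f \<in> F. \<s> f \<in> U}"

lemma bisection_subset: assumes "bisection G F" "closedin UT C" "openin UT C"
  shows "bisection G {f \<in> F. \<s> f \<in> C}" "bisection G {f \<in> F. \<r> f \<in> C}"
proof -
  have F: "compactin T F" "openin T F" "slice F" "F \<subseteq> \<AA>" using assms bisection_iff slice_def by auto
  have *: "bisection G {f \<in> F. p f \<in> C}" if p: "continuous_map T UT p" for p
  proof -
    have eq: "{f \<in> F. p f \<in> C} = {f \<in> \<AA>. p f \<in> C} \<inter> F" using F by auto
    have "closedin T {f \<in> \<AA>. p f \<in> C}" "openin T {f \<in> \<AA>. p f \<in> C}"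
      using closedin_continuous_map_preimage[OF p assms(2)] openin_continuous_map_preimage[OF p assms(3)] by auto
    then have "compactin T {f \<in> F. p f \<in> C}" "openin T {f \<in> F. p f \<in> C}"
      unfolding eq using F by (auto intro: closed_Int_compactin)
    then show ?thesis using F(3) unfolding bisection_iff slice_def
      by (auto intro: inj_on_subset)
  qed
  show "bisection G {f \<in> F. \<s> f \<in> C}" "bisection G {f \<in> F. \<r> f \<in> C}" using *[OF cont_src] *[OF cont_rng] .
qed

lemma bisection_restr: "bisection G F \<Longrightarrow> clop U \<Longrightarrow> bisection G (restr F U)"
  unfolding restr_def by (simp add: bisection_subset clop_iff)

lemma bisection_inv: assumes "bisection G F" shows "bisection G (gset_inv G F)"
proof -
  have F: "compactin T F" "openin T F" "slice F" "F \<subseteq> \<AA>" using assms bisection_iff slice_def by auto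
  have "compactin T (\<i> ` F)" using image_compactin[OF F(1) continuous_inv] .
  moreover have "\<i> ` F = {g \<in> \<AA>. \<i> g \<in> F}" using F(4) by (force simp: image_iff)
  moreover have "openin T {g \<in> \<AA>. \<i> g \<in> F}" using openin_continuous_map_preimage[OF continuous_inv F(2)] by simp
  ultimately show ?thesis using slice_inv[OF F(3)] by (simp add: bisection_iff gset_inv_def)
qed

lemma cont_sec: assumes "bisection G F" shows "continuous_map (subtopology UT (\<s> ` F)) T (sec F)"
proof -
  have "homeomorphic_map (subtopology T F) (subtopology UT (\<s> ` F)) \<s>" using assms by (simp add: bisection_def)
  then obtain g where g: "homeomorphic_maps (subtopology T F) (subtopology UT (\<s> ` F)) \<s> g"
    by (auto simp: homeomorphic_map_maps)
  have FY: "F \<subseteq> \<AA>" "slice F" using assms bisection_slice slice_def by auto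
  have "\<s> ` F \<subseteq> \<UU>" using bisection_clop[OF assms] by (simp add: clop_def)
  have "continuous_map (subtopology UT (\<s> ` F)) T g"
    using g by (auto simp: homeomorphic_maps_def continuous_map_in_subtopology)
  moreover have "g y = sec F y" if "y \<in> topspace (subtopology UT (\<s> ` F))" for y
    using g that FY by (auto simp: homeomorphic_maps_def subset_iff)
  ultimately show ?thesis by (metis continuous_map_eq)
qed

text \<open>Compactness and openness come from two descriptions of the product: it is the image of a
  compact part of \<open>B\<close> under left multiplication by \<open>A\<close>, and the preimage
  of \<open>B\<close> under left multiplication by the inverse of \<open>A\<close>.\<close>

lemma bisection_mult: assumes "bisection G A" "bisection G B" shows "bisection G (gset_mult G A B)"
proof -
  have A: "compactin T A" "openin T A" "slice A" "A \<subseteq> \<AA>" using assms bisection_iff slice_def by auto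
  have B: "compactin T B" "openin T B" "slice B" "B \<subseteq> \<AA>" using assms bisection_iff slice_def by auto
  note Ai = bisection_inv[OF assms(1)]
  have sA: "clop (\<s> ` A)" "clop (\<r> ` A)" using bisection_clop assms(1) by auto
  let ?B = "{b \<in> B. \<r> b \<in> \<s> ` A}"
  have B': "bisection G ?B" using sA assms(2) by (intro bisection_subset) (auto simp: clop_iff)
  have 1: "continuous_map (subtopology T ?B) T (\<lambda>b. sec A (\<r> b) \<star> b)"
  proof (rule cont_mult_pair)
    have "continuous_map (subtopology T ?B) (subtopology UT (\<s> ` A)) \<r>"
      using cont_rng by (auto simp: continuous_map_in_subtopology continuous_map_from_subtopology)
    from continuous_map_compose[OF this cont_sec[OF assms(1)]]
    show "continuous_map (subtopology T ?B) T (\<lambda>b. sec A (\<r> b))" by (simp add: o_def)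
    show "continuous_map (subtopology T ?B) T (\<lambda>b. b)" 
      using continuous_map_from_subtopology[OF continuous_map_id] by (simp add: id_def)
  qed (use secD(2)[OF A(3)] in auto)
  have "gset_mult G A B = (\<lambda>b. sec A (\<r> b) \<star> b) ` ?B"
  proof (intro equalityI subsetI)
    fix x assume "x \<in> gset_mult G A B"
    then obtain a b where ab: "a \<in> A" "b \<in> B" "a \<in> \<AA>" "b \<in> \<AA>" "\<s> a = \<r> b" "x = a \<star> b"
      by (auto elim!: gset_multE)
    then have "sec A (\<r> b) = a" using A(3) sec_eqI by blast
    moreover have "\<r> b \<in> \<s> ` A" using ab by (metis image_eqI)
    ultimately show "x \<in> (\<lambda>b. sec A (\<r> b) \<star> b) ` ?B" using ab by (intro image_eqI[of _ _ b]) auto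
  next
    fix x assume "x \<in> (\<lambda>b. sec A (\<r> b) \<star> b) ` ?B"
    then obtain b where "b \<in> B" "\<r> b \<in> \<s> ` A" "x = sec A (\<r> b) \<star> b" by auto
    then show "x \<in> gset_mult G A B" using secD[OF A(3)] B(4) by (auto intro!: gset_multI)
  qed
  moreover have "compactin T ((\<lambda>b. sec A (\<r> b) \<star> b) ` ?B)"
    using B' image_compactin[OF _ 1] compactin_absolute[of T ?B] by (simp add: bisection_iff)
  ultimately have cpt: "compactin T (gset_mult G A B)" by simp
  let ?R = "{g \<in> \<AA>. \<r> g \<in> \<s> ` gset_inv G A}"
  have iA: "\<s> ` gset_inv G A = \<r> ` A" "slice (gset_inv G A)" using inv_image A slice_inv by auto
  have oR: "openin T ?R" using openin_continuous_map_preimage[OF cont_rng, of "\<s> ` gset_inv G A"] sA iA by (auto simp: clop_iff)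
  have 2: "continuous_map (subtopology T ?R) T (\<lambda>g. sec (gset_inv G A) (\<r> g) \<star> g)"
  proof (rule cont_mult_pair)
    have "continuous_map (subtopology T ?R) (subtopology UT (\<s> ` gset_inv G A)) \<r>"
      using cont_rng by (auto simp: continuous_map_in_subtopology continuous_map_from_subtopology)
    from continuous_map_compose[OF this cont_sec[OF Ai]]
    show "continuous_map (subtopology T ?R) T (\<lambda>g. sec (gset_inv G A) (\<r> g))" by (simp add: o_def)
    show "continuous_map (subtopology T ?R) T (\<lambda>b. b)" 
      using continuous_map_from_subtopology[OF continuous_map_id] by (simp add: id_def)
  qed (use secD(2)[OF iA(2)] in auto)
  have "openin T {g \<in> ?R. sec (gset_inv G A) (\<r> g) \<star> g \<in> B}"
    using openin_continuous_map_preimage[OF 2 B(2)] oR openin_open_subtopology[OF oR]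
    by (auto simp: conj_ac)
  moreover have "{g \<in> ?R. sec (gset_inv G A) (\<r> g) \<star> g \<in> B} = gset_mult G A B"
  proof (intro equalityI subsetI)
    fix x assume "x \<in> gset_mult G A B"
    then obtain a b where ab: "a \<in> A" "b \<in> B" "a \<in> \<AA>" "b \<in> \<AA>" "\<s> a = \<r> b" "x = a \<star> b"
      by (auto elim!: gset_multE)
    then have "sec (gset_inv G A) (\<r> a) = \<i> a" by (intro sec_eqI iA) (auto simp: gset_inv_def)
    then show "x \<in> {g \<in> ?R. sec (gset_inv G A) (\<r> g) \<star> g \<in> B}" using ab iA by auto
  next
    fix x assume x: "x \<in> {g \<in> ?R. sec (gset_inv G A) (\<r> g) \<star> g \<in> B}"
    then obtain a where a: "a \<in> A" "\<r> x = \<r> a" "x \<in> \<AA>" using iA by auto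
    then have "a \<in> \<AA>" using A by auto
    have "sec (gset_inv G A) (\<r> a) = \<i> a" using a \<open>a \<in> \<AA>\<close> by (intro sec_eqI iA) (auto simp: gset_inv_def)
    then have "\<i> a \<star> x \<in> B" using x a by auto
    then have "a \<star> (\<i> a \<star> x) \<in> gset_mult G A B" using a \<open>a \<in> \<AA>\<close> by (intro gset_multI) auto
    then show "x \<in> gset_mult G A B" using a \<open>a \<in> \<AA>\<close> by simp
  qed
  ultimately show ?thesis using cpt slice_mult A B by (simp add: bisection_iff)
qed

lemma bisection_Un: assumes "bisection G A" "bisection G B"
    "\<s> ` A \<inter> \<s> ` B = {}" "\<r> ` A \<inter> \<r> ` B = {}"
  shows "bisection G (A \<union> B)"
proof -
  have "inj_on \<s> (A \<union> B)" "inj_on \<r> (A \<union> B)"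
    using assms by (auto simp: bisection_iff slice_def inj_on_Un)
  then show ?thesis using assms by (auto simp: bisection_iff slice_def compactin_Un)
qed

section \<open>The topological full group\<close>

lemma full_iff: "full_group G = \<lparr>carrier = {F. bisection G F \<and> full F}, mult = gset_mult G, one = \<UU>\<rparr>"
  by (auto simp: full_group_def full_def bisection_slice)

lemma full_group_simps [simp]: "x \<otimes>\<^bsub>full_group G\<^esub> y = gset_mult G x y" "\<one>\<^bsub>full_group G\<^esub> = \<UU>"
  "F \<in> carrier (full_group G) \<longleftrightarrow> bisection G F \<and> full F"
  by (auto simp: full_iff)

lemma full_units: "full \<UU>" using units_subset by (auto simp: full_def slice_def inj_on_def unitD)

lemma group_full_group: "group (full_group G)"
proof (rule groupI)
  fix x y z assume x: "x \<in> carrier (full_group G)" and y: "y \<in> carrier (full_group G)"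
    and z: "z \<in> carrier (full_group G)"
  have b: "bisection G x" "full x" "bisection G y" "full y" using x y by auto
  have "gset_mult G (gset_inv G x) x = \<UU>" using inv_gset_mult[of x] b(2) by (simp add: full_def)
  then show "\<exists>y\<in>carrier (full_group G). y \<otimes>\<^bsub>full_group G\<^esub> x = \<one>\<^bsub>full_group G\<^esub>"
    using b by (intro bexI[of _ "gset_inv G x"]) (simp_all add: full_inv bisection_inv)
  have "x \<subseteq> \<AA>" using bisection_slice[OF b(1)] by (simp add: slice_def)
  then have "gset_mult G \<UU> x = x" by (rule units_gset_mult) (use \<open>x \<subseteq> \<AA>\<close> in auto)
  then show "\<one>\<^bsub>full_group G\<^esub> \<otimes>\<^bsub>full_group G\<^esub> x = x" by simp
  show "x \<otimes>\<^bsub>full_group G\<^esub> y \<in> carrier (full_group G)"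
    using full_mult[OF b(2,4)] bisection_mult[OF b(1,3)] by simp
  show "x \<otimes>\<^bsub>full_group G\<^esub> y \<otimes>\<^bsub>full_group G\<^esub> z = x \<otimes>\<^bsub>full_group G\<^esub> (y \<otimes>\<^bsub>full_group G\<^esub> z)"
    by (simp add: gset_mult_assoc)
next
  show "\<one>\<^bsub>full_group G\<^esub> \<in> carrier (full_group G)"
    using full_units clop_bisection[OF clop_ops(1)] by simp
qed

lemma FG_inv: assumes "F \<in> carrier (full_group G)" shows "inv\<^bsub>full_group G\<^esub> F = gset_inv G F"
proof (rule group.inv_equality[OF group_full_group])
  have b: "bisection G F" "full F" using assms by auto
  then show "gset_inv G F \<otimes>\<^bsub>full_group G\<^esub> F = \<one>\<^bsub>full_group G\<^esub>"
    using inv_gset_mult[of F] by (simp add: full_def)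
  show "gset_inv G F \<in> carrier (full_group G)" using b by (simp add: full_inv bisection_inv)
qed (rule assms)

section \<open>Commutators of 3-cycles\<close>

text \<open>A triple of arrows stands for three germs that \<open>c\<close> permutes cyclically.
  Fixing is demanded of units only, since \<open>act_fix\<close> carries it to all arrows with that
  range. For triples with a common source the two clauses determine \<open>c\<close>
  (\<open>is_cycle_unique\<close>).\<close>

definition is_cycle where "is_cycle c \<Theta> \<longleftrightarrow>
  (\<forall>(a, b, d) \<in> \<Theta>. act c a = b \<and> act c b = d \<and> act c d = a) \<and>
  (\<forall>u \<in> \<UU>. (\<forall>(a, b, d) \<in> \<Theta>. u \<noteq> \<r> a \<and> u \<noteq> \<r> b \<and> u \<noteq> \<r> d) \<longrightarrow> act c u = u)"

definition same_source where "same_source \<Theta> \<longleftrightarrow>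
  (\<forall>(a, b, d) \<in> \<Theta>. a \<in> \<AA> \<and> b \<in> \<AA> \<and> d \<in> \<AA> \<and> \<s> b = \<s> a \<and> \<s> d = \<s> a)"

definition has_cycle where "has_cycle H \<Theta> \<longleftrightarrow> (\<exists>c \<in> H. is_cycle c \<Theta>)"

lemma is_cycleD: assumes "is_cycle c \<Theta>" "(a, b, d) \<in> \<Theta>" shows "act c a = b" "act c b = d" "act c d = a"
  using assms by (auto simp: is_cycle_def)

lemma is_cycle_shift: assumes "is_cycle c \<Theta>" "(a, b, d) \<in> \<Theta>" "same_source \<Theta>" "full c" "h \<in> \<AA>" "\<s> a = \<r> h"
  shows "act c (a \<star> h) = b \<star> h" "act c (b \<star> h) = d \<star> h" "act c (d \<star> h) = a \<star> h"
  using is_cycleD[OF assms(1,2)] assms by (fastforce simp: same_source_def act_mult)+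

lemma same_sourceD: assumes "same_source \<Theta>" "(a, b, d) \<in> \<Theta>"
  shows "a \<in> \<AA>" "b \<in> \<AA>" "d \<in> \<AA>" "\<s> b = \<s> a" "\<s> d = \<s> a"
  using assms by (auto simp: same_source_def)

lemma act_fix: assumes "full c" "g \<in> \<AA>" "act c (\<r> g) = \<r> g" shows "act c g = g"
  using act_mult[of c "\<r> g" g] assms by simp

lemma is_cycle_fix: assumes "is_cycle c \<Theta>" "full c" "g \<in> \<AA>"
    "\<And>a b d. (a, b, d) \<in> \<Theta> \<Longrightarrow> \<r> g \<noteq> \<r> a \<and> \<r> g \<noteq> \<r> b \<and> \<r> g \<noteq> \<r> d"
  shows "act c g = g"
proof (rule act_fix[OF assms(2,3)])
  have "\<forall>u \<in> \<UU>. (\<forall>(a, b, d) \<in> \<Theta>. u \<noteq> \<r> a \<and> u \<noteq> \<r> b \<and> u \<noteq> \<r> d) \<longrightarrow> act c u = u"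
    using assms(1) unfolding is_cycle_def by (rule conjunct2)
  moreover have "\<r> g \<in> \<UU>" using assms(3) by (rule unitI)
  moreover have "\<forall>(a, b, d) \<in> \<Theta>. \<r> g \<noteq> \<r> a \<and> \<r> g \<noteq> \<r> b \<and> \<r> g \<noteq> \<r> d" using assms(4) by blast
  ultimately show "act c (\<r> g) = \<r> g" by blast
qed

lemma act_inv_eq: assumes "full c" "g \<in> \<AA>" "act c g = h" shows "act (gset_inv G c) h = g"
  using act_inv assms by blast

text \<open>The same group element serves for both sets of triples, since the action commutes with
  right multiplication. \<open>sub\<close> gives the cycling of the shifted triples;
  \<open>sup\<close> ensures that no part of the support is lost, so that the fixing clause
  survives.\<close>

lemma has_cycle_shift:
  assumes H: "subgroup H (full_group G)" and HC: "has_cycle H \<Theta>" and t: "same_source \<Theta>"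
    and sub: "\<And>t. t \<in> \<Theta>' \<Longrightarrow> \<exists>a b d h. (a, b, d) \<in> \<Theta> \<and> h \<in> \<AA> \<and> \<s> a = \<r> h \<and> t = (a \<star> h, b \<star> h, d \<star> h)"
    and sup: "\<And>a b d. (a, b, d) \<in> \<Theta> \<Longrightarrow> \<exists>h. h \<in> \<AA> \<and> \<s> a = \<r> h \<and> (a \<star> h, b \<star> h, d \<star> h) \<in> \<Theta>'"
  shows "has_cycle H \<Theta>'"
proof -
  obtain c where c: "c \<in> H" "is_cycle c \<Theta>" using HC by (auto simp: has_cycle_def)
  then have f: "full c" using subgroup.mem_carrier[OF H] by auto
  have "is_cycle c \<Theta>'" unfolding is_cycle_def
  proof (intro conjI ballI impI)
    fix t assume "t \<in> \<Theta>'"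
    then obtain a b d h where "(a, b, d) \<in> \<Theta>" "h \<in> \<AA>" "\<s> a = \<r> h" "t = (a \<star> h, b \<star> h, d \<star> h)" using sub by blast
    then show "case t of (a, b, d) \<Rightarrow> act c a = b \<and> act c b = d \<and> act c d = a"
      using is_cycle_shift[OF c(2) _ t f] by auto
  next
    fix u assume u: "u \<in> \<UU>" "\<forall>(a, b, d) \<in> \<Theta>'. u \<noteq> \<r> a \<and> u \<noteq> \<r> b \<and> u \<noteq> \<r> d"
    have "u \<noteq> \<r> a \<and> u \<noteq> \<r> b \<and> u \<noteq> \<r> d" if abd: "(a, b, d) \<in> \<Theta>" for a b d
    proof -
      obtain h where "h \<in> \<AA>" "\<s> a = \<r> h" "(a \<star> h, b \<star> h, d \<star> h) \<in> \<Theta>'" using sup abd by blast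
      then show ?thesis using u(2) same_sourceD[OF t abd] by fastforce
    qed
    then show "act c u = u" using unitD[OF u(1)] by (intro is_cycle_fix[OF c(2) f]) simp_all
  qed
  then show ?thesis using c by (auto simp: has_cycle_def)
qed

text \<open>The model computation is \<open>[(a b e), (e d f)] = (a d e)\<close> in a symmetric group.\<close>

lemma has_cycle_commutator:
  assumes H: "subgroup H (full_group G)" and HC: "has_cycle H \<Theta>\<^sub>1" "has_cycle H \<Theta>\<^sub>2"
    and t: "same_source \<Theta>\<^sub>1" "same_source \<Theta>\<^sub>2"
    and disj: "\<And>a b e e' d f. (a, b, e) \<in> \<Theta>\<^sub>1 \<Longrightarrow> (e', d, f) \<in> \<Theta>\<^sub>2 \<Longrightarrow>
        {\<r> a, \<r> b} \<inter> {\<r> e', \<r> d, \<r> f} = {} \<and> \<r> e \<notin> {\<r> d, \<r> f}"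
    and sub: "\<And>t. t \<in> \<Theta>\<^sub>3 \<Longrightarrow> \<exists>a b e h e' d f k. (a, b, e) \<in> \<Theta>\<^sub>1 \<and> (e', d, f) \<in> \<Theta>\<^sub>2 \<and> h \<in> \<AA> \<and> k \<in> \<AA> \<and>
        \<s> a = \<r> h \<and> \<s> e' = \<r> k \<and> e \<star> h = e' \<star> k \<and> t = (a \<star> h, d \<star> k, e \<star> h)"
    and sup: "\<And>a b e e' d f. (a, b, e) \<in> \<Theta>\<^sub>1 \<Longrightarrow> (e', d, f) \<in> \<Theta>\<^sub>2 \<Longrightarrow> \<r> e = \<r> e' \<Longrightarrow>
        \<exists>(a', d', e'') \<in> \<Theta>\<^sub>3. \<r> a' = \<r> a \<and> \<r> d' = \<r> d \<and> \<r> e'' = \<r> e"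
  shows "has_cycle H \<Theta>\<^sub>3"
proof -
  obtain x where x: "x \<in> H" "is_cycle x \<Theta>\<^sub>1" using HC by (auto simp: has_cycle_def)
  obtain y where y: "y \<in> H" "is_cycle y \<Theta>\<^sub>2" using HC by (auto simp: has_cycle_def)
  have xc: "x \<in> carrier (full_group G)" and yc: "y \<in> carrier (full_group G)" using x y subgroup.mem_carrier[OF H] by auto
  then have fx: "full x" and fy: "full y" by auto
  let ?x = "gset_inv G x" let ?y = "gset_inv G y"
  have fi: "full ?x" "full ?y" using fx fy full_inv by auto
  have mem: "?x \<in> H" "?y \<in> H" using subgroup.m_inv_closed[OF H] x y FG_inv xc yc by metis+
  define z where "z = gset_mult G x (gset_mult G y (gset_mult G ?x ?y))"
  have zH: "z \<in> H" unfolding z_def using subgroup.m_closed[OF H] x y mem by simp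
  have z: "act z g = act x (act y (act ?x (act ?y g)))" if "g \<in> \<AA>" for g
    unfolding z_def using that by (simp add: act_comp full_mult fx fy fi)
  note xi = act_inv_eq[OF fx] note yi = act_inv_eq[OF fy]
  \<comment> \<open>By \<open>disj\<close> the supports can touch only where a third entry of the
    first family meets a first entry of the second, so \<open>y\<close> fixes whatever ends at the
    other two entries.\<close>
  have Fy: "act y g = g" if "g \<in> \<AA>" "(a, b, e) \<in> \<Theta>\<^sub>1" "\<r> g = \<r> a \<or> \<r> g = \<r> b" for g a b e
  proof (rule is_cycle_fix[OF y(2) fy that(1)])
    fix a' b' c' assume "(a', b', c') \<in> \<Theta>\<^sub>2"
    from disj[OF that(2) this] that(3) show "\<r> g \<noteq> \<r> a' \<and> \<r> g \<noteq> \<r> b' \<and> \<r> g \<noteq> \<r> c'" by auto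
  qed
  have Fx: "act x g = g" if "g \<in> \<AA>" "(e', d, f) \<in> \<Theta>\<^sub>2" "\<r> g = \<r> d \<or> \<r> g = \<r> f" for g e' d f
  proof (rule is_cycle_fix[OF x(2) fx that(1)])
    fix a' b' c' assume "(a', b', c') \<in> \<Theta>\<^sub>1"
    from disj[OF this that(2)] that(3) show "\<r> g \<noteq> \<r> a' \<and> \<r> g \<noteq> \<r> b' \<and> \<r> g \<noteq> \<r> c'" by auto
  qed
  \<comment> \<open>Where no such contact occurs, \<open>y\<close> fixes the third entry as
    well.\<close>
  have Fy': "act y g = g" if "g \<in> \<AA>" "(a, b, e) \<in> \<Theta>\<^sub>1" "\<r> g = \<r> e"
    and n: "\<And>e' d f. (e', d, f) \<in> \<Theta>\<^sub>2 \<Longrightarrow> \<r> e \<noteq> \<r> e'" for g a b e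
  proof (rule is_cycle_fix[OF y(2) fy that(1)])
    fix a' b' c' assume *: "(a', b', c') \<in> \<Theta>\<^sub>2"
    from disj[OF that(2) this] that(3) n[OF *]
    show "\<r> g \<noteq> \<r> a' \<and> \<r> g \<noteq> \<r> b' \<and> \<r> g \<noteq> \<r> c'" by auto
  qed
  have Fx': "act x g = g" if "g \<in> \<AA>" "(e', d, f) \<in> \<Theta>\<^sub>2" "\<r> g = \<r> e'"
    and n: "\<And>a b e. (a, b, e) \<in> \<Theta>\<^sub>1 \<Longrightarrow> \<r> e \<noteq> \<r> e'" for g e' d f
  proof (rule is_cycle_fix[OF x(2) fx that(1)])
    fix a' b' c' assume *: "(a', b', c') \<in> \<Theta>\<^sub>1"
    from disj[OF this that(2)] that(3) n[OF *]
    show "\<r> g \<noteq> \<r> a' \<and> \<r> g \<noteq> \<r> b' \<and> \<r> g \<noteq> \<r> c'" by auto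
  qed
  \<comment> \<open>The five-point computation. The shifts \<open>h\<close> and \<open>k\<close>
    align the sources so that both triples contain the same arrow
    \<open>e \<star> h\<close>.\<close>
  have main: "act z (a \<star> h) = d \<star> k \<and> act z (d \<star> k) = e \<star> h \<and> act z (e \<star> h) = a \<star> h
      \<and> act z (b \<star> h) = b \<star> h \<and> act z (f \<star> k) = f \<star> k"
    if 1: "(a, b, e) \<in> \<Theta>\<^sub>1" "h \<in> \<AA>" "\<s> a = \<r> h" and 2: "(e', d, f) \<in> \<Theta>\<^sub>2" "k \<in> \<AA>" "\<s> e' = \<r> k"
      and eq: "e \<star> h = e' \<star> k" for a b e h e' d f k
  proof -
    note X = is_cycle_shift[OF x(2) 1(1) t(1) fx 1(2,3)]
    note Y = is_cycle_shift[OF y(2) 2(1) t(2) fy 2(2,3)]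
    note T1 = same_sourceD[OF t(1) 1(1)] note T2 = same_sourceD[OF t(2) 2(1)]
    have fixes_y: "act y (a \<star> h) = a \<star> h" "act y (b \<star> h) = b \<star> h"
      by (rule Fy[OF _ 1(1)]; use T1 1 in simp)+
    have fixes_x: "act x (d \<star> k) = d \<star> k" "act x (f \<star> k) = f \<star> k"
      by (rule Fx[OF _ 2(1)]; use T2 2 in simp)+
    have cl: "a \<star> h \<in> \<AA>" "b \<star> h \<in> \<AA>" "e \<star> h \<in> \<AA>" "d \<star> k \<in> \<AA>" "f \<star> k \<in> \<AA>" "e' \<star> k \<in> \<AA>"
      using T1 T2 1 2 by auto
    note eqA = eq[symmetric]
    have iX: "act ?x (b \<star> h) = a \<star> h" "act ?x (e \<star> h) = b \<star> h" "act ?x (a \<star> h) = e \<star> h"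
      using xi[OF _ X(1)] xi[OF _ X(2)] xi[OF _ X(3)] cl by simp_all
    have iY: "act ?y (d \<star> k) = e \<star> h" "act ?y (f \<star> k) = d \<star> k" "act ?y (e \<star> h) = f \<star> k"
      using yi[OF _ Y(1)] yi[OF _ Y(2)] yi[OF _ Y(3)] cl by (simp_all add: eq)
    have Y': "act y (e \<star> h) = d \<star> k" "act y (d \<star> k) = f \<star> k" "act y (f \<star> k) = e \<star> h" 
      using Y by (simp_all add: eq)
    have ifx: "act ?x (d \<star> k) = d \<star> k" "act ?x (f \<star> k) = f \<star> k" 
      "act ?y (a \<star> h) = a \<star> h" "act ?y (b \<star> h) = b \<star> h" 
      using xi[OF _ fixes_x(1)] xi[OF _ fixes_x(2)] yi[OF _ fixes_y(1)] yi[OF _ fixes_y(2)] cl by simp_all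
    show ?thesis
      using z[OF cl(1)] z[OF cl(2)] z[OF cl(3)] z[OF cl(4)] z[OF cl(5)]
      by (simp add: X Y' fixes_x fixes_y iX iY ifx)
  qed
  have "is_cycle z \<Theta>\<^sub>3" unfolding is_cycle_def
  proof (intro conjI ballI impI)
    fix t assume "t \<in> \<Theta>\<^sub>3"
    then show "case t of (a, b, d) \<Rightarrow> act z a = b \<and> act z b = d \<and> act z d = a"
    proof -
      obtain a b e h e' d f k where *: "(a, b, e) \<in> \<Theta>\<^sub>1" "h \<in> \<AA>" "\<s> a = \<r> h" "(e', d, f) \<in> \<Theta>\<^sub>2" "k \<in> \<AA>"
        "\<s> e' = \<r> k" "e \<star> h = e' \<star> k" and t: "t = (a \<star> h, d \<star> k, e \<star> h)"
        using sub[OF \<open>t \<in> \<Theta>\<^sub>3\<close>] by metis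
      show ?thesis unfolding t using main[OF *] by simp
    qed
  next
    fix u assume u: "u \<in> \<UU>" and out: "\<forall>(a, b, d) \<in> \<Theta>\<^sub>3. u \<noteq> \<r> a \<and> u \<noteq> \<r> b \<and> u \<noteq> \<r> d"
    have uA: "u \<in> \<AA>" "\<r> u = u" using u unitD by auto
    have "act x u = u" if "\<not> (\<exists>a b e. (a, b, e) \<in> \<Theta>\<^sub>1 \<and> u \<in> {\<r> a, \<r> b, \<r> e})"
      by (rule is_cycle_fix[OF x(2) fx uA(1)]) (use uA that in auto)
    moreover have "act y u = u" if "\<not> (\<exists>a b e. (a, b, e) \<in> \<Theta>\<^sub>2 \<and> u \<in> {\<r> a, \<r> b, \<r> e})"
      by (rule is_cycle_fix[OF y(2) fy uA(1)]) (use uA that in auto)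
    ultimately consider (x) a b e where "(a, b, e) \<in> \<Theta>\<^sub>1" "u \<in> {\<r> a, \<r> b, \<r> e}"
      | (y) a b e where "(a, b, e) \<in> \<Theta>\<^sub>2" "u \<in> {\<r> a, \<r> b, \<r> e}"
      | (n) "act x u = u" "act y u = u" by metis
    then show "act z u = u"
    proof cases
      case n
      then show ?thesis using z[OF uA(1)] xi[OF uA(1)] yi[OF uA(1)] by simp
    next
      case (x a b e)
      note T1 = same_sourceD[OF t(1) x(1)]
      have "\<exists>g\<in>{a, b, e}. u = \<r> g" using x by auto
      then obtain g where g: "g \<in> {a, b, e}" "u = \<r> g" by auto
      \<comment> \<open>Shifting by this inverse turns the entry \<open>g\<close> into the unit
        \<open>u\<close>, because \<open>g \<star> \<i> g\<close> is the range of
        \<open>g\<close>.\<close>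
      define h where "h = \<i> g"
      have h: "h \<in> \<AA>" "\<s> a = \<r> h" "u = g \<star> h" using g T1 by (auto simp: h_def)
      note X = is_cycle_shift[OF \<open>is_cycle x \<Theta>\<^sub>1\<close> x(1) t(1) fx h(1,2)]
      have cl: "a \<star> h \<in> \<AA>" "b \<star> h \<in> \<AA>" "e \<star> h \<in> \<AA>" using T1 h by auto
      show ?thesis
      \<comment> \<open>If the supports touch here, \<open>sup\<close> puts the ranges of
        \<open>a\<close> and \<open>e\<close> among those of the new triples, so \<open>u\<close> is
        the range of \<open>b\<close>, which the commutator fixes. Otherwise \<open>y\<close> is
        trivial on the whole triple and \<open>x\<close> cancels against its inverse.\<close>
      proof (cases "\<exists>e' d f. (e', d, f) \<in> \<Theta>\<^sub>2 \<and> \<r> e = \<r> e'")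
        case True
        then obtain e' d f where 2: "(e', d, f) \<in> \<Theta>\<^sub>2" "\<r> e = \<r> e'" by blast
        note T2 = same_sourceD[OF t(2) 2(1)]
        obtain a' d' e'' where "(a', d', e'') \<in> \<Theta>\<^sub>3" "\<r> a' = \<r> a" "\<r> d' = \<r> d" "\<r> e'' = \<r> e"
          using sup[OF x(1) 2] by auto
        then have "u \<noteq> \<r> a" "u \<noteq> \<r> e" using out by force+
        then have "g = b" using g by auto
        moreover have "e \<star> h = e' \<star> (\<i> e' \<star> (e \<star> h))" using T1 T2 2 h by simp
        then have "act z (b \<star> h) = b \<star> h"
          using main[OF x(1) h(1,2) 2(1), of "\<i> e' \<star> (e \<star> h)"] T1 T2 2 h by simp
        ultimately show ?thesis using h by simp
      next
        case False
        have fixa: "act y (a \<star> h) = a \<star> h" "act y (b \<star> h) = b \<star> h"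
          by (rule Fy[OF _ x(1)]; use T1 h in simp)+
        have fixe: "act y (e \<star> h) = e \<star> h"
        proof (rule Fy'[OF cl(3) x(1)])
          show "\<r> (e \<star> h) = \<r> e" using T1 h by simp
        qed (use False in blast)
        note ivs = xi[OF cl(1) X(1)] xi[OF cl(2) X(2)] xi[OF cl(3) X(3)]
          yi[OF cl(1) fixa(1)] yi[OF cl(2) fixa(2)] yi[OF cl(3) fixe]
        consider "g = a" | "g = b" | "g = e" using g by blast
        then show ?thesis
          by cases (simp_all add: h(3) z cl X ivs fixa fixe)
      qed
    next
      case (y e' d f)
      note T2 = same_sourceD[OF t(2) y(1)]
      have "\<exists>g\<in>{e', d, f}. u = \<r> g" using y by auto
      then obtain g where g: "g \<in> {e', d, f}" "u = \<r> g" by auto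
      define k where "k = \<i> g"
      have k: "k \<in> \<AA>" "\<s> e' = \<r> k" "u = g \<star> k" using g T2 by (auto simp: k_def)
      note Y = is_cycle_shift[OF \<open>is_cycle y \<Theta>\<^sub>2\<close> y(1) t(2) fy k(1,2)]
      have cl: "e' \<star> k \<in> \<AA>" "d \<star> k \<in> \<AA>" "f \<star> k \<in> \<AA>" using T2 k by auto
      show ?thesis
      proof (cases "\<exists>a b e. (a, b, e) \<in> \<Theta>\<^sub>1 \<and> \<r> e = \<r> e'")
        case True
        then obtain a b e where 1: "(a, b, e) \<in> \<Theta>\<^sub>1" "\<r> e = \<r> e'" by blast
        note T1 = same_sourceD[OF t(1) 1(1)]
        obtain a' d' e'' where "(a', d', e'') \<in> \<Theta>\<^sub>3" "\<r> a' = \<r> a" "\<r> d' = \<r> d" "\<r> e'' = \<r> e"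
          using sup[OF 1(1) y(1) 1(2)] by auto
        then have "u \<noteq> \<r> d" "u \<noteq> \<r> e" using out by force+
        then have "g = f" using g 1 by auto
        moreover have "e \<star> (\<i> e \<star> (e' \<star> k)) = e' \<star> k" using T1 T2 1 k by simp
        then have "act z (f \<star> k) = f \<star> k"
          using main[OF 1(1) _ _ y(1) k(1,2), of "\<i> e \<star> (e' \<star> k)"] T1 T2 1 k by simp
        ultimately show ?thesis using k by simp
      next
        case False
        have fixa: "act x (d \<star> k) = d \<star> k" "act x (f \<star> k) = f \<star> k"
          by (rule Fx[OF _ y(1)]; use T2 k in simp)+
        have fixe: "act x (e' \<star> k) = e' \<star> k"
        proof (rule Fx'[OF cl(1) y(1)])
          show "\<r> (e' \<star> k) = \<r> e'" using T2 k by simp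
        qed (use False in blast)
        note ivs = yi[OF cl(1) Y(1)] yi[OF cl(2) Y(2)] yi[OF cl(3) Y(3)]
          xi[OF cl(1) fixe] xi[OF cl(2) fixa(1)] xi[OF cl(3) fixa(2)]
        consider "g = e'" | "g = d" | "g = f" using g by blast
        then show ?thesis
          by cases (simp_all add: k(3) z cl Y ivs fixa fixe)
      qed
    qed
  qed
  then show ?thesis using zH by (auto simp: has_cycle_def)
qed

section \<open>Cycles over sections parametrised by their base points\<close>

definition tuples where "tuples b1 b2 b3 W = (\<lambda>y. (b1 y, b2 y, b3 y)) ` W"

definition section_on where "section_on b W \<longleftrightarrow> (\<forall>y\<in>W. b y \<in> \<AA> \<and> \<s> (b y) = y)"

lemma same_source_tuples: "section_on b1 W \<Longrightarrow> section_on b2 W \<Longrightarrow> section_on b3 W \<Longrightarrow> same_source (tuples b1 b2 b3 W)"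
  by (auto simp: same_source_def tuples_def section_on_def)

lemma section_onD: assumes "section_on b W" "y \<in> W"
  shows "b y \<in> \<AA>" "\<s> (b y) = y" "y \<in> \<AA>" "y \<in> \<UU>" "\<r> y = y" "b y \<star> y = b y"
proof -
  show b: "b y \<in> \<AA>" "\<s> (b y) = y" using assms by (auto simp: section_on_def)
  show "y \<in> \<AA>" using closed(2)[OF b(1)] b(2) by simp
  show "y \<in> \<UU>" using unitI(2)[OF b(1)] b(2) by simp
  show "\<r> y = y" using endpoints(4)[OF b(1)] b(2) by simp
  show "b y \<star> y = b y" using mult_unit(1)[OF b(1)] b(2) by simp
qed

lemma has_cycle_tuples_cong: assumes "has_cycle H (tuples b1 b2 b3 W)" "\<And>y. y \<in> W \<Longrightarrow> b1 y = d1 y \<and> b2 y = d2 y \<and> b3 y = d3 y"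
  shows "has_cycle H (tuples d1 d2 d3 W)"
proof -
  have "tuples d1 d2 d3 W = tuples b1 b2 b3 W" unfolding tuples_def using assms(2) by (intro image_cong) auto
  then show ?thesis using assms(1) by simp
qed

lemma has_cycle_tuples_empty: assumes "subgroup H (full_group G)" shows "has_cycle H (tuples b1 b2 b3 {})"
proof -
  have "\<UU> \<in> H" using subgroup.one_closed[OF assms] by simp
  moreover have "is_cycle \<UU> (tuples b1 b2 b3 {})"
    unfolding is_cycle_def tuples_def by (simp add: act_units(2)[OF unitD(1)])
  ultimately show ?thesis unfolding has_cycle_def by blast
qed

lemma is_cycle_tuples: "is_cycle c (tuples b1 b2 b3 W) \<longleftrightarrow> (\<forall>y \<in> W. act c (b1 y) = b2 y \<and> act c (b2 y) = b3 y \<and> act c (b3 y) = b1 y) \<and>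
   (\<forall>u\<in>\<UU>. (\<forall>y \<in> W. u \<noteq> \<r> (b1 y) \<and> u \<noteq> \<r> (b2 y) \<and> u \<noteq> \<r> (b3 y)) \<longrightarrow> act c u = u)"
  by (auto simp: is_cycle_def tuples_def)

lemma is_cycle_tuplesD: assumes "is_cycle c (tuples b1 b2 b3 W)" "y \<in> W"
  shows "act c (b1 y) = b2 y" "act c (b2 y) = b3 y" "act c (b3 y) = b1 y"
  using assms unfolding is_cycle_tuples by blast+

lemma is_cycle_tuples_fix: assumes "is_cycle c (tuples b1 b2 b3 W)" "u \<in> \<UU>"
    "\<And>y. y \<in> W \<Longrightarrow> u \<noteq> \<r> (b1 y) \<and> u \<noteq> \<r> (b2 y) \<and> u \<noteq> \<r> (b3 y)"
  shows "act c u = u"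
  using assms unfolding is_cycle_tuples by blast

lemma has_cycle_rot: "has_cycle H (tuples b1 b2 b3 W) \<Longrightarrow> has_cycle H (tuples b2 b3 b1 W)"
  unfolding has_cycle_def is_cycle_tuples by blast

text \<open>The inverse of \<open>(b1 b2 b3)\<close> is \<open>(b2 b1 b3)\<close>.\<close>

lemma has_cycle_rev: assumes H: "subgroup H (full_group G)" and "has_cycle H (tuples b1 b2 b3 W)"
    and s: "section_on b1 W" "section_on b2 W" "section_on b3 W"
  shows "has_cycle H (tuples b2 b1 b3 W)"
proof -
  obtain c where c: "c \<in> H" "is_cycle c (tuples b1 b2 b3 W)" using assms by (auto simp: has_cycle_def)
  have cc: "c \<in> carrier (full_group G)" using c(1) subgroup.mem_carrier[OF H] by auto
  then have f: "full c" by simp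
  have "gset_inv G c \<in> H" using subgroup.m_inv_closed[OF H c(1)] FG_inv[OF cc] by simp
  moreover have "is_cycle (gset_inv G c) (tuples b2 b1 b3 W)" unfolding is_cycle_tuples
  proof (intro conjI ballI impI)
    fix y assume y: "y \<in> W"
    have "b1 y \<in> \<AA>" "b2 y \<in> \<AA>" "b3 y \<in> \<AA>" using s y by (simp_all add: section_on_def)
    moreover have "act c (b1 y) = b2 y" "act c (b2 y) = b3 y" "act c (b3 y) = b1 y"
      using c(2) y unfolding is_cycle_tuples by blast+
    ultimately show "act (gset_inv G c) (b2 y) = b1 y" "act (gset_inv G c) (b1 y) = b3 y"
      "act (gset_inv G c) (b3 y) = b2 y" by (auto intro: act_inv_eq[OF f])
  next
    fix u assume u: "u \<in> \<UU>" and out: "\<forall>y \<in> W. u \<noteq> \<r> (b2 y) \<and> u \<noteq> \<r> (b1 y) \<and> u \<noteq> \<r> (b3 y)"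
    then have "act c u = u" using c(2) unfolding is_cycle_tuples by blast
    then show "act (gset_inv G c) u = u" using unitD(1)[OF u] by (rule act_inv_eq[OF f, rotated])
  qed
  ultimately show ?thesis by (auto simp: has_cycle_def)
qed

text \<open>Both triples now sit over the same base point \<open>y\<close>, so the unit
  \<open>y\<close> serves for both shifts of the general commutator. \<open>inj\<close> ensures that
  the shared section meets itself only over common base points; this is what confines the result to
  \<open>W \<inter> W'\<close>.\<close>

lemma has_cycle_commutator_tuples:
  assumes H: "subgroup H (full_group G)" and HC: "has_cycle H (tuples b1 b2 b3 W)" "has_cycle H (tuples b3 b4 b5 W')"
    and s: "section_on b1 W" "section_on b2 W" "section_on b3 W" "section_on b3 W'" "section_on b4 W'" "section_on b5 W'"
    and disj: "\<And>y y'. y \<in> W \<Longrightarrow> y' \<in> W' \<Longrightarrow>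
        {\<r> (b1 y), \<r> (b2 y)} \<inter> {\<r> (b3 y'), \<r> (b4 y'), \<r> (b5 y')} = {} \<and> \<r> (b3 y) \<notin> {\<r> (b4 y'), \<r> (b5 y')}"
    and inj: "\<And>y y'. y \<in> W \<Longrightarrow> y' \<in> W' \<Longrightarrow> \<r> (b3 y) = \<r> (b3 y') \<Longrightarrow> y = y'"
  shows "has_cycle H (tuples b1 b4 b3 (W \<inter> W'))"
proof (rule has_cycle_commutator[OF H HC])
  show "same_source (tuples b1 b2 b3 W)" "same_source (tuples b3 b4 b5 W')" using s by (auto intro!: same_source_tuples)
next
  fix t assume "t \<in> tuples b1 b4 b3 (W \<inter> W')"
  then obtain y where y: "y \<in> W" "y \<in> W'" "t = (b1 y, b4 y, b3 y)" by (auto simp: tuples_def)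
  note S = section_onD[OF s(1) y(1)] section_onD[OF s(2) y(1)] section_onD[OF s(3) y(1)] section_onD[OF s(5) y(2)] section_onD[OF s(6) y(2)]
  have "(b1 y, b2 y, b3 y) \<in> tuples b1 b2 b3 W" "(b3 y, b4 y, b5 y) \<in> tuples b3 b4 b5 W'"
    using y(1,2) by (simp_all add: tuples_def)
  then show "\<exists>a b e h e' d f k. (a, b, e) \<in> tuples b1 b2 b3 W \<and> (e', d, f) \<in> tuples b3 b4 b5 W' \<and> h \<in> \<AA> \<and> k \<in> \<AA> \<and>
        \<s> a = \<r> h \<and> \<s> e' = \<r> k \<and> e \<star> h = e' \<star> k \<and> t = (a \<star> h, d \<star> k, e \<star> h)"
    by (rule_tac x="b1 y" in exI, rule_tac x="b2 y" in exI, rule_tac x="b3 y" in exI, rule_tac x="y" in exI,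
      rule_tac x="b3 y" in exI, rule_tac x="b4 y" in exI, rule_tac x="b5 y" in exI, rule_tac x="y" in exI)
      (simp add: S y(3))
next
  fix a b e e' d f assume "(a, b, e) \<in> tuples b1 b2 b3 W" "(e', d, f) \<in> tuples b3 b4 b5 W'"
  then obtain y y' where "y \<in> W" "y' \<in> W'" "a = b1 y" "b = b2 y" "e = b3 y" "e' = b3 y'" "d = b4 y'" "f = b5 y'"
    by (auto simp: tuples_def)
  then show "{\<r> a, \<r> b} \<inter> {\<r> e', \<r> d, \<r> f} = {} \<and> \<r> e \<notin> {\<r> d, \<r> f}"
    using disj[of y y'] by simp
next
  fix a b e e' d f assume 1: "(a, b, e) \<in> tuples b1 b2 b3 W" "(e', d, f) \<in> tuples b3 b4 b5 W'" "\<r> e = \<r> e'"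
  then obtain y y' where *: "y \<in> W" "y' \<in> W'" "a = b1 y" "e = b3 y" "e' = b3 y'" "d = b4 y'"
    by (auto simp: tuples_def)
  then have "y' = y" using inj[of y y'] 1(3) by simp
  then have "(b1 y, b4 y, b3 y) \<in> tuples b1 b4 b3 (W \<inter> W')" using * by (auto simp: tuples_def)
  then show "\<exists>(a', d', e'')\<in>tuples b1 b4 b3 (W \<inter> W'). \<r> a' = \<r> a \<and> \<r> d' = \<r> d \<and> \<r> e'' = \<r> e"
    using * \<open>y' = y\<close> by (intro bexI[of _ "(b1 y, b4 y, b3 y)"]) auto
qed

section \<open>Stars: sections over one set with ranges disjoint from each other\<close>

text \<open>Ranges are compared at two base points \<open>y\<close> and \<open>z\<close>, not only
  at one, because the supports in a commutator are unions over all base points.\<close>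

definition star where "star b I V \<longleftrightarrow> (\<forall>i\<in>I. section_on (b i) V) \<and>
  (\<forall>i\<in>I. \<forall>j\<in>I. \<forall>y\<in>V. \<forall>z\<in>V. \<r> (b i y) = \<r> (b j z) \<longrightarrow> i = j \<and> y = z)"

lemma star_section_on: "star b I V \<Longrightarrow> i \<in> I \<Longrightarrow> W \<subseteq> V \<Longrightarrow> section_on (b i) W"
  by (auto simp: star_def section_on_def)

lemma star_inj: "star b I V \<Longrightarrow> i \<in> I \<Longrightarrow> j \<in> I \<Longrightarrow> y \<in> V \<Longrightarrow> z \<in> V \<Longrightarrow> \<r> (b i y) = \<r> (b j z) \<Longrightarrow> i = j \<and> y = z"
  by (auto simp: star_def)

lemma has_cycle_star_commutator:
  assumes H: "subgroup H (full_group G)" and st: "star b I V" and sub: "W \<subseteq> V" "W' \<subseteq> V"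
    and HC: "has_cycle H (tuples (b i) (b j) (b k) W)" "has_cycle H (tuples (b k) (b l) (b m) W')"
    and I: "i \<in> I" "j \<in> I" "k \<in> I" "l \<in> I" "m \<in> I" and d: "distinct [i, j, k, l, m]"
  shows "has_cycle H (tuples (b i) (b l) (b k) (W \<inter> W'))"
proof (rule has_cycle_commutator_tuples[OF H HC])
  fix y y' assume "y \<in> W" "y' \<in> W'"
  then have y: "y \<in> V" "y' \<in> V" using sub by auto
  note inj = star_inj[OF st _ _ y]
  show "{\<r> (b i y), \<r> (b j y)} \<inter> {\<r> (b k y'), \<r> (b l y'), \<r> (b m y')} = {} \<and> \<r> (b k y) \<notin> {\<r> (b l y'), \<r> (b m y')}"
    using inj[of i k] inj[of i l] inj[of i m] inj[of j k] inj[of j l] inj[of j m] inj[of k l] inj[of k m] I d by auto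
  show "\<r> (b k y) = \<r> (b k y') \<Longrightarrow> y = y'" using inj[of k k] I by auto
qed (use I sub star_section_on[OF st] in auto)

text \<open>Take the commutator with the unrestricted cycle \<open>(k l m)\<close> over
  \<open>V\<close>; only the base \<open>W\<close> of the other factor survives. The spare index
  \<open>m\<close> is the reason for asking for five sections.\<close>

lemma has_cycle_star_replace:
  assumes H: "subgroup H (full_group G)" and st: "star b I V" and W: "W \<subseteq> V"
    and full: "\<And>i j k. {i, j, k} \<subseteq> I \<Longrightarrow> distinct [i, j, k] \<Longrightarrow> has_cycle H (tuples (b i) (b j) (b k) V)"
    and HC: "has_cycle H (tuples (b i) (b j) (b k) W)" and I: "{i, j, k, l} \<subseteq> I" and d: "distinct [i, j, k, l]"
    and I5: "finite I" "card I \<ge> 5"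
  shows "has_cycle H (tuples (b i) (b l) (b k) W)"
proof -
  have "\<not> I \<subseteq> {i, j, k, l}"
  proof
    assume "I \<subseteq> {i, j, k, l}"
    then have "card I \<le> card {i, j, k, l}" by (intro card_mono) auto
    also have "\<dots> \<le> 4" by (simp add: card_insert_if)
    finally show False using I5 by simp
  qed
  then obtain m where m: "m \<in> I" "m \<notin> {i, j, k, l}" by auto
  have "has_cycle H (tuples (b i) (b l) (b k) (W \<inter> V))"
    by (rule has_cycle_star_commutator[OF H st W _ HC full[of k l m]]) (use I d m in auto)
  then show ?thesis using W by (simp add: Int_absorb2)
qed

text \<open>Rotation, inversion and replacement of one index connect all ordered triples of distinct
  indices; \<open>i'\<close>, \<open>j'\<close> and \<open>k'\<close> are brought in one after
  another.\<close>

lemma has_cycle_star_all: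
  assumes H: "subgroup H (full_group G)" and st: "star b I V" and W: "W \<subseteq> V"
    and full: "\<And>i j k. {i, j, k} \<subseteq> I \<Longrightarrow> distinct [i, j, k] \<Longrightarrow> has_cycle H (tuples (b i) (b j) (b k) V)"
    and HC: "has_cycle H (tuples (b i) (b j) (b k) W)" and I: "{i, j, k} \<subseteq> I" and d: "distinct [i, j, k]"
    and I5: "finite I" "card I \<ge> 5" and I': "{i', j', k'} \<subseteq> I" and d': "distinct [i', j', k']"
  shows "has_cycle H (tuples (b i') (b j') (b k') W)"
proof -
  define P where "P x y z \<longleftrightarrow> {x, y, z} \<subseteq> I \<and> distinct [x, y, z] \<and> has_cycle H (tuples (b x) (b y) (b z) W)" for x y z
  have rot: "P y z x" if p: "P x y z" for x y z
    using p has_cycle_rot[of H "b x" "b y" "b z" W] unfolding P_def by auto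
  have rev: "P y x z" if p: "P x y z" for x y z
  proof -
    have m: "x \<in> I" "y \<in> I" "z \<in> I" "distinct [x, y, z]" "has_cycle H (tuples (b x) (b y) (b z) W)" using p by (auto simp: P_def)
    have "has_cycle H (tuples (b y) (b x) (b z) W)"
      by (rule has_cycle_rev[OF H m(5)]) (rule star_section_on[OF st _ W], fact)+
    then show ?thesis using m by (auto simp: P_def)
  qed
  have rep: "P x w z" if p: "P x y z" and w: "w \<in> I" "w \<noteq> x" "w \<noteq> y" "w \<noteq> z" for x y z w
  proof -
    have m: "{x, y, z, w} \<subseteq> I" "distinct [x, y, z, w]" "has_cycle H (tuples (b x) (b y) (b z) W)" using p w by (auto simp: P_def)
    have "has_cycle H (tuples (b x) (b w) (b z) W)"
      by (rule has_cycle_star_replace[OF H st W full m(3,1,2) I5])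
    then show ?thesis using m by (auto simp: P_def)
  qed
  have i: "i' \<in> I" "j' \<in> I" "k' \<in> I" "i' \<noteq> j'" "i' \<noteq> k'" "j' \<noteq> k'" using I' d' by auto
  have 0: "P i j k" using HC I d by (auto simp: P_def)
  have "\<exists>y z. P i' y z"
  proof (cases "i' \<in> {i, j, k}")
    case True
    then show ?thesis using 0 rot[OF 0] rot[OF rot[OF 0]] by blast
  next
    case False
    then have "P i i' k" using rep[OF 0 i(1)] by blast
    then show ?thesis using rot by blast
  qed
  then obtain y z where 1: "P i' y z" by blast
  have "\<exists>z. P i' j' z"
  proof (cases "j' \<in> {y, z}")
    case True
    then show ?thesis using 1 rev[OF rot[OF rot[OF 1]]] by blast
  next
    case False
    then show ?thesis using rep[OF 1 i(2)] i(4) by blast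
  qed
  then obtain z where 2: "P i' j' z" by blast
  have "P i' j' k'"
  proof (cases "z = k'")
    case False
    have "P j' k' i'" using rep[OF rot[OF 2] i(3)] i False by metis
    then show ?thesis using rot by blast
  qed (use 2 in simp)
  then show ?thesis by (simp add: P_def)
qed

text \<open>Multiply \<open>c\<close> by the inverse of \<open>e\<close>. The two agree on the germs
  over \<open>W'\<close>, and \<open>e\<close> is trivial on the germs over the rest of
  \<open>W\<close>.\<close>

lemma has_cycle_star_Diff:
  assumes H: "subgroup H (full_group G)" and st: "star b I V" and W: "W' \<subseteq> W" "W \<subseteq> V"
    and HC: "has_cycle H (tuples (b i) (b j) (b k) W)" "has_cycle H (tuples (b i) (b j) (b k) W')" and I: "{i, j, k} \<subseteq> I"
  shows "has_cycle H (tuples (b i) (b j) (b k) (W - W'))"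
proof -
  obtain c where c: "c \<in> H" "is_cycle c (tuples (b i) (b j) (b k) W)" using HC by (auto simp: has_cycle_def)
  obtain e where e: "e \<in> H" "is_cycle e (tuples (b i) (b j) (b k) W')" using HC by (auto simp: has_cycle_def)
  have cc: "c \<in> carrier (full_group G)" "e \<in> carrier (full_group G)" using c(1) e(1) subgroup.mem_carrier[OF H] by auto
  then have f: "full c" "full e" by simp_all
  let ?e = "gset_inv G e"
  have fe: "full ?e" using f full_inv by auto
  have "?e \<in> H" using subgroup.m_inv_closed[OF H e(1)] FG_inv[OF cc(2)] by simp
  then have mem: "gset_mult G c ?e \<in> H" using subgroup.m_closed[OF H c(1)] by simp
  have act: "act (gset_mult G c ?e) g = act c (act ?e g)" if "g \<in> \<AA>" for g
    using act_comp[OF f(1) fe that] .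
  have cl: "b i y \<in> \<AA>" "b j y \<in> \<AA>" "b k y \<in> \<AA>" if "y \<in> V" for y
    using star_section_on[OF st, of _ V] I that by (auto simp: section_on_def)
  have "is_cycle (gset_mult G c ?e) (tuples (b i) (b j) (b k) (W - W'))" unfolding is_cycle_tuples
  proof (intro conjI ballI impI)
    fix y assume y: "y \<in> W - W'"
    then have yV: "y \<in> V" using W by auto
    have "act e (b l y) = b l y" if l: "l \<in> {i, j, k}" for l
    proof (rule is_cycle_fix[OF e(2) f(2)])
      show "b l y \<in> \<AA>" using cl yV l by auto
      fix a a' a'' assume "(a, a', a'') \<in> tuples (b i) (b j) (b k) W'"
      then obtain z where "z \<in> W'" "a = b i z" "a' = b j z" "a'' = b k z" by (auto simp: tuples_def)
      then show "\<r> (b l y) \<noteq> \<r> a \<and> \<r> (b l y) \<noteq> \<r> a' \<and> \<r> (b l y) \<noteq> \<r> a''"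
        using star_inj[OF st _ _ yV, of l _ z] y l I W by auto
    qed
    then have "act ?e (b l y) = b l y" if l: "l \<in> {i, j, k}" for l
      using act_inv_eq[OF f(2)] cl yV l by auto
    moreover have "y \<in> W" using y by blast
    ultimately show "act (gset_mult G c ?e) (b i y) = b j y" "act (gset_mult G c ?e) (b j y) = b k y"
       "act (gset_mult G c ?e) (b k y) = b i y"
      using is_cycle_tuplesD[OF c(2)] by (simp_all add: act cl[OF yV])
  next
    fix u assume u: "u \<in> \<UU>" and out: "\<forall>y \<in> W - W'. u \<noteq> \<r> (b i y) \<and> u \<noteq> \<r> (b j y) \<and> u \<noteq> \<r> (b k y)"
    have uA: "u \<in> \<AA>" using u unitD by auto
    show "act (gset_mult G c ?e) u = u"
    proof (cases "\<exists>y \<in> W'. u \<in> {\<r> (b i y), \<r> (b j y), \<r> (b k y)}")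
      case True
      then obtain y l where y: "y \<in> W'" "l \<in> {i, j, k}" "u = \<r> (b l y)" by auto
      then have yV: "y \<in> V" "y \<in> W" using W by auto
      have b: "b i y \<in> \<AA>" "b j y \<in> \<AA>" "b k y \<in> \<AA>" using cl yV by auto
      \<comment> \<open>Over \<open>W'\<close> both elements act alike, so the inverse of
        \<open>e\<close> followed by \<open>c\<close> returns every germ to itself.\<close>
      have "act c (b l y') = act e (b l y')" if "l \<in> {i, j, k}" "y' \<in> W'" for l y'
        using c(2) e(2) that W unfolding is_cycle_tuples by auto
      moreover obtain l' where l': "l' \<in> {i, j, k}" "act e (b l' y) = b l y" 
        using e(2) y unfolding is_cycle_tuples by auto
      ultimately have "act c (act ?e (b l y)) = b l y"
        using act_inv_eq[OF f(2), of "b l' y"] b y(1) by auto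
      then have "act (gset_mult G c ?e) (b l y) = b l y" using act b y(2) by auto
      then have "act (gset_mult G c ?e) (b l y \<star> \<i> (b l y)) = b l y \<star> \<i> (b l y)"
        using act_mult[OF full_mult[OF f(1) fe], of "b l y" "\<i> (b l y)"] b y(2) by auto
      then show ?thesis using y by simp
    next
      case False
      have "act e u = u" by (rule is_cycle_tuples_fix[OF e(2) u]) (use False in blast)
      then have "act ?e u = u" by (rule act_inv_eq[OF f(2) uA])
      moreover have "act c u = u" by (rule is_cycle_tuples_fix[OF c(2) u]) (use False out in blast)
      ultimately show ?thesis using act[OF uA] by simp
    qed
  qed
  then show ?thesis using mem by (auto simp: has_cycle_def)
qed

text \<open>The product of the two elements works: disjoint bases inside a star give disjoint
  supports, so each factor is trivial where the other one moves germs.\<close>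

lemma has_cycle_star_Un:
  assumes H: "subgroup H (full_group G)" and st: "star b I V" and W: "W \<inter> W' = {}" "W \<union> W' \<subseteq> V"
    and HC: "has_cycle H (tuples (b i) (b j) (b k) W)" "has_cycle H (tuples (b i) (b j) (b k) W')" and I: "{i, j, k} \<subseteq> I"
  shows "has_cycle H (tuples (b i) (b j) (b k) (W \<union> W'))"
proof -
  obtain c where c: "c \<in> H" "is_cycle c (tuples (b i) (b j) (b k) W)" using HC by (auto simp: has_cycle_def)
  obtain e where e: "e \<in> H" "is_cycle e (tuples (b i) (b j) (b k) W')" using HC by (auto simp: has_cycle_def)
  have cc: "c \<in> carrier (full_group G)" "e \<in> carrier (full_group G)" using c(1) e(1) subgroup.mem_carrier[OF H] by auto
  then have f: "full c" "full e" by simp_all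
  have mem: "gset_mult G c e \<in> H" using subgroup.m_closed[OF H c(1) e(1)] by simp
  have act: "act (gset_mult G c e) g = act c (act e g)" if "g \<in> \<AA>" for g
    using act_comp[OF f that] .
  have cl: "b i y \<in> \<AA>" "b j y \<in> \<AA>" "b k y \<in> \<AA>" if "y \<in> V" for y
    using star_section_on[OF st, of _ V] I that by (auto simp: section_on_def)
  have fx: "act x (b l y) = b l y" if l: "l \<in> {i, j, k}" and y: "y \<in> V" "y \<notin> Z" "Z \<subseteq> V"
    and x: "full x" "is_cycle x (tuples (b i) (b j) (b k) Z)" for x l y Z
  proof (rule is_cycle_fix[OF x(2,1)])
    show "b l y \<in> \<AA>" using cl y l by auto
    fix a a' a'' assume "(a, a', a'') \<in> tuples (b i) (b j) (b k) Z"
    then obtain z where "z \<in> Z" "a = b i z" "a' = b j z" "a'' = b k z" by (auto simp: tuples_def)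
    then show "\<r> (b l y) \<noteq> \<r> a \<and> \<r> (b l y) \<noteq> \<r> a' \<and> \<r> (b l y) \<noteq> \<r> a''"
      using star_inj[OF st _ _ y(1), of l _ z] y l I by auto
  qed
  have "is_cycle (gset_mult G c e) (tuples (b i) (b j) (b k) (W \<union> W'))" unfolding is_cycle_tuples
  proof (intro conjI ballI impI)
    fix y assume y: "y \<in> W \<union> W'"
    then have yV: "y \<in> V" using W by auto
    note cy = cl[OF yV]
    have "act (gset_mult G c e) (b i y) = b j y \<and> act (gset_mult G c e) (b j y) = b k y \<and>
       act (gset_mult G c e) (b k y) = b i y"
    proof (cases "y \<in> W")
      case True
      then have "y \<notin> W'" using W by auto
      then have "act e (b l y) = b l y" if "l \<in> {i, j, k}" for l
        using fx[OF that yV _ _ f(2) e(2)] W by blast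
      then show ?thesis using is_cycle_tuplesD[OF c(2) True] by (simp add: act cy)
    next
      case False
      then have "act c (b l y) = b l y" if "l \<in> {i, j, k}" for l
        using fx[OF that yV _ _ f(1) c(2)] W by blast
      moreover have "y \<in> W'" using y False by auto
      ultimately show ?thesis using is_cycle_tuplesD[OF e(2), of y] by (simp add: act cy)
    qed
    then show "act (gset_mult G c e) (b i y) = b j y" "act (gset_mult G c e) (b j y) = b k y"
       "act (gset_mult G c e) (b k y) = b i y" by blast+
  next
    fix u assume u: "u \<in> \<UU>" and out: "\<forall>y \<in> W \<union> W'. u \<noteq> \<r> (b i y) \<and> u \<noteq> \<r> (b j y) \<and> u \<noteq> \<r> (b k y)"
    have "act e u = u" by (rule is_cycle_tuples_fix[OF e(2) u]) (use out in blast)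
    moreover have "act c u = u" by (rule is_cycle_tuples_fix[OF c(2) u]) (use out in blast)
    ultimately show "act (gset_mult G c e) u = u" using act[OF unitD(1)[OF u]] by simp
  qed
  then show ?thesis using mem by (auto simp: has_cycle_def)
qed

section \<open>The 3-cycles of multisections\<close>

lemma bisection_UN:
  assumes "finite I" "\<And>i. i \<in> I \<Longrightarrow> bisection G (B i)"
    "disjoint_family_on (\<lambda>i. \<s> ` B i) I" "disjoint_family_on (\<lambda>i. \<r> ` B i) I"
  shows "bisection G (\<Union>i\<in>I. B i)"
  using assms
proof (induction I rule: finite_induct)
  case empty
  show ?case using clop_bisection[OF clop_ops(2)] by simp
next
  case (insert i I)
  have "bisection G (B i \<union> (\<Union>i\<in>I. B i))"
  proof (rule bisection_Un)
    show "bisection G (B i)" using insert.prems(1) by blast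
    show "bisection G (\<Union>i\<in>I. B i)"
    proof (rule insert.IH)
      show "bisection G (B j)" if "j \<in> I" for j by (rule insert.prems(1)[OF insertI2[OF that]])
      show "disjoint_family_on (\<lambda>i. \<s> ` B i) I" by (rule disjoint_family_on_mono[OF subset_insertI insert.prems(2)])
      show "disjoint_family_on (\<lambda>i. \<r> ` B i) I" by (rule disjoint_family_on_mono[OF subset_insertI insert.prems(3)])
    qed
    have *: "\<s> ` B i \<inter> \<s> ` B j = {}" "\<r> ` B i \<inter> \<r> ` B j = {}" if "j \<in> I" for j
    proof -
      have "i \<noteq> j" using insert.hyps(2) that by blast
      then show "\<s> ` B i \<inter> \<s> ` B j = {}" "\<r> ` B i \<inter> \<r> ` B j = {}"
        using disjoint_family_onD[OF insert.prems(2) insertI1 insertI2[OF that]]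
          disjoint_family_onD[OF insert.prems(3) insertI1 insertI2[OF that]] by blast+
    qed
    show "\<s> ` B i \<inter> \<s> ` (\<Union>i\<in>I. B i) = {}"
      unfolding image_UN Int_UN_distrib using *(1) by blast
    show "\<r> ` B i \<inter> \<r> ` (\<Union>i\<in>I. B i) = {}"
      unfolding image_UN Int_UN_distrib using *(2) by blast
  qed
  then show ?case by simp
qed

text \<open>Sources and ranges are forced by the composition rule: \<open>F i j\<close> absorbs the
  units \<open>F i i\<close> on the right, and \<open>F i i\<close> is itself the product of
  \<open>F j i\<close> and \<open>F i j\<close>; ranges are treated symmetrically.\<close>

lemma multisectionD:
  assumes F: "multisection G d F" and i: "i \<in> {1..d}" and j: "j \<in> {1..d}"
  shows "bisection G (F i j)" "slice (F i j)" "F i i \<subseteq> \<UU>" "clop (F i i)" "\<s> ` F i j = F i i" "\<r> ` F i j = F j j"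
proof -
  have mult: "gset_mult G (F j k) (F i j) = F i k" if "i \<in> {1..d}" "j \<in> {1..d}" "k \<in> {1..d}" for i j k
    using F that by (simp add: multisection_def)
  have bis: "bisection G (F i j)" if "i \<in> {1..d}" "j \<in> {1..d}" for i j
    using F that by (simp add: multisection_def)
  have un: "F i i \<subseteq> \<UU>" if "i \<in> {1..d}" for i
    using F that by (simp add: multisection_def)
  show "bisection G (F i j)" "F i i \<subseteq> \<UU>" using bis un i j by auto
  then show sl: "slice (F i j)" by (simp add: bisection_slice)
  show "clop (F i i)" using bis[OF i i] un[OF i] by (simp add: clop_def bisection_iff)
  show "\<s> ` F i j = F i i"
  proof (intro equalityI subsetI)
    fix u assume "u \<in> \<s> ` F i j"
    then obtain b where "b \<in> gset_mult G (F i j) (F i i)" "u = \<s> b" using mult[OF i i j] by auto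
    then obtain a v where v: "v \<in> F i i" "\<s> a = \<r> v" "u = \<s> v" by (auto elim!: gset_multE)
    then show "u \<in> F i i" using un[OF i] unitD(2) by (metis subsetD)
  next
    fix u assume u: "u \<in> F i i"
    then have "u \<in> gset_mult G (F j i) (F i j)" using mult[OF i j i] by simp
    then obtain a b where "b \<in> F i j" "u = a \<star> b" "a \<in> \<AA>" "b \<in> \<AA>" "\<s> a = \<r> b" by (elim gset_multE)
    moreover have "\<s> u = u" using unitD(2) un[OF i] u by blast
    ultimately show "u \<in> \<s> ` F i j" by (metis endpoints(7) imageI)
  qed
  show "\<r> ` F i j = F j j"
  proof (intro equalityI subsetI)
    fix u assume "u \<in> \<r> ` F i j"
    then obtain b where "b \<in> gset_mult G (F j j) (F i j)" "u = \<r> b" using mult[OF i j j] by auto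
    then obtain v where v: "v \<in> F j j" "u = \<r> v" by (auto elim!: gset_multE)
    then show "u \<in> F j j" using un[OF j] unitD(3) by (metis subsetD)
  next
    fix u assume u: "u \<in> F j j"
    then have "u \<in> gset_mult G (F i j) (F j i)" using mult[OF j i j] by simp
    then obtain a b where "a \<in> F i j" "u = a \<star> b" "a \<in> \<AA>" "b \<in> \<AA>" "\<s> a = \<r> b" by (elim gset_multE)
    moreover have "\<r> u = u" using unitD(3) un[OF j] u by blast
    ultimately show "u \<in> \<r> ` F i j" by (metis endpoints(8) imageI)
  qed
qed

text \<open>The ranges of the sets \<open>F i (\<pi> i)\<close> are the sets \<open>F i i\<close> in
  another order, so the moving part has the domain both as source and as range.\<close>

lemma multisection_perm_full:
  assumes F: "multisection G d F" and p: "\<pi> permutes {1..d}"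
  shows "multisection_perm G d F \<pi> \<in> carrier (full_group G)"
proof -
  note M = multisectionD[OF F]
  have dis: "disjoint_family_on (\<lambda>i. F i i) {1..d}" using F by (simp add: multisection_def)
  have pi: "\<pi> i \<in> {1..d}" if "i \<in> {1..d}" for i using that by (simp only: permutes_in_image[OF p])
  have pinj: "\<pi> i \<noteq> \<pi> j" if "i \<noteq> j" for i j using permutes_inj[OF p] that by (auto simp: inj_def)
  let ?U = "\<Union>i\<in>{1..d}. F i i" and ?P = "\<Union>i\<in>{1..d}. F i (\<pi> i)"
  have bU: "bisection G ?P"
  proof (rule bisection_UN)
    show "disjoint_family_on (\<lambda>i. \<s> ` F i (\<pi> i)) {1..d}"
      using dis M(5) pi by (auto simp: disjoint_family_on_def)
    show "disjoint_family_on (\<lambda>i. \<r> ` F i (\<pi> i)) {1..d}"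
      unfolding disjoint_family_on_def
    proof (intro ballI impI)
      fix m n assume mn: "m \<in> {1..d}" "n \<in> {1..d}" "m \<noteq> n"
      then have "F (\<pi> m) (\<pi> m) \<inter> F (\<pi> n) (\<pi> n) = {}"
        using dis pi pinj unfolding disjoint_family_on_def by metis
      then show "\<r> ` F m (\<pi> m) \<inter> \<r> ` F n (\<pi> n) = {}" using M(6)[OF mn(1) pi[OF mn(1)]] M(6)[OF mn(2) pi[OF mn(2)]] by simp
    qed
  qed (use M(1) pi in auto)
  have sP: "\<s> ` ?P = ?U" using M(5) pi by (auto simp: image_UN)
  have "\<r> ` ?P = (\<Union>i\<in>{1..d}. F (\<pi> i) (\<pi> i))" using M(6) pi by (auto simp: image_UN)
  also have "\<dots> = (\<Union>i\<in>\<pi> ` {1..d}. F i i)" by auto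
  also have "\<dots> = ?U" using permutes_image[OF p] by simp
  finally have rP: "\<r> ` ?P = ?U" .
  have cU: "clop ?U" using bisection_clop(1)[OF bU] sP by simp
  then have U: "?U \<subseteq> \<UU>" by (simp add: clop_def)
  have cR: "clop (\<UU> - ?U)" using cU clop_ops by blast
  have idR: "\<s> ` (\<UU> - ?U) = \<UU> - ?U" "\<r> ` (\<UU> - ?U) = \<UU> - ?U"
    using unitD(2,3) by (force simp: image_iff)+
  have b: "bisection G (?P \<union> (\<UU> - ?U))"
    by (rule bisection_Un[OF bU clop_bisection[OF cR]]) (unfold sP rP idR, blast+)
  moreover have "\<s> ` (?P \<union> (\<UU> - ?U)) = \<UU>" "\<r> ` (?P \<union> (\<UU> - ?U)) = \<UU>"
    unfolding image_Un sP rP idR using U by auto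
  ultimately show ?thesis
    unfolding multisection_perm_def full_group_simps full_def using bisection_slice by blast
qed

text \<open>All germs are based at \<open>F 1 1\<close>. Left multiplication by
  \<open>F i (\<pi> i)\<close> carries the section \<open>F 1 i\<close> to
  \<open>F 1 (\<pi> i)\<close> by the composition rule, and \<open>orb\<close> says that
  \<open>\<pi>\<close> runs through all three indices from 1.\<close>

lemma multisection_perm_is_cycle:
  assumes F: "multisection G 3 F" and p: "\<pi> permutes {1..3}"
    and orb: "{1, \<pi> 1, \<pi> (\<pi> 1)} = {1..3}" "\<pi> (\<pi> (\<pi> 1)) = 1"
  shows "is_cycle (multisection_perm G 3 F \<pi>) (tuples (sec (F 1 1)) (sec (F 1 (\<pi> 1))) (sec (F 1 (\<pi> (\<pi> 1)))) (F 1 1))"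
proof -
  note M = multisectionD[OF F]
  let ?c = "multisection_perm G 3 F \<pi>"
  have fc: "full ?c" using multisection_perm_full[OF F p] by simp
  have 1: "1 \<in> {1..3::nat}" by simp
  have pi: "\<pi> i \<in> {1..3}" if "i \<in> {1..3}" for i using that by (simp only: permutes_in_image[OF p])
  have step: "act ?c (sec (F 1 i) y) = sec (F 1 (\<pi> i)) y" if i: "i \<in> {1..3}" and y: "y \<in> F 1 1" for i y
  proof -
    have y': "y \<in> \<s> ` F 1 i" using y M(5)[OF 1 i] by simp
    note g = secD[OF M(2)[OF 1 i] y']
    have rg: "\<r> (sec (F 1 i) y) \<in> \<s> ` F i (\<pi> i)"
      using M(5)[OF i pi[OF i]] M(6)[OF 1 i] g(1) by auto
    note f = secD[OF M(2)[OF i pi[OF i]] rg]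
    have "act ?c (sec (F 1 i) y) = sec (F i (\<pi> i)) (\<r> (sec (F 1 i) y)) \<star> sec (F 1 i) y"
      by (rule act_eq[OF fc]) (use f g i in \<open>auto simp: multisection_perm_def\<close>)
    also have "\<dots> = sec (gset_mult G (F i (\<pi> i)) (F 1 i)) y"
      by (rule sec_mult[symmetric, OF M(2)[OF i pi[OF i]] M(2)[OF 1 i] y' rg])
    also have "gset_mult G (F i (\<pi> i)) (F 1 i) = F 1 (\<pi> i)"
      using F i pi[OF i] by (simp add: multisection_def)
    finally show ?thesis .
  qed
  have i: "\<pi> 1 \<in> {1..3}" "\<pi> (\<pi> 1) \<in> {1..3}" using pi by auto
  show ?thesis unfolding is_cycle_tuples
  proof (intro conjI ballI impI)
    fix y assume y: "y \<in> F 1 1"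
    show "act ?c (sec (F 1 1) y) = sec (F 1 (\<pi> 1)) y"
      "act ?c (sec (F 1 (\<pi> 1)) y) = sec (F 1 (\<pi> (\<pi> 1))) y"
      "act ?c (sec (F 1 (\<pi> (\<pi> 1))) y) = sec (F 1 1) y"
      using step[OF 1 y] step[OF i(1) y] step[OF i(2) y] orb(2) by simp_all
  next
    fix u assume u: "u \<in> \<UU>" and out: "\<forall>y \<in> F 1 1. u \<noteq> \<r> (sec (F 1 1) y) \<and>
       u \<noteq> \<r> (sec (F 1 (\<pi> 1)) y) \<and> u \<noteq> \<r> (sec (F 1 (\<pi> (\<pi> 1))) y)"
    have "u \<notin> F i i" if i: "i \<in> {1, \<pi> 1, \<pi> (\<pi> 1)}" for i
    proof
      assume "u \<in> F i i"
      have i3: "i \<in> {1..3}" using i orb(1) by blast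
      then obtain f where f: "f \<in> F 1 i" "u = \<r> f" using M(6)[OF 1 i3] \<open>u \<in> F i i\<close> by auto
      then have "\<s> f \<in> F 1 1" using M(5)[OF 1 i3] by auto
      moreover have "sec (F 1 i) (\<s> f) = f" using M(2)[OF 1 i3] f by simp
      ultimately show False using out i f(2) by auto
    qed
    then have "u \<in> ?c" using u orb(1) unfolding multisection_perm_def by blast
    then have "act ?c u = u \<star> u" by (rule act_eq[OF fc]) (simp_all add: unitD[OF u])
    then show "act ?c u = u" using mult_unit(1)[of u] unitD[OF u] by simp
  qed
qed

definition alt where "alt = generate (full_group G) (\<Union>\<F>\<in>{\<F>. multisection G 3 \<F>}. multisection_alt G 3 \<F>)"

lemma subgroup_alt: "subgroup alt (full_group G)"
  unfolding alt_def
proof (rule group.generate_is_subgroup[OF group_full_group])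
  show "(\<Union>\<F>\<in>{\<F>. multisection G 3 \<F>}. multisection_alt G 3 \<F>) \<subseteq> carrier (full_group G)"
    using multisection_perm_full unfolding multisection_alt_def by blast
qed

text \<open>The products of \<open>B j\<close> with the inverse of \<open>B i\<close> form a
  multisection, whose base \<open>F 1 1\<close> is the range of \<open>B 1\<close> instead of
  \<open>V\<close>. Right multiplication by the arrows of \<open>B 1\<close> moves the base back to
  \<open>V\<close>.\<close>

lemma has_cycle_alt:
  assumes B: "\<And>i. i \<in> {1, 2, 3::nat} \<Longrightarrow> bisection G (B i)" "\<And>i. i \<in> {1, 2, 3::nat} \<Longrightarrow> \<s> ` B i = V"
    and dis: "disjoint_family_on (\<lambda>i. \<r> ` B i) {1, 2, 3}"
  shows "has_cycle alt (tuples (sec (B 1)) (sec (B 2)) (sec (B 3)) V)"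
proof -
  define F where "F i j = gset_mult G (B j) (gset_inv G (B i))" for i j
  have 3: "{1..3} = {1, 2, 3::nat}" by auto
  have sl: "slice (B i)" "B i \<subseteq> \<AA>" if "i \<in> {1, 2, 3}" for i using B(1)[OF that] bisection_slice slice_def by auto
  have V: "V \<subseteq> \<UU>" using B(2)[of 1] bisection_clop(1)[OF B(1), of 1] clop_def by auto
  have inv: "gset_mult G (gset_inv G (B j)) (B j) = V" if j: "j \<in> {1, 2, 3}" for j
    using inv_gset_mult[OF sl(1)[OF j]] B(2)[OF j] by simp
  have VB: "gset_mult G V (gset_inv G (B i)) = gset_inv G (B i)" if i: "i \<in> {1, 2, 3}" for i
  proof (rule units_gset_mult[OF _ _ V])
    show "gset_inv G (B i) \<subseteq> \<AA>" using slice_inv[OF sl(1)[OF i]] by (simp add: slice_def)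
    show "\<r> ` gset_inv G (B i) \<subseteq> V" using inv_image(2)[OF sl(2)[OF i]] B(2)[OF i] by simp
  qed
  have Fii: "F i i = \<r> ` B i" if i: "i \<in> {1, 2, 3}" for i
    unfolding F_def by (rule gset_mult_inv[OF sl(1)[OF i]])
  have FM: "multisection G 3 F" unfolding multisection_def 3
  proof (intro conjI ballI)
    fix i j k assume i: "i \<in> {1, 2, 3::nat}" and j: "j \<in> {1, 2, 3::nat}" and k: "k \<in> {1, 2, 3::nat}"
    show "bisection G (F i j)" unfolding F_def using B(1)[OF i] B(1)[OF j] by (intro bisection_mult bisection_inv)
    show "gset_mult G (F j k) (F i j) = F i k"
      unfolding F_def gset_mult_assoc gset_mult_assoc[of "gset_inv G (B j)", symmetric] inv[OF j] VB[OF i] ..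
    show "F i i \<subseteq> \<UU>" using Fii[OF i] sl(2)[OF i] by auto
  next
    show "disjoint_family_on (\<lambda>i. F i i) {1, 2, 3}" using dis Fii by (simp add: disjoint_family_on_def)
  qed
  \<comment> \<open>A product of two transpositions, hence even; it sends 1 to 2, 2 to 3 and 3 to
    1.\<close>
  define \<pi> where "\<pi> = Transposition.transpose 1 2 \<circ> Transposition.transpose 2 (3::nat)"
  have pv: "\<pi> 1 = 2" "\<pi> 2 = 3" "\<pi> 3 = 1" by (simp_all add: \<pi>_def transpose_def)
  have pp: "\<pi> permutes {1..3}" unfolding \<pi>_def by (intro permutes_compose permutes_swap_id) auto
  have "evenperm \<pi>" unfolding \<pi>_def by (simp add: evenperm_comp permutation_swap_id evenperm_swap)
  then have "multisection_perm G 3 F \<pi> \<in> alt"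
    unfolding alt_def multisection_alt_def using FM pp by (intro generate.incl) blast
  moreover have "is_cycle (multisection_perm G 3 F \<pi>) (tuples (sec (F 1 1)) (sec (F 1 2)) (sec (F 1 3)) (F 1 1))"
  proof -
    have orb: "{1, \<pi> 1, \<pi> (\<pi> 1)} = {1..3}" "\<pi> (\<pi> (\<pi> 1)) = 1" unfolding pv 3 by simp_all
    show ?thesis using multisection_perm_is_cycle[OF FM pp orb] unfolding pv .
  qed
  ultimately have HC: "has_cycle alt (tuples (sec (F 1 1)) (sec (F 1 2)) (sec (F 1 3)) (F 1 1))" by (auto simp: has_cycle_def)
  have sF: "sec (F 1 j) (\<r> b) = sec (B j) (\<s> b) \<star> \<i> b" "sec (B j) (\<s> b) \<in> \<AA>" "\<s> (sec (B j) (\<s> b)) = \<s> b"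
    if b: "b \<in> B 1" and j: "j \<in> {1, 2, 3}" for b j
  proof -
    have bA: "b \<in> \<AA>" using sl(2)[of 1] b by auto
    have "\<s> b \<in> \<s> ` B j" using B(2)[of 1] B(2)[OF j] b by auto
    note S = secD[OF sl(1)[OF j] this]
    show "sec (B j) (\<s> b) \<in> \<AA>" "\<s> (sec (B j) (\<s> b)) = \<s> b" using S by auto
    have "sec (B j) (\<s> b) \<star> \<i> b \<in> F 1 j" unfolding F_def using S b bA by (intro gset_multI) (auto simp: gset_inv_def)
    moreover have "slice (F 1 j)" using multisectionD(2)[OF FM, of 1 j] j by auto
    ultimately show "sec (F 1 j) (\<r> b) = sec (B j) (\<s> b) \<star> \<i> b" using S bA by (intro sec_eqI) auto
  qed
  have secF: "section_on (sec (F 1 j)) (F 1 1)" if j: "j \<in> {1, 2, 3}" for j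
    unfolding section_on_def
  proof
    fix y assume "y \<in> F 1 1"
    then have "y \<in> \<s> ` F 1 j" using multisectionD(5)[OF FM, of 1 j] j by auto
    from secD[OF multisectionD(2)[OF FM, of 1 j] this] j
    show "sec (F 1 j) y \<in> \<AA> \<and> \<s> (sec (F 1 j) y) = y" by auto
  qed
  have eq: "(sec (B 1) (\<s> b), sec (B 2) (\<s> b), sec (B 3) (\<s> b)) =
      (sec (F 1 1) (\<r> b) \<star> b, sec (F 1 2) (\<r> b) \<star> b, sec (F 1 3) (\<r> b) \<star> b)" if b: "b \<in> B 1" for b
    using sF[OF b, of 1] sF[OF b, of 2] sF[OF b, of 3] sl(2)[of 1] b by auto
  show ?thesis
  proof (rule has_cycle_shift[OF subgroup_alt HC])
    show "same_source (tuples (sec (F 1 1)) (sec (F 1 2)) (sec (F 1 3)) (F 1 1))"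
      using secF by (intro same_source_tuples) auto
  next
    fix t assume "t \<in> tuples (sec (B 1)) (sec (B 2)) (sec (B 3)) V"
    then obtain b where b: "b \<in> B 1" "t = (sec (B 1) (\<s> b), sec (B 2) (\<s> b), sec (B 3) (\<s> b))"
      using B(2)[of 1] by (auto simp: tuples_def)
    have bA: "b \<in> \<AA>" using sl(2)[of 1] b by auto
    have rb: "\<r> b \<in> F 1 1" using b Fii[of 1] by auto
    have "(sec (F 1 1) (\<r> b), sec (F 1 2) (\<r> b), sec (F 1 3) (\<r> b)) \<in> tuples (sec (F 1 1)) (sec (F 1 2)) (sec (F 1 3)) (F 1 1)"
      unfolding tuples_def using rb by (rule imageI)
    moreover have "\<s> (sec (F 1 1) (\<r> b)) = \<r> b" using secF[of 1] rb by (simp add: section_on_def)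
    ultimately show "\<exists>a b' d h. (a, b', d) \<in> tuples (sec (F 1 1)) (sec (F 1 2)) (sec (F 1 3)) (F 1 1) \<and> h \<in> \<AA> \<and>
       \<s> a = \<r> h \<and> t = (a \<star> h, b' \<star> h, d \<star> h)"
      unfolding b(2) eq[OF b(1)] using bA by blast
  next
    fix a b' d assume "(a, b', d) \<in> tuples (sec (F 1 1)) (sec (F 1 2)) (sec (F 1 3)) (F 1 1)"
    then obtain y where y: "y \<in> F 1 1" "a = sec (F 1 1) y" "b' = sec (F 1 2) y" "d = sec (F 1 3) y"
      by (auto simp: tuples_def)
    then obtain b where b: "b \<in> B 1" "y = \<r> b" using Fii[of 1] by auto
    have bA: "b \<in> \<AA>" using sl(2)[of 1] b by auto
    have "\<s> a = \<r> b" using secF[of 1] y b by (simp add: section_on_def)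
    moreover have "(a \<star> b, b' \<star> b, d \<star> b) \<in> tuples (sec (B 1)) (sec (B 2)) (sec (B 3)) V"
      unfolding y(2,3,4) b(2) eq[OF b(1), symmetric] tuples_def using B(2)[of 1] b(1) by auto
    ultimately show "\<exists>h. h \<in> \<AA> \<and> \<s> a = \<r> h \<and> (a \<star> h, b' \<star> h, d \<star> h) \<in> tuples (sec (B 1)) (sec (B 2)) (sec (B 3)) V"
      using bA by blast
  qed
qed

text \<open>Among the six permutations of three points the transpositions are odd, which leaves the
  identity and the two 3-cycles.\<close>

lemma even_perm_3:
  assumes p: "\<pi> permutes {1..3::nat}" and e: "evenperm \<pi>"
  shows "\<pi> = id \<or> ({1, \<pi> 1, \<pi> (\<pi> 1)} = {1..3} \<and> \<pi> (\<pi> (\<pi> 1)) = 1)"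
proof -
  have 3: "{1..3} = {1, 2, 3::nat}" by auto
  have v: "\<pi> 1 \<in> {1, 2, 3}" "\<pi> 2 \<in> {1, 2, 3}" "\<pi> 3 \<in> {1, 2, 3}"
    using permutes_in_image[OF p] unfolding 3 by auto
  have ne: "\<pi> 1 \<noteq> \<pi> 2" "\<pi> 1 \<noteq> \<pi> 3" "\<pi> 2 \<noteq> \<pi> 3" using permutes_inj[OF p] unfolding inj_def by fastforce+
  have out: "\<pi> x = x" if "x \<noteq> 1" "x \<noteq> 2" "x \<noteq> 3" for x
    by (rule permutes_not_in[OF p]) (use that in auto)
  have odd: "\<not> evenperm (Transposition.transpose a b)" if "a \<noteq> b" for a b :: nat using that by (simp add: evenperm_swap)
  have no_swap: "\<not> (\<pi> a = b \<and> \<pi> b = a \<and> \<pi> c = c)" if abc: "{a, b, c} = {1, 2, 3}" "distinct [a, b, c]" for a b c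
  proof
    assume *: "\<pi> a = b \<and> \<pi> b = a \<and> \<pi> c = c"
    have "\<pi> x = Transposition.transpose a b x" for x
    proof (cases "x \<in> {a, b, c}")
      case True
      then show ?thesis using * abc(2) by (auto simp: transpose_def)
    next
      case False
      then have "\<pi> x = x" using out abc(1) by blast
      then show ?thesis using False by (simp add: transpose_def)
    qed
    then have "\<pi> = Transposition.transpose a b" by blast
    then show False using e odd[of a b] abc(2) by simp
  qed
  have n: "\<not> (\<pi> 2 = 3 \<and> \<pi> 3 = 2 \<and> \<pi> 1 = 1)" "\<not> (\<pi> 1 = 2 \<and> \<pi> 2 = 1 \<and> \<pi> 3 = 3)" "\<not> (\<pi> 1 = 3 \<and> \<pi> 3 = 1 \<and> \<pi> 2 = 2)"
    by (rule no_swap; auto)+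
  consider "\<pi> 1 = 1 \<and> \<pi> 2 = 2 \<and> \<pi> 3 = 3" | "\<pi> 1 = 2 \<and> \<pi> 2 = 3 \<and> \<pi> 3 = 1" | "\<pi> 1 = 3 \<and> \<pi> 2 = 1 \<and> \<pi> 3 = 2"
    using v ne n by auto
  then show ?thesis
  proof cases
    case 1
    have "\<pi> = id"
    proof
      fix x show "\<pi> x = id x" using 1 out[of x] by (cases "x = 1"; cases "x = 2"; cases "x = 3") auto
    qed
    then show ?thesis ..
  next
    case 2
    then show ?thesis unfolding 3 by simp
  next
    case 3
    then show ?thesis unfolding \<open>{1..3} = {1, 2, 3::nat}\<close> by auto
  qed
qed

lemma multisection_perm_id: "multisection G d F \<Longrightarrow> multisection_perm G d F id = \<UU>"
  using multisectionD(3)[of d F] unfolding multisection_perm_def by fastforce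

section \<open>Colourings of the unit space\<close>

lemma clop_compact_ex: assumes "clop U" "\<And>x. x \<in> U \<Longrightarrow> \<exists>V. clop V \<and> x \<in> V \<and> Q V"
  shows "\<exists>\<V>. finite \<V> \<and> (\<forall>V\<in>\<V>. clop V \<and> Q V) \<and> U \<subseteq> \<Union>\<V>"
proof -
  obtain \<V> where \<V>: "finite \<V>" "\<And>V. V \<in> \<V> \<Longrightarrow> clop V \<and> Q V" "U \<subseteq> \<Union>\<V>"
    using clop_compact[of U Q, OF assms] by metis
  show ?thesis by (intro exI[of _ \<V>] conjI ballI \<V>)
qed

text \<open>The neighbourhood filter of \<open>x\<close> in the unit space, expressed by clopen
  witnesses so that these can serve as bases of cycles.\<close>

definition near where "near x Q \<longleftrightarrow> (\<exists>V. clop V \<and> x \<in> V \<and> (\<forall>y\<in>V. Q y))"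

lemma near_mono: "near x Q \<Longrightarrow> (\<And>y. y \<in> \<UU> \<Longrightarrow> Q y \<Longrightarrow> R y) \<Longrightarrow> near x R"
  unfolding near_def using clop_subset by metis

lemma near_conj: assumes "near x Q" "near x R" shows "near x (\<lambda>y. Q y \<and> R y)"
proof -
  obtain V W where "clop V" "x \<in> V" "\<forall>y\<in>V. Q y" "clop W" "x \<in> W" "\<forall>y\<in>W. R y"
    using assms unfolding near_def by blast
  then show ?thesis unfolding near_def using clop_ops(3)[of V W] by blast
qed

lemma near_True: "x \<in> \<UU> \<Longrightarrow> near x (\<lambda>_. True)"
  using clop_ops(1) unfolding near_def by blast

lemma near_finite: assumes "finite I" "x \<in> \<UU>" "\<And>i. i \<in> I \<Longrightarrow> near x (Q i)" shows "near x (\<lambda>y. \<forall>i\<in>I. Q i y)"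
  using assms(1,3)
proof (induction I rule: finite_induct)
  case empty
  then show ?case using near_True[OF assms(2)] by simp
next
  case (insert i I)
  have "near x (\<lambda>y. Q i y \<and> (\<forall>i\<in>I. Q i y))"
    by (rule near_conj) (use insert in auto)
  then show ?case by simp
qed

lemma near_clop: "clop V \<Longrightarrow> x \<in> V \<Longrightarrow> near x (\<lambda>y. y \<in> V)"
  unfolding near_def by blast

lemma clop_preimage: assumes "bisection G B" "clop K" shows "clop {y \<in> \<s> ` B. \<r> (sec B y) \<in> K}"
proof -
  have K: "closedin UT K" "openin UT K" using assms(2) by (auto simp: clop_iff)
  have sl: "slice B" using assms(1) bisection_slice by blast
  have "{y \<in> \<s> ` B. \<r> (sec B y) \<in> K} = \<s> ` {f \<in> B. \<r> f \<in> K}" using sl by auto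
  then show ?thesis using bisection_clop(1)[OF bisection_subset(2)[OF assms(1) K]] by simp
qed

lemma near_src: "bisection G B \<Longrightarrow> x \<in> \<s> ` B \<Longrightarrow> near x (\<lambda>y. y \<in> \<s> ` B)"
  using near_clop bisection_clop(1) by blast

lemma near_rng: assumes "bisection G B" "x \<in> \<s> ` B" "clop K" "\<r> (sec B x) \<in> K"
  shows "near x (\<lambda>y. y \<in> \<s> ` B \<and> \<r> (sec B y) \<in> K)"
proof -
  have "near x (\<lambda>y. y \<in> {y \<in> \<s> ` B. \<r> (sec B y) \<in> K})"
    by (rule near_clop[OF clop_preimage[OF assms(1,3)]]) (use assms in blast)
  then show ?thesis by simp
qed

lemma near_rng_not: assumes "bisection G B" "x \<in> \<s> ` B" "clop K" "\<r> (sec B x) \<notin> K"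
  shows "near x (\<lambda>y. y \<in> \<s> ` B \<and> \<r> (sec B y) \<notin> K)"
proof -
  have "near x (\<lambda>y. y \<in> \<s> ` B - {y \<in> \<s> ` B. \<r> (sec B y) \<in> K})"
    by (rule near_clop) (use assms clop_ops(5)[OF bisection_clop(1)[OF assms(1)] clop_preimage[OF assms(1,3)]] in blast)+
  then show ?thesis by (rule near_mono) blast
qed

text \<open>\<open>A \<inter> B\<close> is open and \<open>src\<close> is an open map, so the two
  sections agree on a neighbourhood of the source of any common arrow.\<close>

lemma near_agree: assumes "bisection G A" "bisection G B" "g \<in> A" "g \<in> B"
  shows "near (\<s> g) (\<lambda>y. y \<in> \<s> ` A \<and> y \<in> \<s> ` B \<and> sec A y = sec B y)"
proof -
  have sl: "slice A" "slice B" using bisection_slice[OF assms(1)] bisection_slice[OF assms(2)] .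
  have "openin T A" "openin T B" using assms(1,2) unfolding bisection_iff by blast+
  then have "openin T (A \<inter> B)" by (rule openin_Int)
  from open_src_image[OF this]
  have o: "openin T (\<s> ` (A \<inter> B))" "\<s> ` (A \<inter> B) \<subseteq> \<UU>" unfolding openin_UT by blast+
  have sg: "\<s> g \<in> \<s> ` (A \<inter> B)" using assms by blast
  obtain V where V: "clop V" "\<s> g \<in> V" "V \<subseteq> \<s> ` (A \<inter> B)" by (rule clop_basis[OF o(1) sg subsetD[OF o(2) sg]])
  have "y \<in> \<s> ` A \<and> y \<in> \<s> ` B \<and> sec A y = sec B y" if y: "y \<in> V" for y
  proof -
    obtain h where "h \<in> A" "h \<in> B" "y = \<s> h" using V(3) y by blast
    then show ?thesis using sl by simp
  qed
  then show ?thesis unfolding near_def using V by blast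
qed

lemma restr_facts: assumes "bisection G B" "V \<subseteq> \<s> ` B"
  shows "\<s> ` restr B V = V" "y \<in> V \<Longrightarrow> sec (restr B V) y = sec B y"
proof -
  have sl: "slice B" using assms bisection_slice by blast
  show "\<s> ` restr B V = V" using assms(2) unfolding restr_def by blast
  assume "y \<in> V"
  then have "sec B y \<in> restr B V" "\<s> (sec B y) = y" using secD[OF sl, of y] assms(2) unfolding restr_def by auto
  moreover have "slice (restr B V)" using sl unfolding slice_def restr_def by (auto intro: inj_on_subset)
  ultimately show "sec (restr B V) y = sec B y" using sec_eqI by blast
qed

lemma sec_clop: assumes "V \<subseteq> \<UU>" "y \<in> V" shows "sec V y = y"
proof (rule sec_eqI)
  show "slice V" using assms units_subset unfolding slice_def inj_on_def by (auto simp: unitD subset_iff)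
qed (use assms unitD in auto)

text \<open>Clopen sets separating the ranges at \<open>x\<close> keep doing so on a small
  \<open>V\<close> by continuity of the sections. The sets \<open>K\<close> are returned as well,
  since the colouring is built from them.\<close>

lemma separating_neighbourhood:
  assumes fin: "finite I" and x: "x \<in> \<UU>"
    and A: "\<And>i. i \<in> I \<Longrightarrow> bisection G (A i)" "\<And>i. i \<in> I \<Longrightarrow> x \<in> \<s> ` A i"
    and inj: "inj_on (\<lambda>i. \<r> (sec (A i) x)) I"
  shows "\<exists>K V. clop V \<and> x \<in> V \<and> (\<forall>i\<in>I. V \<subseteq> \<s> ` A i) \<and>
    (\<forall>i\<in>I. \<forall>j\<in>I. i \<noteq> j \<longrightarrow> clop (K i j) \<and> (\<forall>y\<in>V. \<r> (sec (A i) y) \<in> K i j \<and> \<r> (sec (A j) y) \<notin> K i j))"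
proof -
  let ?r = "\<lambda>i. \<r> (sec (A i) x)"
  define K where "K i j = (SOME K. clop K \<and> ?r i \<in> K \<and> ?r j \<notin> K)" for i j
  have K: "clop (K i j) \<and> ?r i \<in> K i j \<and> ?r j \<notin> K i j" if ij: "i \<in> I" "j \<in> I" "i \<noteq> j" for i j
  proof -
    have "?r i \<noteq> ?r j" using inj_onD[OF inj _ ij(1,2)] ij(3) by blast
    moreover have "?r l \<in> \<UU>" if l: "l \<in> I" for l
      by (rule unitI(1)[OF secD(3)[OF bisection_slice[OF A(1)[OF l]] A(2)[OF l]]])
    ultimately have "\<exists>K. clop K \<and> ?r i \<in> K \<and> ?r j \<notin> K" using clop_separate[of "?r i" "?r j"] ij by metis
    then show ?thesis unfolding K_def by (rule someI_ex)
  qed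
  let ?J = "{t \<in> I \<times> I. fst t \<noteq> snd t}"
  have "near x (\<lambda>y. \<forall>i\<in>I. y \<in> \<s> ` A i)"
    by (rule near_finite[OF fin x]) (rule near_src[OF A])
  moreover have "near x (\<lambda>y. \<forall>t\<in>?J. (y \<in> \<s> ` A (fst t) \<and> \<r> (sec (A (fst t)) y) \<in> K (fst t) (snd t)) \<and>
     (y \<in> \<s> ` A (snd t) \<and> \<r> (sec (A (snd t)) y) \<notin> K (fst t) (snd t)))"
  proof (rule near_finite[OF _ x])
    fix t assume t: "t \<in> ?J"
    then have m: "fst t \<in> I" "snd t \<in> I" by auto
    have k: "clop (K (fst t) (snd t))" "?r (fst t) \<in> K (fst t) (snd t)" "?r (snd t) \<notin> K (fst t) (snd t)"
      using K[OF m] t by auto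
    show "near x (\<lambda>y. (y \<in> \<s> ` A (fst t) \<and> \<r> (sec (A (fst t)) y) \<in> K (fst t) (snd t)) \<and>
     (y \<in> \<s> ` A (snd t) \<and> \<r> (sec (A (snd t)) y) \<notin> K (fst t) (snd t)))"
      by (rule near_conj[OF near_rng[OF A[OF m(1)] k(1,2)] near_rng_not[OF A[OF m(2)] k(1,3)]])
  qed (use fin in simp)
  ultimately have "near x (\<lambda>y. (\<forall>i\<in>I. y \<in> \<s> ` A i) \<and> (\<forall>t\<in>?J. (y \<in> \<s> ` A (fst t) \<and> \<r> (sec (A (fst t)) y) \<in> K (fst t) (snd t)) \<and>
     (y \<in> \<s> ` A (snd t) \<and> \<r> (sec (A (snd t)) y) \<notin> K (fst t) (snd t))))" by (rule near_conj)
  then obtain V where V: "clop V" "x \<in> V" and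
    V1: "\<forall>y\<in>V. (\<forall>i\<in>I. y \<in> \<s> ` A i) \<and> (\<forall>t\<in>?J. (y \<in> \<s> ` A (fst t) \<and> \<r> (sec (A (fst t)) y) \<in> K (fst t) (snd t)) \<and>
     (y \<in> \<s> ` A (snd t) \<and> \<r> (sec (A (snd t)) y) \<notin> K (fst t) (snd t)))"
    unfolding near_def by blast
  have V2: "clop (K i j) \<and> (\<forall>y\<in>V. \<r> (sec (A i) y) \<in> K i j \<and> \<r> (sec (A j) y) \<notin> K i j)" if "i \<in> I" "j \<in> I" "i \<noteq> j" for i j
  proof (intro conjI ballI)
    show "clop (K i j)" using K[OF that] by blast
    fix y assume "y \<in> V"
    from V1[rule_format, OF this, THEN conjunct2, rule_format, of "(i, j)"] that
    show "\<r> (sec (A i) y) \<in> K i j" "\<r> (sec (A j) y) \<notin> K i j" by simp_all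
  qed
  have "\<forall>i\<in>I. V \<subseteq> \<s> ` A i" using V1 by blast
  then show ?thesis using V V2 by blast
qed

section \<open>Local stars and the colours derived from them\<close>

definition local_star where "local_star N V B K \<longleftrightarrow> clop V \<and> B 0 = V \<and>
  (\<forall>j<N. bisection G (B j) \<and> \<s> ` B j = V) \<and>
  (\<forall>i<N. \<forall>j<N. i \<noteq> j \<longrightarrow> clop (K i j) \<and> (\<forall>f\<in>B i. \<r> f \<in> K i j) \<and> (\<forall>f\<in>B j. \<r> f \<notin> K i j))"

text \<open>This is where infinite orbits enter: they give arbitrarily many arrows out of
  \<open>x\<close> with distinct ranges, and \<open>separating_neighbourhood\<close> spreads them
  over a clopen set.\<close>

lemma local_star_ex:
  assumes "infinite_orbits G" "x \<in> \<UU>"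
  shows "\<exists>V B K. x \<in> V \<and> local_star (N :: nat) V B K"
proof -
  have "infinite (orbit_of G x - {x})" using assms by (simp add: infinite_orbits_def)
  then obtain f :: "nat \<Rightarrow> 'a" where f: "inj f" "range f \<subseteq> orbit_of G x - {x}"
    using infinite_countable_subset by blast
  \<comment> \<open>Index 0 is reserved for \<open>x\<close>, reached by the unit \<open>x\<close>;
    an injective sequence in the rest of the orbit fills the other indices.\<close>
  define pt where "pt j = (case j of 0 \<Rightarrow> x | Suc k \<Rightarrow> f k)" for j
  have pt: "pt 0 = x" "inj pt" 
    using f by (auto simp: pt_def inj_def split: nat.splits) blast+
  have "\<exists>g. g \<in> \<AA> \<and> \<s> g = x \<and> \<r> g = pt j \<and> (j = 0 \<longrightarrow> g = x)" for j
  proof (cases j)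
    case 0
    then show ?thesis using assms(2) unitD pt by auto
  next
    case (Suc k)
    then have "pt j \<in> orbit_of G x" using f(2) by (auto simp: pt_def)
    then show ?thesis using Suc by (auto simp: orbit_of_def)
  qed
  then obtain e where e: "\<And>j. e j \<in> \<AA>" "\<And>j. \<s> (e j) = x" "\<And>j. \<r> (e j) = pt j" "e 0 = x" by metis
  \<comment> \<open>With all units as the bisection at index 0, its restriction to \<open>V\<close>
    is \<open>V\<close>.\<close>
  have "\<exists>A. bisection G A \<and> e j \<in> A \<and> (j = 0 \<longrightarrow> A = \<UU>)" for j
    using arrow_bisection[OF e(1)] e(4) assms(2) clop_bisection[OF clop_ops(1)] by metis
  then obtain A where A: "\<And>j. bisection G (A j)" "\<And>j. e j \<in> A j" "A 0 = \<UU>" by metis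
  have sl: "slice (A j)" for j using A(1) bisection_slice by blast
  have xA: "x \<in> \<s> ` A j" for j using A(2)[of j] e(2)[of j] by (metis imageI)
  have sx: "sec (A j) x = e j" for j using sec_eqI[OF sl A(2) e(2)] .
  have "inj_on (\<lambda>j. \<r> (sec (A j) x)) {..<N}" using pt(2) unfolding sx e(3) inj_def inj_on_def by blast
  from separating_neighbourhood[of "{..<N}" x A, OF _ assms(2) A(1) xA this]
  obtain K V where V: "clop V" "x \<in> V" and V': "\<forall>j\<in>{..<N}. V \<subseteq> \<s> ` A j" and
    K': "\<forall>i\<in>{..<N}. \<forall>j\<in>{..<N}. i \<noteq> j \<longrightarrow> clop (K i j) \<and> (\<forall>y\<in>V. \<r> (sec (A i) y) \<in> K i j \<and> \<r> (sec (A j) y) \<notin> K i j)"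
    by blast
  have V3: "V \<subseteq> \<s> ` A j" if "j < N" for j using V' that by simp
  have K: "clop (K i j) \<and> (\<forall>y\<in>V. \<r> (sec (A i) y) \<in> K i j \<and> \<r> (sec (A j) y) \<notin> K i j)"
    if "i < N" "j < N" "i \<noteq> j" for i j using K' that by simp
  let ?B = "\<lambda>j. restr (A j) V"
  have el: "\<exists>y\<in>V. f = sec (A j) y" if "f \<in> ?B j" for f j
    using that sec_eq[OF sl, of f j] unfolding restr_def by (intro bexI[of _ "\<s> f"]) auto
  have "local_star N V ?B K" unfolding local_star_def
  proof (intro conjI allI impI ballI)
    show "?B 0 = V" using V(1) A(3) unitD(2) unfolding restr_def clop_def by auto
    fix j assume j: "j < N"
    show "bisection G (?B j)" by (rule bisection_restr[OF A(1) V(1)])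
    show "\<s> ` ?B j = V" by (rule restr_facts(1)[OF A(1) V3[OF j]])
  next
    fix i j f assume ij: "i < N" "j < N" "i \<noteq> j"
    show "clop (K i j)" using K[OF ij] by blast
    show "\<r> f \<in> K i j" if f: "f \<in> ?B i" using el[OF f] K[OF ij] by blast
    show "\<r> f \<notin> K i j" if f: "f \<in> ?B j" using el[OF f] K[OF ij] by blast
  qed fact
  then show ?thesis using V(2) by blast
qed

text \<open>Here colours replace the separating sets. Unlike those, which belong to a single star,
  colours also compare sections of different pieces.\<close>

definition piece where "piece \<kappa> N p \<longleftrightarrow> (case p of (V, B, col) \<Rightarrow> clop V \<and> B 0 = V \<and>
  (\<forall>j<N. bisection G (B j) \<and> \<s> ` B j = V \<and> (\<forall>f\<in>B j. \<kappa> (\<r> f) = col j)) \<and> inj_on col {..<N::nat})"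

text \<open>The colour of a unit records which of the finitely many separating sets contain it.
  Sections \<open>i\<close> and \<open>j\<close> over \<open>V\<close> differ at the entry
  \<open>(V, i, j)\<close>. As these sets are clopen, colours are locally constant along each
  section, so a second compactness argument refines the cover to bases on which they are
  constant.\<close>

lemma coloring:
  assumes "infinite_orbits G"
  obtains \<kappa> :: "'a \<Rightarrow> ('a set \<times> nat \<times> nat) set" and P where "finite P" "\<And>p. p \<in> P \<Longrightarrow> piece \<kappa> N p"
    "\<UU> \<subseteq> \<Union>(fst ` P)"
proof -
  have "\<exists>V. clop V \<and> x \<in> V \<and> (\<exists>B K. local_star N V B K)" if x: "x \<in> \<UU>" for x
  proof -
    obtain V B K where L: "x \<in> V" "local_star N V B K" using local_star_ex[OF assms x] by blast
    then have "clop V" unfolding local_star_def by blast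
    then show ?thesis using L by blast
  qed
  from clop_compact_ex[OF clop_ops(1) this]
  obtain \<V> where \<V>: "finite \<V>" "\<forall>V\<in>\<V>. clop V \<and> (\<exists>B K. local_star N V B K)" "\<UU> \<subseteq> \<Union>\<V>"
    by blast
  have "\<forall>V\<in>\<V>. \<exists>B K. local_star N V B K" using \<V>(2) by blast
  then obtain B K where BK: "\<And>V. V \<in> \<V> \<Longrightarrow> local_star N V (B V) (K V)" by metis
  let ?I = "{t \<in> \<V> \<times> {..<N} \<times> {..<N}. fst (snd t) \<noteq> snd (snd t)}"
  have fI: "finite ?I" using \<V>(1) by auto
  define \<kappa> where "\<kappa> u = {t \<in> ?I. u \<in> K (fst t) (fst (snd t)) (snd (snd t))}" for u
  have "\<exists>W. clop W \<and> z \<in> W \<and> (\<exists>p. piece \<kappa> N p \<and> fst p = W)" if z: "z \<in> \<UU>" for z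
  proof -
    obtain V where V: "V \<in> \<V>" "z \<in> V" using \<V>(3) z by blast
    note L = BK[OF V(1), unfolded local_star_def]
    have b: "bisection G (B V j)" "\<s> ` B V j = V" if "j < N" for j using L that by blast+
    have cV: "clop V" using L by blast
    have cK: "clop (K (fst t) (fst (snd t)) (snd (snd t)))" if "t \<in> ?I" for t
      using BK[of "fst t"] that unfolding local_star_def by auto
    have "near z (\<lambda>y. (\<r> (sec (B V j) y) \<in> K (fst t) (fst (snd t)) (snd (snd t))) =
       (\<r> (sec (B V j) z) \<in> K (fst t) (fst (snd t)) (snd (snd t))))" if j: "j < N" and t: "t \<in> ?I" for j t
    proof (cases "\<r> (sec (B V j) z) \<in> K (fst t) (fst (snd t)) (snd (snd t))")
      case True
      then show ?thesis using near_mono[OF near_rng[OF b(1)[OF j] _ cK[OF t] True]] V b(2)[OF j] by auto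
    next
      case False
      then show ?thesis using near_mono[OF near_rng_not[OF b(1)[OF j] _ cK[OF t] False]] V b(2)[OF j] by auto
    qed
    then have "near z (\<lambda>y. \<forall>t\<in>?I. (\<r> (sec (B V j) y) \<in> K (fst t) (fst (snd t)) (snd (snd t))) =
       (\<r> (sec (B V j) z) \<in> K (fst t) (fst (snd t)) (snd (snd t))))" if j: "j \<in> {..<N}" for j
      by (intro near_finite[OF fI z]) (use j in auto)
    then have "near z (\<lambda>y. \<forall>j\<in>{..<N}. \<forall>t\<in>?I. (\<r> (sec (B V j) y) \<in> K (fst t) (fst (snd t)) (snd (snd t))) =
       (\<r> (sec (B V j) z) \<in> K (fst t) (fst (snd t)) (snd (snd t))))"
      by (rule near_finite[OF finite_lessThan z])
    from near_conj[OF near_clop[OF cV V(2)] this]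
    obtain W where W: "clop W" "z \<in> W" "W \<subseteq> V" and
      Wt: "\<And>y j t. y \<in> W \<Longrightarrow> j < N \<Longrightarrow> t \<in> ?I \<Longrightarrow> (\<r> (sec (B V j) y) \<in> K (fst t) (fst (snd t)) (snd (snd t))) =
       (\<r> (sec (B V j) z) \<in> K (fst t) (fst (snd t)) (snd (snd t)))"
      unfolding near_def by blast
    have \<kappa>W: "\<kappa> (\<r> (sec (B V j) y)) = \<kappa> (\<r> (sec (B V j) z))" if "y \<in> W" "j < N" for y j
      unfolding \<kappa>_def using Wt[OF that] by blast
    let ?B = "\<lambda>j. restr (B V j) W"
    let ?p = "(W, ?B, \<lambda>j. \<kappa> (\<r> (sec (B V j) z)))"
    have "piece \<kappa> N ?p" unfolding piece_def prod.case
    proof (intro conjI allI impI ballI)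
      show "clop W" by fact
      have "B V 0 = V" using L by blast
      then show "?B 0 = W" using W(3) cV unitD(2) unfolding restr_def clop_def by auto
      fix j assume j: "j < N"
      show "bisection G (?B j)" using bisection_restr[OF b(1)[OF j] W(1)] .
      show "\<s> ` ?B j = W" using restr_facts(1)[OF b(1)[OF j]] W(3) b(2)[OF j] by blast
      fix f assume f: "f \<in> ?B j"
      then have "f = sec (B V j) (\<s> f)" "\<s> f \<in> W"
        using bisection_slice[OF b(1)[OF j]] unfolding restr_def by auto
      then show "\<kappa> (\<r> f) = \<kappa> (\<r> (sec (B V j) z))" using \<kappa>W[OF _ j, of "\<s> f"] by simp
    next
      show "inj_on (\<lambda>j. \<kappa> (\<r> (sec (B V j) z))) {..<N}"
      proof (intro inj_onI, rule ccontr)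
        fix i j assume ij: "i \<in> {..<N}" "j \<in> {..<N}" "\<kappa> (\<r> (sec (B V i) z)) = \<kappa> (\<r> (sec (B V j) z))" "i \<noteq> j"
        have m: "sec (B V i) z \<in> B V i" "sec (B V j) z \<in> B V j"
          using secD(1)[OF bisection_slice[OF b(1)]] b(2) V(2) ij by auto
        have t: "(V, i, j) \<in> ?I" using V(1) ij by auto
        have "\<r> (sec (B V i) z) \<in> K V i j" "\<r> (sec (B V j) z) \<notin> K V i j" using L m ij by auto
        then have "(V, i, j) \<in> \<kappa> (\<r> (sec (B V i) z))" "(V, i, j) \<notin> \<kappa> (\<r> (sec (B V j) z))"
          using t unfolding \<kappa>_def by auto
        then show False using ij(3) by blast
      qed
    qed
    then show ?thesis using W by (intro exI[of _ W]) auto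
  qed
  from clop_compact_ex[OF clop_ops(1) this]
  obtain \<W> where \<W>: "finite \<W>" "\<forall>W\<in>\<W>. clop W \<and> (\<exists>p. piece \<kappa> N p \<and> fst p = W)" "\<UU> \<subseteq> \<Union>\<W>"
    by blast
  have "\<forall>W\<in>\<W>. \<exists>p. piece \<kappa> N p \<and> fst p = W" using \<W>(2) by blast
  then obtain pc where pc: "\<And>W. W \<in> \<W> \<Longrightarrow> piece \<kappa> N (pc W) \<and> fst (pc W) = W" by metis
  show ?thesis
  proof (rule that[of "pc ` \<W>" \<kappa>])
    have "fst ` pc ` \<W> = \<W>" using pc by (auto simp: image_iff)
    then show "\<UU> \<subseteq> \<Union>(fst ` pc ` \<W>)" using \<W>(3) by simp
  qed (use \<W>(1) pc in auto)
qed

section \<open>Restricting generators to smaller clopen sets\<close>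

abbreviation "pdom p \<equiv> fst p"
abbreviation "psec p j \<equiv> sec (fst (snd p) j)"
abbreviation "pcol p \<equiv> snd (snd p)"
text \<open>The section \<open>b\<close> prolonged by \<open>F\<close>: follow \<open>F\<close> and
  then \<open>b\<close> at the point reached. It starts where \<open>F\<close> starts and has the
  ranges, hence the colours, of \<open>b\<close>.\<close>

abbreviation "via F b \<equiv> (\<lambda>y. b (\<r> (sec F y)) \<star> sec F y)"
abbreviation "pull F V W \<equiv> {y \<in> V \<inter> \<s> ` F. \<r> (sec F y) \<in> W}"

lemma pieceD: assumes "piece \<kappa> N p" "j < N"
  shows "clop (pdom p)" "bisection G (fst (snd p) j)" "\<s> ` fst (snd p) j = pdom p"
    "y \<in> pdom p \<Longrightarrow> psec p j y \<in> \<AA>" "y \<in> pdom p \<Longrightarrow> \<s> (psec p j y) = y"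
    "y \<in> pdom p \<Longrightarrow> \<kappa> (\<r> (psec p j y)) = pcol p j"
    "y \<in> pdom p \<Longrightarrow> psec p 0 y = y" "y \<in> pdom p \<Longrightarrow> psec p j y \<in> fst (snd p) j"
    "inj_on (pcol p) {..<N}"
proof -
  obtain V B col where p: "p = (V, B, col)" by (cases p) auto
  note D = assms(1)[unfolded p piece_def prod.case]
  show V: "clop (pdom p)" and b: "bisection G (fst (snd p) j)" "\<s> ` fst (snd p) j = pdom p" and "inj_on (pcol p) {..<N}"
    using D assms(2) unfolding p by auto
  assume y: "y \<in> pdom p"
  note S = secD[OF bisection_slice[OF b(1)], unfolded b(2), OF y]
  show "psec p j y \<in> \<AA>" "\<s> (psec p j y) = y" "psec p j y \<in> fst (snd p) j" using S by blast+
  show "\<kappa> (\<r> (psec p j y)) = pcol p j" using D assms(2) S(1) unfolding p by auto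
  have "fst (snd p) 0 = pdom p" using D unfolding p by auto
  then show "psec p 0 y = y" using sec_clop[of "pdom p" y] V y unfolding clop_def by simp
qed

lemma piece_section_on: "piece \<kappa> N p \<Longrightarrow> j < N \<Longrightarrow> W \<subseteq> pdom p \<Longrightarrow> section_on (psec p j) W"
  unfolding section_on_def using pieceD(4,5) by blast

text \<open>Colours tell the indices apart even over different base points; for equal indices,
  injectivity of \<open>rng\<close> on the bisection identifies the base points.\<close>

lemma piece_star: assumes "piece \<kappa> N p" shows "star (psec p) {..<N} (pdom p)"
  unfolding star_def
proof (intro conjI ballI impI)
  fix i assume "i \<in> {..<N}"
  then show "section_on (psec p i) (pdom p)" using piece_section_on[OF assms] by simp
next
  fix i j y z assume i: "i \<in> {..<N}" and j: "j \<in> {..<N}" and y: "y \<in> pdom p" and z: "z \<in> pdom p"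
    and eq: "\<r> (psec p i y) = \<r> (psec p j z)"
  have i': "i < N" "j < N" using i j by auto
  have "pcol p i = pcol p j" using pieceD(6)[OF assms i'(1) y] pieceD(6)[OF assms i'(2) z] eq by simp
  then show "i = j" using inj_onD[OF pieceD(9)[OF assms i'(1)] _ i j] by blast
  then have "psec p i y = psec p i z"
    using slice_rng_inj[OF bisection_slice[OF pieceD(2)[OF assms i'(1)]]] pieceD(8)[OF assms i'(1)] y z eq by simp
  then show "y = z" using pieceD(5)[OF assms i'(1)] y z by metis
qed

end

text \<open>\<open>H\<close> is abstract and known only through the cycles listed here; in the end
  it is the subgroup they generate. \<open>\<T>\<close> will be the cover together with the inverses
  of its members, so that its powers are the products in the definition of expansivity. In
  \<open>gen_bridge\<close> the distinct colours keep the three ranges disjoint.\<close>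

locale generating_system = cantor_groupoid +
  fixes H :: "'a set set" and P :: "('a set \<times> (nat \<Rightarrow> 'a set) \<times> (nat \<Rightarrow> 'k)) set"
    and \<kappa> :: "'a \<Rightarrow> 'k" and \<T> :: "'a set set"
  assumes subH: "subgroup H (full_group G)"
    and finP: "finite P"
    and pieces: "p \<in> P \<Longrightarrow> piece \<kappa> 7 p"
    and cover: "\<UU> \<subseteq> \<Union>(fst ` P)"
    and bisT: "F \<in> \<T> \<Longrightarrow> bisection G F"
    and basisT: "topology_basis T (\<Union>n\<in>{1..}. family_pow G \<T> n)"
    and gen_star: "p \<in> P \<Longrightarrow> {i, j, k} \<subseteq> {..<7} \<Longrightarrow> distinct [i, j, k] \<Longrightarrow>
       has_cycle H (tuples (psec p i) (psec p j) (psec p k) (pdom p))"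
    and gen_bridge: "F \<in> \<T> \<Longrightarrow> p \<in> P \<Longrightarrow> q \<in> P \<Longrightarrow> {a, b, c} \<subseteq> {..<7} \<Longrightarrow>
       distinct [pcol q c, pcol p a, pcol p b] \<Longrightarrow>
       has_cycle H (tuples (via F (psec q c)) (psec p a) (psec p b) (pull F (pdom p) (pdom q)))"
begin

section \<open>The ring of restrictable sets\<close>

text \<open>All triples of indices are demanded at once, so that commutators can draw on spare
  indices.\<close>

definition restrictable where "restrictable p W \<longleftrightarrow> W \<subseteq> pdom p \<and>
  (\<forall>i<7. \<forall>j<7. \<forall>k<7. distinct [i, j, k] \<longrightarrow> has_cycle H (tuples (psec p i) (psec p j) (psec p k) W))"

lemma restrictable_has_cycle: "restrictable p W \<Longrightarrow> i < 7 \<Longrightarrow> j < 7 \<Longrightarrow> k < 7 \<Longrightarrow> distinct [i, j, k] \<Longrightarrow> has_cycle H (tuples (psec p i) (psec p j) (psec p k) W)"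
  unfolding restrictable_def by blast

lemma restrictable_dom: "p \<in> P \<Longrightarrow> restrictable p (pdom p)"
  unfolding restrictable_def using gen_star by auto

lemma restrictable_empty: "restrictable p {}"
  unfolding restrictable_def using has_cycle_tuples_empty[OF subH] by blast

lemma fresh_index: assumes "length xs \<le> 6" shows "\<exists>l<7. l \<notin> set (xs :: nat list)"
proof (rule ccontr)
  assume "\<not> ?thesis"
  then have "{..<7} \<subseteq> set xs" by auto
  from card_mono[OF _ this] show False using assms card_length[of xs] by simp
qed

text \<open>With spare indices, the commutator of \<open>(i l k)\<close> over \<open>W\<close> and
  \<open>(k j m)\<close> over \<open>W'\<close> is \<open>(i j k)\<close> over the
  intersection.\<close>

lemma restrictable_Int: assumes p: "p \<in> P" and W: "restrictable p W" "restrictable p W'" shows "restrictable p (W \<inter> W')"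
  unfolding restrictable_def
proof (intro conjI allI impI)
  show "W \<inter> W' \<subseteq> pdom p" using W unfolding restrictable_def by blast
  fix i j k :: nat assume ijk: "i < 7" "j < 7" "k < 7" and d: "distinct [i, j, k]"
  obtain l where l: "l < 7" "l \<notin> {i, j, k}" using fresh_index[of "[i, j, k]"] by auto
  obtain m where m: "m < 7" "m \<notin> {i, j, k, l}" using fresh_index[of "[i, j, k, l]"] by auto
  show "has_cycle H (tuples (psec p i) (psec p j) (psec p k) (W \<inter> W'))"
  proof (rule has_cycle_star_commutator[OF subH piece_star[OF pieces[OF p]]])
    show "W \<subseteq> pdom p" "W' \<subseteq> pdom p" using W unfolding restrictable_def by auto
    show "has_cycle H (tuples (psec p i) (psec p l) (psec p k) W)" using restrictable_has_cycle[OF W(1)] ijk l d by auto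
    show "has_cycle H (tuples (psec p k) (psec p j) (psec p m) W')" using restrictable_has_cycle[OF W(2)] ijk l m d by auto
  qed (use ijk l m d in auto)
qed

text \<open>\<open>has_cycle_star_Diff\<close> wants nested sets, so the intersection, already known
  to be restrictable, is removed in place of \<open>W'\<close>.\<close>

lemma restrictable_Diff: assumes p: "p \<in> P" and W: "restrictable p W" "restrictable p W'" shows "restrictable p (W - W')"
  unfolding restrictable_def
proof (intro conjI allI impI)
  show "W - W' \<subseteq> pdom p" using W unfolding restrictable_def by blast
  fix i j k :: nat assume ijk: "i < 7" "j < 7" "k < 7" and d: "distinct [i, j, k]"
  have "has_cycle H (tuples (psec p i) (psec p j) (psec p k) (W - W \<inter> W'))"
  proof (rule has_cycle_star_Diff[OF subH piece_star[OF pieces[OF p]]])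
    show "W \<inter> W' \<subseteq> W" "W \<subseteq> pdom p" using W unfolding restrictable_def by auto
    show "has_cycle H (tuples (psec p i) (psec p j) (psec p k) W)" by (rule restrictable_has_cycle[OF W(1) ijk d])
    show "has_cycle H (tuples (psec p i) (psec p j) (psec p k) (W \<inter> W'))" by (rule restrictable_has_cycle[OF restrictable_Int[OF p W] ijk d])
  qed (use ijk in auto)
  then show "has_cycle H (tuples (psec p i) (psec p j) (psec p k) (W - W'))" by (simp add: Diff_Int)
qed

lemma restrictable_Un: assumes p: "p \<in> P" and W: "restrictable p W" "restrictable p W'" shows "restrictable p (W \<union> W')"
  unfolding restrictable_def
proof (intro conjI allI impI)
  show "W \<union> W' \<subseteq> pdom p" using W unfolding restrictable_def by blast
  fix i j k :: nat assume ijk: "i < 7" "j < 7" "k < 7" and d: "distinct [i, j, k]"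
  have "has_cycle H (tuples (psec p i) (psec p j) (psec p k) (W \<union> (W' - W)))"
  proof (rule has_cycle_star_Un[OF subH piece_star[OF pieces[OF p]]])
    show "W \<union> (W' - W) \<subseteq> pdom p" using W unfolding restrictable_def by auto
    show "has_cycle H (tuples (psec p i) (psec p j) (psec p k) W)" by (rule restrictable_has_cycle[OF W(1) ijk d])
    show "has_cycle H (tuples (psec p i) (psec p j) (psec p k) (W' - W))" by (rule restrictable_has_cycle[OF restrictable_Diff[OF p W(2,1)] ijk d])
  qed (use ijk in auto)
  then show "has_cycle H (tuples (psec p i) (psec p j) (psec p k) (W \<union> W'))" by simp
qed

lemma restrictable_UN: assumes p: "p \<in> P" and "finite I" "\<And>i. i \<in> I \<Longrightarrow> restrictable p (W i)" shows "restrictable p (\<Union>i\<in>I. W i)"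
  using assms(2,3)
proof (induction I rule: finite_induct)
  case empty
  then show ?case using restrictable_empty by simp
next
  case (insert i I)
  have "restrictable p (W i \<union> (\<Union>i\<in>I. W i))" by (rule restrictable_Un[OF p]) (use insert in auto)
  then show ?case by simp
qed

section \<open>Transport of restrictions along members of the cover\<close>

text \<open>The commutator of the restricted cycle \<open>(d e c)\<close> over \<open>W\<close> with
  the linking generator, whose first section is \<open>c\<close> prolonged by \<open>F\<close>. The
  bases lie at opposite ends of \<open>F\<close>, so the shifts are \<open>sec F y\<close> on one
  side and the unit \<open>y\<close> on the other. The colour hypothesis leaves \<open>c\<close> as
  the only contact.\<close>

lemma bridge:
  assumes F: "F \<in> \<T>" and p: "p \<in> P" and q: "q \<in> P" and W: "W \<subseteq> pdom q"
    and HC: "has_cycle H (tuples (psec q d) (psec q e) (psec q c) W)"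
    and cde: "{c, d, e} \<subseteq> {..<7}" "distinct [c, d, e]" and ab: "{a, b} \<subseteq> {..<7}" "a \<noteq> b"
    and col: "pcol p ` {a, b} \<inter> pcol q ` {c, d, e} = {}"
  shows "has_cycle H (tuples (via F (psec q d)) (psec p a) (via F (psec q c))
     (pull F (pdom p) W))" (is "has_cycle H (tuples ?d ?a ?c ?W)")
proof -
  let ?Z = "(pull F (pdom p) (pdom q))"
  note Pp = pieceD[OF pieces[OF p]] note Pq = pieceD[OF pieces[OF q]]
  have n: "a < 7" "b < 7" "c < 7" "d < 7" "e < 7" using cde ab by auto
  have "pcol p a \<noteq> pcol p b" using inj_onD[OF Pp(9)[OF n(1)], of a b] n ab by auto
  then have G: "has_cycle H (tuples ?c (psec p a) (psec p b) ?Z)"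
    by (intro gen_bridge[OF F p q]) (use n col in auto)
  have f: "sec F y \<in> \<AA>" "\<s> (sec F y) = y" if "y \<in> ?Z" for y
    using secD[OF bisection_slice[OF bisT[OF F]]] that by auto
  have colq: "\<kappa> (\<r> (psec q l z)) = pcol q l" if "l \<in> {c, d, e}" "z \<in> pdom q" for l z
    using Pq(6)[of l z] n that by auto
  have colp: "\<kappa> (\<r> (psec p l z)) = pcol p l" if "l \<in> {a, b}" "z \<in> pdom p" for l z
    using Pp(6)[of l z] n that by auto
  have colr: "pcol q c \<noteq> pcol q d" "pcol q c \<noteq> pcol q e" "pcol q d \<noteq> pcol q e"
    using inj_onD[OF Pq(9)[OF n(3)], of c d] inj_onD[OF Pq(9)[OF n(3)], of c e] inj_onD[OF Pq(9)[OF n(3)], of d e] n cde(2) by auto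
  have cl: "?c y \<in> \<AA>" "\<s> (?c y) = y" "\<r> (?c y) = \<r> (psec q c (\<r> (sec F y)))" if "y \<in> ?Z" for y
    using f[OF that] Pq(4,5)[OF n(3), of "\<r> (sec F y)"] that by auto
  have sZ: "section_on ?c ?Z" unfolding section_on_def using cl by blast
  show ?thesis
  proof (rule has_cycle_commutator[OF subH HC G])
    show "same_source (tuples (psec q d) (psec q e) (psec q c) W)"
      by (intro same_source_tuples piece_section_on[OF pieces[OF q]] n W)
    show "same_source (tuples ?c (psec p a) (psec p b) ?Z)"
      by (intro same_source_tuples piece_section_on[OF pieces[OF p]] n sZ) auto
  next
    fix x1 x2 x3 z1 z2 z3 assume 1: "(x1, x2, x3) \<in> tuples (psec q d) (psec q e) (psec q c) W"
      and 2: "(z1, z2, z3) \<in> tuples ?c (psec p a) (psec p b) ?Z"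
    obtain w where w: "w \<in> W" "w \<in> pdom q" "x1 = psec q d w" "x2 = psec q e w" "x3 = psec q c w" using 1 W unfolding tuples_def by auto
    obtain y where y: "y \<in> ?Z" "z1 = ?c y" "z2 = psec p a y" "z3 = psec p b y" using 2 unfolding tuples_def by auto
    have zq: "\<r> (sec F y) \<in> pdom q" and yp: "y \<in> pdom p" using y(1) by blast+
    have x: "\<kappa> (\<r> x1) = pcol q d" "\<kappa> (\<r> x2) = pcol q e" "\<kappa> (\<r> x3) = pcol q c"
      unfolding w by (rule colq[OF _ w(2)], simp)+
    have z: "\<kappa> (\<r> z1) = pcol q c" "\<kappa> (\<r> z2) = pcol p a" "\<kappa> (\<r> z3) = pcol p b"
      unfolding y(2,3,4) cl(3)[OF y(1)] by (rule colq[OF _ zq] colp[OF _ yp], simp)+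
    have cc: "pcol p a \<notin> {pcol q c, pcol q d, pcol q e}" "pcol p b \<notin> {pcol q c, pcol q d, pcol q e}" using col by auto
    show "{\<r> x1, \<r> x2} \<inter> {\<r> z1, \<r> z2, \<r> z3} = {} \<and> \<r> x3 \<notin> {\<r> z2, \<r> z3}"
      using x z colr cc by auto
    assume eq: "\<r> x3 = \<r> z1"
    \<comment> \<open>Equal ranges along the single section \<open>c\<close> force equal base
      points, so contact occurs exactly over the points that \<open>F\<close> carries into
      \<open>W\<close>.\<close>
    have "w = \<r> (sec F y)"
      using star_inj[OF piece_star[OF pieces[OF q]], of c c w "\<r> (sec F y)"] n zq w(2) eq
      unfolding w(5) y(2) cl(3)[OF y(1)] by simp
    then have yW: "y \<in> ?W" and r: "\<r> (?d y) = \<r> x1"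
      using y(1) w(1) f[OF y(1)] Pq(4,5)[OF n(4) w(2)] unfolding w(3) by simp_all
    show "\<exists>(a', d', e'')\<in>tuples ?d (psec p a) ?c ?W. \<r> a' = \<r> x1 \<and> \<r> d' = \<r> z2 \<and> \<r> e'' = \<r> x3"
      using r eq y yW by (intro bexI[of _ "(?d y, psec p a y, ?c y)"]) (auto simp: tuples_def)
  next
    fix t assume "t \<in> tuples ?d (psec p a) ?c ?W"
    then obtain y where y: "y \<in> ?W" "t = (?d y, psec p a y, ?c y)" by (auto simp: tuples_def)
    let ?z = "\<r> (sec F y)"
    have z: "?z \<in> W" "?z \<in> pdom q" using y W by auto
    have yZ: "y \<in> ?Z" using y(1) W by auto
    have m1: "(psec q d ?z, psec q e ?z, psec q c ?z) \<in> tuples (psec q d) (psec q e) (psec q c) W"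
      unfolding tuples_def using z(1) by (rule imageI)
    have m2: "(?c y, psec p a y, psec p b y) \<in> tuples ?c (psec p a) (psec p b) ?Z"
      unfolding tuples_def using yZ by (rule imageI)
    note S = section_onD[OF sZ yZ]
    have yp: "y \<in> pdom p" using yZ by blast
    have a: "psec p a y \<star> y = psec p a y"
      by (rule section_onD(6)[OF piece_section_on[OF pieces[OF p] n(1) subset_refl] yp])
    have c: "\<s> (psec q d ?z) = \<r> (sec F y)" "\<s> (?c y) = \<r> y" "psec q c ?z \<star> sec F y = ?c y \<star> y"
      "t = (psec q d ?z \<star> sec F y, psec p a y \<star> y, psec q c ?z \<star> sec F y)"
      using Pq(5)[OF n(4) z(2)] S(2,5,6) a y(2) by simp_all
    show "\<exists>a' b' e' h e'' d' f k. (a', b', e') \<in> tuples (psec q d) (psec q e) (psec q c) W \<and>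
       (e'', d', f) \<in> tuples ?c (psec p a) (psec p b) ?Z \<and> h \<in> \<AA> \<and> k \<in> \<AA> \<and>
        \<s> a' = \<r> h \<and> \<s> e'' = \<r> k \<and> e' \<star> h = e'' \<star> k \<and> t = (a' \<star> h, d' \<star> k, e' \<star> h)"
      by (intro exI conjI) (rule m1, rule m2, rule f(1)[OF yZ], rule S(3), rule c, rule c, rule c, rule c)
  qed
qed

end

context generating_system
begin

text \<open>Colours are distinct on the seven indices, so at most three indices are lost to
  \<open>C\<close>.\<close>

lemma four_indices: assumes "inj_on f {..<7::nat}" "finite C" "card C \<le> 3"
  shows "\<exists>a b g h. {a, b, g, h} \<subseteq> {i. i < 7 \<and> f i \<notin> C} \<and> distinct [a, b, g, h]"
proof -
  let ?A = "{i. i < 7 \<and> f i \<notin> C}" and ?B = "{i. i < 7 \<and> f i \<in> C}"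
  have fin: "finite ?A" "finite ?B" by auto
  have "card ?B = card (f ` ?B)" using assms(1) by (intro card_image[symmetric]) (auto intro: inj_on_subset)
  also have "\<dots> \<le> card C" using assms(2) by (intro card_mono) auto
  finally have "card ?B \<le> 3" using assms(3) by simp
  moreover have "card (?A \<union> ?B) = card ?A + card ?B" using fin by (intro card_Un_disjoint) auto
  moreover have "?A \<union> ?B = {..<7}" by auto
  ultimately have "4 \<le> card ?A" by simp
  then obtain D where D: "D \<subseteq> ?A" "card D = 4" "finite D" by (rule obtain_subset_with_card_n)
  then obtain xs where xs: "distinct xs" "set xs = D" using finite_distinct_list by blast
  then have "length xs = 4" using D(2) distinct_card by fastforce
  then obtain a b g h where "xs = [a, b, g, h]" by (auto simp: length_Suc_conv eval_nat_numeral)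
  then have "set xs = {a, b, g, h}" "distinct [a, b, g, h]" using xs(1) by simp_all
  then have "{a, b, g, h} \<subseteq> ?A \<and> distinct [a, b, g, h]" using xs(2) D(1) by simp
  then show ?thesis by (intro exI)
qed

text \<open>\<open>bridge\<close> yields a mixed cycle over the pulled-back set, with one section
  from \<open>p\<close> and two prolonged from \<open>q\<close>. Two commutators with unrestricted
  cycles of \<open>p\<close> exchange the foreign sections one at a time;
  \<open>has_cycle_star_all\<close> then reaches all triples.\<close>

lemma restrictable_pull:
  assumes F: "F \<in> \<T>" and p: "p \<in> P" and q: "q \<in> P" and W: "restrictable q W"
  shows "restrictable p (pull F (pdom p) W)" (is "restrictable p ?W")
proof -
  note Pp = pieceD[OF pieces[OF p]] note Pq = pieceD[OF pieces[OF q]]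
  have Wq: "W \<subseteq> pdom q" using W unfolding restrictable_def by blast
  \<comment> \<open>The sections 0, 1 and 2 of \<open>q\<close> are those that \<open>bridge\<close>
    will use, so their colours are the ones to avoid.\<close>
  have card: "card (pcol q ` {0, 1, 2}) \<le> 3" using card_image_le[of "{0, 1, 2::nat}" "pcol q"] by simp
  obtain a b g h where abgh: "{a, b, g, h} \<subseteq> {i. i < 7 \<and> pcol p i \<notin> pcol q ` {0, 1, 2}}" "distinct [a, b, g, h]"
    using four_indices[OF Pp(9)[of 0] _ card] by auto
  have n: "a < 7" "b < 7" "g < 7" "h < 7" using abgh by auto
  let ?d = "via F (psec q 1)" and ?c = "via F (psec q 0)"
  have f: "sec F y \<in> \<AA>" "\<s> (sec F y) = y" if "y \<in> ?W" for y
    using secD[OF bisection_slice[OF bisT[OF F]]] that by auto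
  have sd: "section_on ?d ?W" and sc: "section_on ?c ?W"
    unfolding section_on_def using f Pq(4,5) Wq by auto
  have rd: "\<r> (?d y) = \<r> (psec q 1 (\<r> (sec F y)))" "\<r> (?c y) = \<r> (psec q 0 (\<r> (sec F y)))" if "y \<in> ?W" for y
    using f[OF that] Pq(4,5) Wq that by auto
  have kd: "\<kappa> (\<r> (?d y)) = pcol q 1" "\<kappa> (\<r> (?c y)) = pcol q 0" if "y \<in> ?W" for y
    using rd[OF that] Pq(6)[of 1 "\<r> (sec F y)"] Pq(6)[of 0 "\<r> (sec F y)"] Wq that by auto
  have kp: "\<kappa> (\<r> (psec p l y)) = pcol p l" if "l < 7" "y \<in> pdom p" for l y
    using Pp(6) that by blast
  have cp: "pcol p i \<noteq> pcol p j" if "i \<in> {a, b, g, h}" "j \<in> {a, b, g, h}" "i \<noteq> j" for i j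
    using inj_onD[OF Pp(9)[of 0], of i j] n that by auto
  have cq: "pcol p i \<noteq> pcol q 1" "pcol p i \<noteq> pcol q 0" if "i \<in> {a, b, g, h}" for i
    using abgh(1) that by auto
  have sub: "?W \<subseteq> pdom p" by auto
  have sp: "section_on (psec p l) ?W" "section_on (psec p l) (pdom p)" if "l < 7" for l
    using piece_section_on[OF pieces[OF p] that] sub by auto
  have 1: "has_cycle H (tuples ?d (psec p a) ?c ?W)"
    by (rule bridge[OF F p q Wq, of 1 2 0 a b]) (use restrictable_has_cycle[OF W, of 1 2 0] n abgh in auto)
  note H2 = has_cycle_rot[OF has_cycle_rev[OF subH 1 sd sp(1)[OF n(1)] sc]]
  \<comment> \<open>\<open>[(d c a), (a b g)] = (d b a)\<close>: the prolonged section
    \<open>?c\<close> is exchanged for section \<open>b\<close> of \<open>p\<close>.\<close>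
  have 3: "has_cycle H (tuples ?d (psec p b) (psec p a) (?W \<inter> pdom p))"
  proof (rule has_cycle_commutator_tuples[OF subH H2 restrictable_has_cycle[OF restrictable_dom[OF p], of a b g]])
    fix y y' assume y: "y \<in> ?W" and y': "y' \<in> pdom p"
    have "y \<in> pdom p" using y by blast
    note k = kd[OF y] kp[OF n(1) this] kp[OF n(1) y'] kp[OF n(2) y'] kp[OF n(3) y']
    show "{\<r> (?d y), \<r> (?c y)} \<inter> {\<r> (psec p a y'), \<r> (psec p b y'), \<r> (psec p g y')} = {} \<and>
      \<r> (psec p a y) \<notin> {\<r> (psec p b y'), \<r> (psec p g y')}"
      using k cq[of a] cq[of b] cq[of g] cp[of a b] cp[of a g] abgh(2) by auto
    show "\<r> (psec p a y) = \<r> (psec p a y') \<Longrightarrow> y = y'"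
      using star_inj[OF piece_star[OF pieces[OF p]], of a a y y'] n \<open>y \<in> pdom p\<close> y' by simp
  qed (use sd sc sp n abgh in auto)
  have Wi: "?W \<inter> pdom p = ?W" by blast
  note H3 = has_cycle_rev[OF subH 3[unfolded Wi] sd sp(1)[OF n(2)] sp(1)[OF n(1)]]
  \<comment> \<open>\<open>[(b d a), (a g h)] = (b g a)\<close>: now all three sections belong to
    \<open>p\<close>.\<close>
  have 4: "has_cycle H (tuples (psec p b) (psec p g) (psec p a) (?W \<inter> pdom p))"
  proof (rule has_cycle_commutator_tuples[OF subH H3 restrictable_has_cycle[OF restrictable_dom[OF p], of a g h]])
    fix y y' assume y: "y \<in> ?W" and y': "y' \<in> pdom p"
    have yp: "y \<in> pdom p" using y by blast
    note k = kd[OF y] kp[OF n(1) yp] kp[OF n(2) yp] kp[OF n(1) y'] kp[OF n(3) y'] kp[OF n(4) y']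
    show "{\<r> (psec p b y), \<r> (?d y)} \<inter> {\<r> (psec p a y'), \<r> (psec p g y'), \<r> (psec p h y')} = {} \<and>
      \<r> (psec p a y) \<notin> {\<r> (psec p g y'), \<r> (psec p h y')}"
      using k cq[of a] cq[of g] cq[of h] cp[of b a] cp[of b g] cp[of b h] cp[of a g] cp[of a h] abgh(2) by auto
    show "\<r> (psec p a y) = \<r> (psec p a y') \<Longrightarrow> y = y'"
      using star_inj[OF piece_star[OF pieces[OF p]], of a a y y'] n yp y' by simp
  qed (use sd sc sp n abgh in auto)
  show ?thesis unfolding restrictable_def
  proof (intro conjI allI impI sub)
    fix i j k :: nat assume ijk: "i < 7" "j < 7" "k < 7" "distinct [i, j, k]"
    show "has_cycle H (tuples (psec p i) (psec p j) (psec p k) ?W)"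
    proof (rule has_cycle_star_all[OF subH piece_star[OF pieces[OF p]] sub _ 4[unfolded Wi]])
      show "has_cycle H (tuples (psec p i) (psec p j) (psec p k) (pdom p))"
        if "{i, j, k} \<subseteq> {..<7}" "distinct [i, j, k]" for i j k
        using gen_star[OF p that] .
    qed (use n ijk abgh in auto)
  qed
qed

lemma family_bisection: "Q \<in> family_pow G \<T> n \<Longrightarrow> bisection G Q"
proof (induction n arbitrary: Q)
  case 0
  then show ?case using clop_bisection[OF clop_ops(1)] by simp
next
  case (Suc n)
  then show ?case using bisection_mult bisT by auto
qed

text \<open>Powers grow on the right, so the last factor \<open>F\<close> is applied first. The
  source of a product \<open>R F\<close> is the pullback along \<open>F\<close> of the source of
  \<open>R\<close>, which is treated separately on each of the finitely many pieces.\<close>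

lemma restrictable_family: "Q \<in> family_pow G \<T> n \<Longrightarrow> p \<in> P \<Longrightarrow> restrictable p (pdom p \<inter> \<s> ` Q)"
proof (induction n arbitrary: Q p)
  case 0
  have "\<s> ` \<UU> = \<UU>" using unitD(2) by force
  moreover have "pdom p \<subseteq> \<UU>" using pieceD(1)[OF pieces[OF 0(2)], of 0] unfolding clop_def by simp
  ultimately show ?case using restrictable_dom[OF 0(2)] 0(1) by (simp add: Int_absorb2)
next
  case (Suc n)
  then obtain R F where R: "R \<in> family_pow G \<T> n" and F: "F \<in> \<T>" and Q: "Q = gset_mult G R F" by auto
  have sl: "slice R" "slice F" using family_bisection[OF R] bisT[OF F] bisection_slice by blast+
  have "pdom p \<inter> \<s> ` Q = (\<Union>q\<in>P. (pull F (pdom p) (pdom q \<inter> \<s> ` R)))"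
  proof (intro equalityI subsetI)
    fix y assume "y \<in> pdom p \<inter> \<s> ` Q"
    then have y: "y \<in> pdom p" "y \<in> \<s> ` F" "\<r> (sec F y) \<in> \<s> ` R" unfolding Q src_image_mult[OF sl] by auto
    have "\<r> (sec F y) \<in> \<UU>" using secD(3)[OF sl(2) y(2)] by (rule unitI(1))
    then obtain q where "q \<in> P" "\<r> (sec F y) \<in> pdom q" using cover by blast
    then show "y \<in> (\<Union>q\<in>P. (pull F (pdom p) (pdom q \<inter> \<s> ` R)))" using y by blast
  next
    fix y assume "y \<in> (\<Union>q\<in>P. (pull F (pdom p) (pdom q \<inter> \<s> ` R)))"
    then show "y \<in> pdom p \<inter> \<s> ` Q" unfolding Q src_image_mult[OF sl] by blast
  qed
  moreover have "restrictable p (\<Union>q\<in>P. (pull F (pdom p) (pdom q \<inter> \<s> ` R)))"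
    by (rule restrictable_UN[OF Suc.prems(2) finP], rule restrictable_pull[OF F Suc.prems(2) _ Suc.IH[OF R]])
  ultimately show ?case by simp
qed

text \<open>By expansivity every point of \<open>W\<close> lies in a product \<open>Q\<close> of
  members of the cover with \<open>Q\<close> inside \<open>W\<close>. Such a \<open>Q\<close>
  consists of units and is its own source, hence restrictable; compactness and finite unions
  finish.\<close>

lemma restrictable_clop: assumes p: "p \<in> P" and W: "clop W" "W \<subseteq> pdom p" shows "restrictable p W"
proof -
  have "\<exists>V. clop V \<and> x \<in> V \<and> (V \<subseteq> W \<and> restrictable p V)" if x: "x \<in> W" for x
  proof -
    have "openin T W" using W(1) by (simp add: clop_def)
    then obtain Q where Q: "Q \<in> (\<Union>n\<in>{1..}. family_pow G \<T> n)" "x \<in> Q" "Q \<subseteq> W"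
      by (rule topology_basisD[OF basisT _ x])
    then obtain n where n: "Q \<in> family_pow G \<T> n" by blast
    have QU: "Q \<subseteq> \<UU>" using Q(3) W(1) unfolding clop_def by blast
    then have "\<s> ` Q = Q" using unitD(2) by force
    then have "pdom p \<inter> \<s> ` Q = Q" using Q(3) W(2) by blast
    then have "restrictable p Q" using restrictable_family[OF n p] by simp
    moreover have "clop Q" using family_bisection[OF n] QU unfolding clop_def bisection_iff by blast
    ultimately show ?thesis using Q by blast
  qed
  from clop_compact_ex[OF W(1) this]
  obtain \<V> where \<V>: "finite \<V>" "\<forall>V\<in>\<V>. clop V \<and> (V \<subseteq> W \<and> restrictable p V)" "W \<subseteq> \<Union>\<V>" by blast
  then have "W = (\<Union>V\<in>\<V>. V)" by blast
  moreover have "restrictable p (\<Union>V\<in>\<V>. V)" using \<V> by (intro restrictable_UN[OF p]) auto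
  ultimately show ?thesis by simp
qed

end

section \<open>Germs of 3-cycles\<close>

context cantor_groupoid
begin

text \<open>An arbitrary choice. By \<open>near_agree\<close> any other bisection through
  \<open>g\<close> agrees with it near the source of \<open>g\<close>, which is all that germs can
  see.\<close>

definition bis_at where "bis_at g = (SOME B. bisection G B \<and> g \<in> B)"

abbreviation "gsec g \<equiv> sec (bis_at g)"

lemma bis_atD: assumes "g \<in> \<AA>" shows "bisection G (bis_at g)" "g \<in> bis_at g" "slice (bis_at g)" "\<s> g \<in> \<s> ` bis_at g" "gsec g (\<s> g) = g"
proof -
  obtain F where "bisection G F \<and> g \<in> F" using arrow_bisection[OF assms] by blast
  then have *: "bisection G (bis_at g) \<and> g \<in> bis_at g" unfolding bis_at_def by (rule someI)
  then show "bisection G (bis_at g)" "g \<in> bis_at g" by blast+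
  then show "slice (bis_at g)" "\<s> g \<in> \<s> ` bis_at g" using bisection_slice by blast+
  then show "gsec g (\<s> g) = g" using * by simp
qed

lemma near_gsec: assumes "bisection G B" "g \<in> B"
  shows "near (\<s> g) (\<lambda>y. y \<in> \<s> ` B \<and> y \<in> \<s> ` bis_at g \<and> sec B y = gsec g y)"
proof -
  have "g \<in> \<AA>" using slice_subset[OF bisection_slice[OF assms(1)] assms(2)] .
  from near_agree[OF assms(1) bis_atD(1)[OF this] assms(2) bis_atD(2)[OF this]] show ?thesis .
qed

text \<open>The bisection chosen at \<open>a \<star> b\<close> and the product of \<open>A\<close>
  and \<open>B\<close> share that arrow, hence agree near its source.\<close>

lemma near_gsec_mult: assumes "bisection G A" "bisection G B" "a \<in> A" "b \<in> B" "\<s> a = \<r> b"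
  shows "near (\<s> b) (\<lambda>y. y \<in> \<s> ` B \<and> \<r> (sec B y) \<in> \<s> ` A \<and> gsec (a \<star> b) y = sec A (\<r> (sec B y)) \<star> sec B y)"
proof -
  have sl: "slice A" "slice B" using bisection_slice assms(1,2) by blast+
  have ab: "a \<in> \<AA>" "b \<in> \<AA>" using slice_subset sl assms(3,4) by blast+
  have m: "a \<star> b \<in> gset_mult G A B" using assms ab by (intro gset_multI)
  have "\<s> (a \<star> b) = \<s> b" using ab assms(5) by simp
  then have "near (\<s> b) (\<lambda>y. y \<in> \<s> ` gset_mult G A B \<and> y \<in> \<s> ` bis_at (a \<star> b) \<and> sec (gset_mult G A B) y = gsec (a \<star> b) y)"
    using near_gsec[OF bisection_mult[OF assms(1,2)] m] by simp
  then show ?thesis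
  proof (rule near_mono)
    fix y assume y: "y \<in> \<s> ` gset_mult G A B \<and> y \<in> \<s> ` bis_at (a \<star> b) \<and> sec (gset_mult G A B) y = gsec (a \<star> b) y"
    then have 1: "y \<in> \<s> ` B" "\<r> (sec B y) \<in> \<s> ` A" unfolding src_image_mult[OF sl] by blast+
    then show "y \<in> \<s> ` B \<and> \<r> (sec B y) \<in> \<s> ` A \<and> gsec (a \<star> b) y = sec A (\<r> (sec B y)) \<star> sec B y"
      using y sec_mult[OF sl 1] by simp
  qed
qed

lemma clop_push: assumes "bisection G B" "clop W" "W \<subseteq> \<s> ` B"
  shows "clop ((\<lambda>y. \<r> (sec B y)) ` W)"
proof -
  have sl: "slice B" using assms(1) by (rule bisection_slice)
  have "\<r> ` restr B W = (\<lambda>y. \<r> (sec B y)) ` W"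
  proof (intro equalityI subsetI)
    fix z assume "z \<in> \<r> ` restr B W"
    then obtain f where "f \<in> B" "\<s> f \<in> W" "z = \<r> f" unfolding restr_def by blast
    then have "z = \<r> (sec B (\<s> f))" using sl by simp
    then show "z \<in> (\<lambda>y. \<r> (sec B y)) ` W" using \<open>\<s> f \<in> W\<close> by blast
  next
    fix z assume "z \<in> (\<lambda>y. \<r> (sec B y)) ` W"
    then obtain y where "y \<in> W" "z = \<r> (sec B y)" by blast
    moreover from this have "sec B y \<in> restr B W" using secD[OF sl, of y] assms(3) unfolding restr_def by auto
    ultimately show "z \<in> \<r> ` restr B W" by blast
  qed
  then show ?thesis using bisection_clop(2)[OF bisection_restr[OF assms(1,2)]] by simp
qed

text \<open>Clopen sets separating the ranges at \<open>x\<close> keep different germs apart over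
  all of \<open>V\<close>, even at different base points; for one germ, \<open>rng\<close> is
  injective on its bisection.\<close>

lemma germ_star: assumes "finite E" "x \<in> \<UU>" "\<And>b. b \<in> E \<Longrightarrow> b \<in> \<AA> \<and> \<s> b = x" "inj_on \<r> E"
  shows "\<exists>V. clop V \<and> x \<in> V \<and> star gsec E V"
proof -
  have src: "x \<in> \<s> ` bis_at b" "gsec b x = b" "bisection G (bis_at b)" if b: "b \<in> E" for b
    using bis_atD[of b] assms(3)[OF b] by auto
  have "inj_on (\<lambda>b. \<r> (gsec b x)) E" using assms(4) src(2) unfolding inj_on_def by simp
  from separating_neighbourhood[of E x bis_at, OF assms(1,2) src(3,1) this]
  obtain K V where V: "clop V" "x \<in> V" and V1: "\<forall>b\<in>E. V \<subseteq> \<s> ` bis_at b" and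
    K: "\<forall>b\<in>E. \<forall>b'\<in>E. b \<noteq> b' \<longrightarrow> clop (K b b') \<and> (\<forall>y\<in>V. \<r> (gsec b y) \<in> K b b' \<and> \<r> (gsec b' y) \<notin> K b b')"
    by blast
  have V3: "gsec b y \<in> bis_at b" "gsec b y \<in> \<AA>" "\<s> (gsec b y) = y" if "y \<in> V" "b \<in> E" for y b
    using secD[OF bisection_slice[OF src(3)[OF that(2)]], of y] V1 that by blast+
  have "star gsec E V" unfolding star_def
  proof (intro conjI ballI impI)
    show "section_on (gsec b) V" if "b \<in> E" for b unfolding section_on_def using V3 that by blast
    fix b b' y z assume *: "b \<in> E" "b' \<in> E" "y \<in> V" "z \<in> V" "\<r> (gsec b y) = \<r> (gsec b' z)"
    show "b = b'"
    proof (rule ccontr)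
      assume "b \<noteq> b'"
      then have "\<r> (gsec b y) \<in> K b b'" "\<r> (gsec b' z) \<notin> K b b'" using K *(1-4) by blast+
      then show False using *(5) by simp
    qed
    then have "gsec b y = gsec b z"
      using slice_rng_inj[OF bisection_slice[OF src(3)[OF *(1)]] V3(1)[OF *(3,1)] V3(1)[OF *(4,1)]] *(5) by simp
    then show "y = z" using V3(3)[OF *(3,1)] V3(3)[OF *(4,1)] by metis
  qed
  then show ?thesis using V by blast
qed

text \<open>Each unit in the support is the range of an entry, where the triple dictates the action;
  elsewhere both elements are trivial. This identifies an element built from a multisection with one
  found in \<open>H\<close>.\<close>

lemma is_cycle_unique: assumes "is_cycle c \<Theta>" "is_cycle c' \<Theta>" "same_source \<Theta>" "full c" "full c'" shows "c = c'"
proof (rule act_ext[OF assms(4,5)])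
  fix u assume u: "u \<in> \<UU>"
  show "act c u = act c' u"
  proof (cases "\<exists>a b d. (a, b, d) \<in> \<Theta> \<and> (u = \<r> a \<or> u = \<r> b \<or> u = \<r> d)")
    case True
    then obtain a b d where t: "(a, b, d) \<in> \<Theta>" and "u = \<r> a \<or> u = \<r> b \<or> u = \<r> d" by blast
    then obtain g where g: "g = a \<or> g = b \<or> g = d" "u = \<r> g" by blast
    note T = same_sourceD[OF assms(3) t]
    have gA: "g \<in> \<AA>" using g T by blast
    have eq: "act c g = act c' g" using is_cycleD[OF assms(1) t] is_cycleD[OF assms(2) t] g(1) by auto
    have "act c (g \<star> \<i> g) = act c g \<star> \<i> g" "act c' (g \<star> \<i> g) = act c' g \<star> \<i> g"
      using act_mult[OF assms(4) gA, of "\<i> g"] act_mult[OF assms(5) gA, of "\<i> g"] gA by simp_all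
    then show ?thesis using eq g(2) by simp
  next
    case False
    then show ?thesis using is_cycle_fix[OF assms(1,4) unitD(1)[OF u]] is_cycle_fix[OF assms(2,5) unitD(1)[OF u]]
      unfolding unitD(3)[OF u] by metis
  qed
qed

end

context generating_system
begin

section \<open>Triples of germs whose small restrictions all lie in the group\<close>

text \<open>\<open>W\<close> ranges over all clopen subsets of \<open>V\<close>, including those
  that miss the source of \<open>a\<close>. This heredity is what later allows a large base to be
  cut into disjoint small ones.\<close>

definition good where "good a b d \<longleftrightarrow> a \<in> \<AA> \<and> b \<in> \<AA> \<and> d \<in> \<AA> \<and> \<s> b = \<s> a \<and> \<s> d = \<s> a \<and>
  \<r> a \<noteq> \<r> b \<and> \<r> b \<noteq> \<r> d \<and> \<r> a \<noteq> \<r> d \<and>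
  (\<exists>V. clop V \<and> \<s> a \<in> V \<and> (\<forall>W. clop W \<longrightarrow> W \<subseteq> V \<longrightarrow> has_cycle H (tuples (gsec a) (gsec b) (gsec d) W)))"

lemma goodI: assumes "a \<in> \<AA>" "b \<in> \<AA>" "d \<in> \<AA>" "\<s> b = \<s> a" "\<s> d = \<s> a" "\<r> a \<noteq> \<r> b" "\<r> b \<noteq> \<r> d" "\<r> a \<noteq> \<r> d"
    "clop V" "\<s> a \<in> V" "\<And>W. clop W \<Longrightarrow> W \<subseteq> V \<Longrightarrow> has_cycle H (tuples (gsec a) (gsec b) (gsec d) W)"
  shows "good a b d"
  unfolding good_def using assms by blast

lemma goodD: assumes "good a b d"
  shows "a \<in> \<AA>" "b \<in> \<AA>" "d \<in> \<AA>" "\<s> b = \<s> a" "\<s> d = \<s> a" "\<r> a \<noteq> \<r> b" "\<r> b \<noteq> \<r> d" "\<r> a \<noteq> \<r> d"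
    "\<exists>V. clop V \<and> \<s> a \<in> V \<and> (\<forall>W. clop W \<longrightarrow> W \<subseteq> V \<longrightarrow> has_cycle H (tuples (gsec a) (gsec b) (gsec d) W))"
  using assms unfolding good_def by blast+

lemma good_rot: assumes "good a b d" shows "good b d a"
proof -
  note D = goodD[OF assms]
  obtain V where V: "clop V" "\<s> a \<in> V" "\<forall>W. clop W \<longrightarrow> W \<subseteq> V \<longrightarrow> has_cycle H (tuples (gsec a) (gsec b) (gsec d) W)"
    using D(9) by blast
  show ?thesis
    by (rule goodI[OF D(2,3,1) _ _ D(7) not_sym[OF D(8)] not_sym[OF D(6)] V(1)])
      (use D(4,5) V in \<open>auto intro: has_cycle_rot\<close>)
qed

lemma good_rev: assumes "good a b d" shows "good b a d"
proof -
  note D = goodD[OF assms]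
  obtain V where V: "clop V" "\<s> a \<in> V" "\<forall>W. clop W \<longrightarrow> W \<subseteq> V \<longrightarrow> has_cycle H (tuples (gsec a) (gsec b) (gsec d) W)"
    using D(9) by blast
  have "\<exists>V'. clop V' \<and> \<s> a \<in> V' \<and> star gsec {a, b, d} V'"
  proof (rule germ_star)
    show "inj_on \<r> {a, b, d}" using D(6-8) by auto
    show "\<s> a \<in> \<UU>" using D(1) by (rule unitI(2))
    show "g \<in> \<AA> \<and> \<s> g = \<s> a" if "g \<in> {a, b, d}" for g using D(1-5) that by blast
  qed simp
  then obtain V' where V': "clop V'" "\<s> a \<in> V'" "star gsec {a, b, d} V'" by blast
  show ?thesis
  proof (rule goodI[OF D(2,1,3) _ _ not_sym[OF D(6)] D(8,7) clop_ops(3)[OF V(1) V'(1)]])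
    fix W assume W: "clop W" "W \<subseteq> V \<inter> V'"
    have "has_cycle H (tuples (gsec a) (gsec b) (gsec d) W)" using V(3) W by blast
    then show "has_cycle H (tuples (gsec b) (gsec a) (gsec d) W)"
      by (rule has_cycle_rev[OF subH]) (rule star_section_on[OF V'(3)]; use W in blast)+
  qed (use D(4,5) V V' in auto)
qed

text \<open>Five germs with one source and distinct ranges form a star nearby, and there the
  commutator can be taken with the same \<open>W\<close> on both sides.\<close>

lemma good_commutator: assumes "good a b e" "good e d f" and r: "distinct [\<r> a, \<r> b, \<r> e, \<r> d, \<r> f]"
  shows "good a d e"
proof -
  note D = goodD[OF assms(1)] note D' = goodD[OF assms(2)]
  obtain V where V: "clop V" "\<s> a \<in> V" "\<forall>W. clop W \<longrightarrow> W \<subseteq> V \<longrightarrow> has_cycle H (tuples (gsec a) (gsec b) (gsec e) W)"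
    using D(9) by blast
  obtain V' where V': "clop V'" "\<s> e \<in> V'" "\<forall>W. clop W \<longrightarrow> W \<subseteq> V' \<longrightarrow> has_cycle H (tuples (gsec e) (gsec d) (gsec f) W)"
    using D'(9) by blast
  have "\<exists>Z. clop Z \<and> \<s> a \<in> Z \<and> star gsec {a, b, e, d, f} Z"
  proof (rule germ_star)
    show "inj_on \<r> {a, b, e, d, f}" using r by auto
    show "\<s> a \<in> \<UU>" using D(1) by (rule unitI(2))
    have "\<s> d = \<s> a" "\<s> f = \<s> a" using D'(4,5) D(5) by simp_all
    then show "g \<in> \<AA> \<and> \<s> g = \<s> a" if "g \<in> {a, b, e, d, f}" for g using D(1-5) D'(1-3) that by blast
  qed simp
  then obtain Z where Z: "clop Z" "\<s> a \<in> Z" "star gsec {a, b, e, d, f} Z" by blast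
  have dis: "distinct [a, b, e, d, f]" using r by auto
  show ?thesis
  proof (rule goodI)
    show "clop (V \<inter> V' \<inter> Z)" using V(1) V'(1) Z(1) clop_ops(3) by blast
    fix W assume W: "clop W" "W \<subseteq> V \<inter> V' \<inter> Z"
    have 1: "has_cycle H (tuples (gsec a) (gsec b) (gsec e) W)" using V(3) W by blast
    have 2: "has_cycle H (tuples (gsec e) (gsec d) (gsec f) W)" using V'(3) W by blast
    have "has_cycle H (tuples (gsec a) (gsec d) (gsec e) (W \<inter> W))"
      by (rule has_cycle_star_commutator[OF subH Z(3) _ _ 1 2 _ _ _ _ _ dis]) (use W in auto)
    then show "has_cycle H (tuples (gsec a) (gsec d) (gsec e) W)" by simp
  qed (use D(1-5) D'(1-5) V(2) V'(2) Z(2) r in auto)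
qed

text \<open>A small \<open>W\<close> around the source of \<open>g\<close> is pushed forward along a
  bisection through \<open>g\<close> to a clopen set near the source of \<open>a\<close>. The cycle
  available there is, after right multiplication, the cycle wanted over \<open>W\<close>.\<close>

lemma good_shift: assumes "good a b d" and g: "g \<in> \<AA>" "\<r> g = \<s> a"
  shows "good (a \<star> g) (b \<star> g) (d \<star> g)"
proof -
  note D = goodD[OF assms(1)]
  obtain V where V: "clop V" "\<s> a \<in> V" "\<forall>W. clop W \<longrightarrow> W \<subseteq> V \<longrightarrow> has_cycle H (tuples (gsec a) (gsec b) (gsec d) W)"
    using D(9) by blast
  let ?g = "gsec g" let ?z = "\<lambda>y. \<r> (gsec g y)"
  have m: "near (\<s> g) (\<lambda>y. y \<in> \<s> ` bis_at g \<and> ?z y \<in> \<s> ` bis_at l \<and> gsec (l \<star> g) y = gsec l (?z y) \<star> ?g y)"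
    if "l \<in> {a, b, d}" for l
    using near_gsec_mult[OF bis_atD(1) bis_atD(1)[OF g(1)] bis_atD(2) bis_atD(2)[OF g(1)], of l] that D(1-5) g(2) by auto
  have "near (\<s> g) (\<lambda>y. y \<in> \<s> ` bis_at g \<and> ?z y \<in> V)"
    using near_rng[OF bis_atD(1)[OF g(1)] bis_atD(4)[OF g(1)] V(1)] V(2) bis_atD(5)[OF g(1)] g(2) by simp
  from near_conj[OF this near_conj[OF m[of a] near_conj[OF m[of b] m[of d]]]]
  obtain Z where Z: "clop Z" "\<s> g \<in> Z" and
    Zg: "\<And>y. y \<in> Z \<Longrightarrow> y \<in> \<s> ` bis_at g \<and> ?z y \<in> V" and
    Zm: "\<And>y l. y \<in> Z \<Longrightarrow> l \<in> {a, b, d} \<Longrightarrow> ?z y \<in> \<s> ` bis_at l \<and> gsec (l \<star> g) y = gsec l (?z y) \<star> ?g y"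
    unfolding near_def by auto
  have sg: "?g y \<in> \<AA>" "\<s> (?g y) = y" if "y \<in> Z" for y using secD[OF bis_atD(3)[OF g(1)], of y] Zg[OF that] by auto
  have sl: "gsec l (?z y) \<in> \<AA>" "\<s> (gsec l (?z y)) = ?z y" if "y \<in> Z" "l \<in> {a, b, d}" for y l
    using secD[OF bis_atD(3), of l "?z y"] Zm[OF that] D(1-3) that(2) by auto
  show ?thesis
  proof (rule goodI[of _ _ _ Z])
    fix W assume W: "clop W" "W \<subseteq> Z"
    let ?W = "?z ` W"
    have "clop ?W" by (rule clop_push[OF bis_atD(1)[OF g(1)] W(1)]) (use W(2) Zg in blast)
    moreover have "?W \<subseteq> V" using W(2) Zg by blast
    ultimately have HC: "has_cycle H (tuples (gsec a) (gsec b) (gsec d) ?W)" using V(3) by blast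
    have ss: "section_on (gsec l) ?W" if "l \<in> {a, b, d}" for l
      unfolding section_on_def using sl that W(2) by blast
    have eq: "(gsec (a \<star> g) y, gsec (b \<star> g) y, gsec (d \<star> g) y) =
      (gsec a (?z y) \<star> ?g y, gsec b (?z y) \<star> ?g y, gsec d (?z y) \<star> ?g y)" if "y \<in> W" for y
      using Zm[of y] that W(2) by auto
    show "has_cycle H (tuples (gsec (a \<star> g)) (gsec (b \<star> g)) (gsec (d \<star> g)) W)"
    proof (rule has_cycle_shift[OF subH HC])
      show "same_source (tuples (gsec a) (gsec b) (gsec d) ?W)" by (intro same_source_tuples ss) auto
    next
      fix t assume "t \<in> tuples (gsec (a \<star> g)) (gsec (b \<star> g)) (gsec (d \<star> g)) W"
      then obtain y where y: "y \<in> W" "t = (gsec (a \<star> g) y, gsec (b \<star> g) y, gsec (d \<star> g) y)" unfolding tuples_def by blast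
      have yZ: "y \<in> Z" using y(1) W(2) by blast
      have "(gsec a (?z y), gsec b (?z y), gsec d (?z y)) \<in> tuples (gsec a) (gsec b) (gsec d) ?W"
        unfolding tuples_def using y(1) by blast
      moreover have "\<s> (gsec a (?z y)) = \<r> (?g y)" using sl[OF yZ] by simp
      ultimately show "\<exists>a' b' d' h. (a', b', d') \<in> tuples (gsec a) (gsec b) (gsec d) ?W \<and> h \<in> \<AA> \<and>
         \<s> a' = \<r> h \<and> t = (a' \<star> h, b' \<star> h, d' \<star> h)"
        unfolding y(2) eq[OF y(1)] using sg(1)[OF yZ] by blast
    next
      fix a' b' d' assume "(a', b', d') \<in> tuples (gsec a) (gsec b) (gsec d) ?W"
      then obtain y where y: "y \<in> W" "a' = gsec a (?z y)" "b' = gsec b (?z y)" "d' = gsec d (?z y)"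
        unfolding tuples_def by blast
      have yZ: "y \<in> Z" using y(1) W(2) by blast
      have "(a' \<star> ?g y, b' \<star> ?g y, d' \<star> ?g y) \<in> tuples (gsec (a \<star> g)) (gsec (b \<star> g)) (gsec (d \<star> g)) W"
        unfolding y(2,3,4) eq[OF y(1), symmetric] tuples_def using y(1) by blast
      moreover have "\<s> a' = \<r> (?g y)" using sl[OF yZ] y(2) by simp
      ultimately show "\<exists>h. h \<in> \<AA> \<and> \<s> a' = \<r> h \<and>
         (a' \<star> h, b' \<star> h, d' \<star> h) \<in> tuples (gsec (a \<star> g)) (gsec (b \<star> g)) (gsec (d \<star> g)) W"
        using sg(1)[OF yZ] by blast
    qed
  qed (use D(1-8) g Z in auto)
qed

text \<open>Every clopen subset of a piece is restrictable, and near \<open>x\<close> the sections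
  of the piece agree with those chosen for their germs.\<close>

lemma good_piece: assumes p: "p \<in> P" and x: "x \<in> pdom p" and i: "{i, j, k} \<subseteq> {..<7}" "distinct [i, j, k]"
  shows "good (psec p i x) (psec p j x) (psec p k x)"
proof -
  note Pp = pieceD[OF pieces[OF p]]
  have n: "i < 7" "j < 7" "k < 7" using i by auto
  have inj: "\<r> (psec p l x) \<noteq> \<r> (psec p m x)" if "l < 7" "m < 7" "l \<noteq> m" for l m
    using star_inj[OF piece_star[OF pieces[OF p]], of l m x x] that x by auto
  have nr: "near x (\<lambda>y. y \<in> pdom p \<and> psec p l y = gsec (psec p l x) y)" if l: "l < 7" for l
    using near_mono[OF near_gsec[OF Pp(2)[OF l] Pp(8)[OF l x]], of "\<lambda>y. y \<in> pdom p \<and> psec p l y = gsec (psec p l x) y"]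
    unfolding Pp(5)[OF l x] Pp(3)[OF l] by blast
  from near_conj[OF nr[OF n(1)] near_conj[OF nr[OF n(2)] nr[OF n(3)]]]
  obtain V where V: "clop V" "x \<in> V" and Ve: "\<forall>y\<in>V. (y \<in> pdom p \<and> psec p i y = gsec (psec p i x) y) \<and>
      (y \<in> pdom p \<and> psec p j y = gsec (psec p j x) y) \<and> (y \<in> pdom p \<and> psec p k y = gsec (psec p k x) y)"
    unfolding near_def by blast
  show ?thesis
  proof (rule goodI[OF Pp(4)[OF n(1) x] Pp(4)[OF n(2) x] Pp(4)[OF n(3) x] _ _ inj inj inj V(1)])
    fix W assume W: "clop W" "W \<subseteq> V"
    have "W \<subseteq> pdom p" using W(2) Ve by blast
    from restrictable_has_cycle[OF restrictable_clop[OF p W(1) this] n i(2)]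
    show "has_cycle H (tuples (gsec (psec p i x)) (gsec (psec p j x)) (gsec (psec p k x)) W)"
      by (rule has_cycle_tuples_cong) (use W(2) Ve in blast)
  qed (use n i(2) V(2) Pp(5)[OF _ x] in auto)
qed

text \<open>The link in terms of germs. A small \<open>W\<close> is pushed along \<open>F\<close>
  into \<open>pdom q\<close>, where all clopen sets are restrictable, and \<open>bridge\<close> for
  the pushed set returns a cycle over \<open>W\<close>.\<close>

lemma good_bridge:
  assumes F: "F \<in> \<T>" and p: "p \<in> P" and q: "q \<in> P" and f: "f \<in> F" "\<s> f \<in> pdom p" "\<r> f \<in> pdom q"
  shows "\<exists>a<7. \<exists>c<7. \<exists>d<7. good (psec q d (\<r> f) \<star> f) (psec p a (\<s> f)) (psec q c (\<r> f) \<star> f)"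
proof -
  note Pp = pieceD[OF pieces[OF p]] note Pq = pieceD[OF pieces[OF q]]
  have sF: "bisection G F" "slice F" using bisT[OF F] bisection_slice by blast+
  have fA: "f \<in> \<AA>" using slice_subset[OF sF(2) f(1)] .
  have card: "card (pcol q ` {0, 1, 2}) \<le> 3" using card_image_le[of "{0, 1, 2::nat}" "pcol q"] by simp
  have "inj_on (pcol p) {..<7}" by (rule Pp(9)[of 0]) simp
  then obtain a b g h where abgh: "{a, b, g, h} \<subseteq> {i. i < 7 \<and> pcol p i \<notin> pcol q ` {0, 1, 2}}" "distinct [a, b, g, h]"
    using four_indices[OF _ _ card] by blast
  have n: "a < 7" "b < 7" using abgh by auto
  let ?x = "\<s> f" and ?z = "\<r> f"
  have sx: "sec F ?x = f" "?x \<in> \<s> ` F" using sF f(1) by auto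
  let ?d = "psec q 1 ?z \<star> f" and ?a = "psec p a ?x" and ?c = "psec q 0 ?z \<star> f"
  have mq: "near ?x (\<lambda>y. y \<in> \<s> ` F \<and> \<r> (sec F y) \<in> pdom q \<and> gsec (psec q l ?z \<star> f) y = psec q l (\<r> (sec F y)) \<star> sec F y)"
    if l: "l < 7" for l
    using near_gsec_mult[OF Pq(2)[OF l] sF(1) Pq(8)[OF l f(3)] f(1) Pq(5)[OF l f(3)]] unfolding Pq(3)[OF l] .
  have mp: "near ?x (\<lambda>y. y \<in> pdom p \<and> psec p a y = gsec ?a y)"
    using near_mono[OF near_gsec[OF Pp(2)[OF n(1)] Pp(8)[OF n(1) f(2)]], of "\<lambda>y. y \<in> pdom p \<and> psec p a y = gsec ?a y"]
    unfolding Pp(5)[OF n(1) f(2)] Pp(3)[OF n(1)] by blast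
  have l: "(1::nat) < 7" "(0::nat) < 7" by simp_all
  from near_conj[OF mp near_conj[OF mq[OF l(1)] mq[OF l(2)]]]
  obtain V where V: "clop V" "?x \<in> V" and Ve: "\<forall>y\<in>V. (y \<in> pdom p \<and> psec p a y = gsec ?a y) \<and>
     (y \<in> \<s> ` F \<and> \<r> (sec F y) \<in> pdom q \<and> gsec ?d y = psec q 1 (\<r> (sec F y)) \<star> sec F y) \<and>
     (y \<in> \<s> ` F \<and> \<r> (sec F y) \<in> pdom q \<and> gsec ?c y = psec q 0 (\<r> (sec F y)) \<star> sec F y)"
    unfolding near_def by blast
  have A: "?d \<in> \<AA>" "?a \<in> \<AA>" "?c \<in> \<AA>" and S: "\<s> ?d = ?x" "\<s> ?a = ?x" "\<s> ?c = ?x"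
    and R: "\<r> ?d = \<r> (psec q 1 ?z)" "\<r> ?c = \<r> (psec q 0 ?z)"
    using Pq(4,5)[OF l(1) f(3)] Pq(4,5)[OF l(2) f(3)] Pp(4,5)[OF n(1) f(2)] fA by simp_all
  have kap: "\<kappa> (\<r> ?d) = pcol q 1" "\<kappa> (\<r> ?c) = pcol q 0" "\<kappa> (\<r> ?a) = pcol p a"
    unfolding R using Pq(6)[OF _ f(3)] Pp(6)[OF n(1) f(2)] by simp_all
  have "pcol q 1 \<noteq> pcol q 0" using inj_onD[OF Pq(9)[OF l(1)], of 1 0] by auto
  moreover have "pcol p a \<noteq> pcol q 1" "pcol p a \<noteq> pcol q 0" using abgh(1) by auto
  ultimately have ne: "\<r> ?d \<noteq> \<r> ?a" "\<r> ?a \<noteq> \<r> ?c" "\<r> ?d \<noteq> \<r> ?c" using kap by metis+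
  have "good ?d ?a ?c"
  proof (rule goodI[OF A _ _ ne V(1)])
    show "\<s> ?a = \<s> ?d" "\<s> ?c = \<s> ?d" "\<s> ?d \<in> V" using S V(2) by simp_all
    fix W assume W: "clop W" "W \<subseteq> V"
    let ?Wq = "(\<lambda>y. \<r> (sec F y)) ` W"
    have sub: "W \<subseteq> \<s> ` F" "?Wq \<subseteq> pdom q" "W \<subseteq> pdom p" using W(2) Ve by blast+
    have cq: "clop ?Wq" by (rule clop_push[OF sF(1) W(1) sub(1)])
    \<comment> \<open>Pulling back undoes the push because \<open>rng\<close> is injective on
      \<open>F\<close>.\<close>
    have eq: "(pull F (pdom p) ?Wq) = W"
    proof (intro equalityI subsetI)
      fix y assume "y \<in> (pull F (pdom p) ?Wq)"
      then obtain y' where y: "y \<in> \<s> ` F" "y' \<in> W" "\<r> (sec F y) = \<r> (sec F y')" by blast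
      have y': "y' \<in> \<s> ` F" using y(2) sub(1) by blast
      have "sec F y = sec F y'"
        by (rule slice_rng_inj[OF sF(2) secD(1)[OF sF(2) y(1)] secD(1)[OF sF(2) y'] y(3)])
      then have "y = y'" using secD(2)[OF sF(2) y(1)] secD(2)[OF sF(2) y'] by metis
      then show "y \<in> W" using y(2) by simp
    next
      fix y assume y: "y \<in> W"
      have "y \<in> pdom p" "y \<in> \<s> ` F" using y sub by blast+
      moreover have "\<r> (sec F y) \<in> ?Wq" using y by (rule imageI)
      ultimately show "y \<in> (pull F (pdom p) ?Wq)" by simp
    qed
    have "has_cycle H (tuples (via F (psec q 1)) (psec p a) (via F (psec q 0))
      (pull F (pdom p) ?Wq))"
      by (rule bridge[OF F p q sub(2), of 1 2 0 a b])
        (use restrictable_has_cycle[OF restrictable_clop[OF q cq sub(2)], of 1 2 0] n abgh in auto)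
    then have "has_cycle H (tuples (via F (psec q 1)) (psec p a) (via F (psec q 0)) W)"
      unfolding eq .
    then show "has_cycle H (tuples (gsec ?d) (gsec ?a) (gsec ?c) W)"
    proof (rule has_cycle_tuples_cong)
      fix y assume "y \<in> W"
      then have "y \<in> V" using W(2) by blast
      with Ve have "psec p a y = gsec ?a y" "gsec ?d y = psec q 1 (\<r> (sec F y)) \<star> sec F y"
        "gsec ?c y = psec q 0 (\<r> (sec F y)) \<star> sec F y" by blast+
      then show "psec q 1 (\<r> (sec F y)) \<star> sec F y = gsec ?d y \<and> psec p a y = gsec ?a y \<and>
        psec q 0 (\<r> (sec F y)) \<star> sec F y = gsec ?c y" by simp
    qed
  qed
  then show ?thesis using n(1) l by blast
qed

section \<open>Linked germs and propagation through the groupoid\<close>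

text \<open>A star of germs centred at \<open>b\<close>, obtained in \<open>gstar_piece\<close> by
  shifting the sections of a piece by \<open>b\<close>. Entry 0 is \<open>b\<close> because section
  0 of a piece consists of units.\<close>

definition gstar where "gstar b e \<longleftrightarrow> e 0 = b \<and> inj_on (\<lambda>i. \<r> (e i)) {..<7::nat} \<and>
  (\<forall>i<7. \<forall>j<7. \<forall>k<7. distinct [i, j, k] \<longrightarrow> good (e i) (e j) (e k))"

lemma gstar_piece: assumes p: "p \<in> P" and b: "b \<in> \<AA>" "\<r> b \<in> pdom p"
  shows "gstar b (\<lambda>i. psec p i (\<r> b) \<star> b)"
proof -
  note Pp = pieceD[OF pieces[OF p]]
  have S: "psec p i (\<r> b) \<in> \<AA>" "\<s> (psec p i (\<r> b)) = \<r> b" if "i < 7" for i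
    using Pp(4,5)[OF that b(2)] .
  show ?thesis unfolding gstar_def
  proof (intro conjI allI impI)
    show "psec p 0 (\<r> b) \<star> b = b" using Pp(7)[of 0, OF _ b(2)] b(1) by simp
    show "inj_on (\<lambda>i. \<r> (psec p i (\<r> b) \<star> b)) {..<7}"
    proof (rule inj_onI)
      fix i j :: nat assume ij: "i \<in> {..<7}" "j \<in> {..<7}" "\<r> (psec p i (\<r> b) \<star> b) = \<r> (psec p j (\<r> b) \<star> b)"
      then have "\<r> (psec p i (\<r> b)) = \<r> (psec p j (\<r> b))" using S b(1) by simp
      then show "i = j" using star_inj[OF piece_star[OF pieces[OF p]] ij(1,2) b(2,2)] by blast
    qed
    fix i j k :: nat assume "i < 7" "j < 7" "k < 7" "distinct [i, j, k]"
    then have "good (psec p i (\<r> b)) (psec p j (\<r> b)) (psec p k (\<r> b))" by (intro good_piece[OF p b(2)]) auto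
    then show "good (psec p i (\<r> b) \<star> b) (psec p j (\<r> b) \<star> b) (psec p k (\<r> b) \<star> b)"
      by (rule good_shift[OF _ b(1)]) (simp add: S \<open>i < 7\<close>)
  qed
qed

lemma gstar_ex: assumes "b \<in> \<AA>" shows "\<exists>e. gstar b e"
proof -
  have "\<r> b \<in> \<UU>" using assms by (rule unitI(1))
  then obtain p where "p \<in> P" "\<r> b \<in> pdom p" using cover by blast
  then show ?thesis using gstar_piece assms by blast
qed

lemma gstar_good: "gstar b e \<Longrightarrow> i < 7 \<Longrightarrow> j < 7 \<Longrightarrow> k < 7 \<Longrightarrow> distinct [i, j, k] \<Longrightarrow> good (e i) (e j) (e k)"
  unfolding gstar_def by blast

lemma gstar_fresh: assumes e: "gstar b e" and "length xs \<le> 6" shows "\<exists>i<7. \<r> (e i) \<notin> set xs"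
proof (rule ccontr)
  assume "\<not> ?thesis"
  then have "(\<lambda>i. \<r> (e i)) ` {..<7} \<subseteq> set xs" by auto
  from card_mono[OF _ this] have "card ((\<lambda>i. \<r> (e i)) ` {..<7}) \<le> 6" using card_length[of xs] assms(2) by simp
  moreover have "inj_on (\<lambda>i. \<r> (e i)) {..<7}" using e unfolding gstar_def by blast
  then have "card ((\<lambda>i. \<r> (e i)) ` {..<7}) = 7" by (simp add: card_image)
  ultimately show False by simp
qed

text \<open>The third germ is forgotten because \<open>linked_replace\<close> can exchange it for
  other germs of a star at \<open>a\<close>.\<close>

definition linked where "linked a b \<longleftrightarrow> (\<exists>c. good a b c)"

lemma linked_sym: "linked a b \<Longrightarrow> linked b a"
  unfolding linked_def using good_rev by blast

lemma linkedD: assumes "linked a b" shows "a \<in> \<AA>" "b \<in> \<AA>" "\<s> b = \<s> a" "\<r> a \<noteq> \<r> b"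
  using assms goodD(1,2,4,6) unfolding linked_def by blast+

lemma gstar_linked: assumes e: "gstar b e" and ij: "i < 7" "j < 7" "i \<noteq> j" shows "linked (e i) (e j)"
proof -
  obtain k where "k < 7" "k \<notin> set [i, j]" using fresh_index[of "[i, j]"] by auto
  then have "good (e i) (e j) (e k)" using gstar_good[OF e ij(1,2)] ij(3) by auto
  then show ?thesis unfolding linked_def by blast
qed

text \<open>With a further fresh germ \<open>e j\<close> of the star,
  \<open>[(b c a), (a e_i e_j)] = (b e_i a)\<close>, where \<open>e_i\<close> stands for
  \<open>e i\<close>.\<close>

lemma linked_replace: assumes ab: "good a b c" and e: "gstar a e" and i: "i < 7" "\<r> (e i) \<notin> {\<r> a, \<r> b, \<r> c}"
  shows "good a b (e i)"
proof -
  have e0: "e 0 = a" using e unfolding gstar_def by blast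
  obtain j where j: "j < 7" "\<r> (e j) \<notin> set [\<r> a, \<r> b, \<r> c, \<r> (e i)]" using gstar_fresh[OF e, of "[\<r> a, \<r> b, \<r> c, \<r> (e i)]"] by auto
  have "i \<noteq> 0" "j \<noteq> 0" "i \<noteq> j" using i(2) j(2) e0 by (auto intro: ccontr)
  then have g: "good a (e i) (e j)" using gstar_good[OF e, of 0 i j] e0 i(1) j(1) by simp
  note D = goodD[OF ab]
  have "distinct [\<r> b, \<r> c, \<r> a, \<r> (e i), \<r> (e j)]" using D(6-8) i(2) j(2) by auto
  from good_commutator[OF good_rot[OF ab] g this] have "good b (e i) a" .
  from good_rot[OF good_rot[OF this]] show ?thesis .
qed

lemma linked_fresh: assumes "linked a b" and e: "gstar a e" and xs: "length xs \<le> 4"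
  shows "\<exists>u. \<r> u \<notin> set xs \<and> good a b u"
proof -
  obtain c where c: "good a b c" using assms(1) unfolding linked_def by blast
  obtain i where i: "i < 7" "\<r> (e i) \<notin> set (\<r> a # \<r> b # xs)" using gstar_fresh[OF e, of "\<r> a # \<r> b # xs"] xs by auto
  show ?thesis
  proof (cases "\<r> (e i) = \<r> c")
    case False
    then have "good a b (e i)" using linked_replace[OF c e i(1)] i(2) by auto
    then show ?thesis using i(2) by auto
  next
    \<comment> \<open>The candidate ends where the present third germ \<open>c\<close> does, so it
      cannot be inserted directly; \<open>c\<close> is first exchanged for a germ \<open>e j\<close>
      with another range.\<close>
    case True
    obtain j where j: "j < 7" "\<r> (e j) \<notin> set [\<r> a, \<r> b, \<r> c]" using gstar_fresh[OF e, of "[\<r> a, \<r> b, \<r> c]"] by auto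
    then have "good a b (e j)" using linked_replace[OF c e j(1)] by simp
    then have "good a b (e i)" by (rule linked_replace[OF _ e i(1)]) (use i(2) j(2) True in auto)
    then show ?thesis using i(2) by auto
  qed
qed

lemma linked_fresh': assumes "linked a b" and xs: "length xs \<le> 4"
  shows "\<exists>u. \<r> u \<notin> set xs \<and> good a b u"
  using gstar_ex[OF linkedD(1)[OF assms(1)]] linked_fresh[OF assms(1) _ xs] by blast

text \<open>With third germs chosen to keep all five ranges distinct,
  \<open>[(a u b), (b c v)] = (a c b)\<close>.\<close>

lemma linked_trans: assumes "linked a b" "linked b c" "\<r> a \<noteq> \<r> c" shows "linked a c"
proof -
  obtain u where u: "\<r> u \<notin> set [\<r> c]" "good a b u" using linked_fresh'[OF assms(1), of "[\<r> c]"] by auto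
  obtain v where v: "\<r> v \<notin> set [\<r> a, \<r> u]" "good b c v" using linked_fresh'[OF assms(2), of "[\<r> a, \<r> u]"] by auto
  have "good a u b" using good_rev[OF good_rot[OF good_rot[OF u(2)]]] .
  moreover have "distinct [\<r> a, \<r> u, \<r> b, \<r> c, \<r> v]" using u v goodD(6-8)[OF u(2)] goodD(6-8)[OF v(2)] assms(3) by auto
  ultimately have "good a c b" using good_commutator[OF _ v(2)] by blast
  then show ?thesis unfolding linked_def by blast
qed

text \<open>The detour through \<open>z\<close> makes this an equivalence relation although germs with the same
  range are never in relation \<open>linked\<close>.\<close>

definition chained where "chained a b \<longleftrightarrow> (\<exists>z. linked a z \<and> linked z b)"

lemma chained_refl: assumes "a \<in> \<AA>" shows "chained a a"
proof -
  obtain e where e: "gstar a e" using gstar_ex[OF assms] by blast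
  then have "linked a (e 1)" using gstar_linked[OF e, of 0 1] unfolding gstar_def by auto
  then show ?thesis unfolding chained_def using linked_sym by blast
qed

lemma linked_chained: assumes "linked a b" shows "chained a b"
proof -
  obtain u where u: "good a b u" using assms unfolding linked_def by blast
  have "good u a b" using good_rot[OF good_rot[OF u]] .
  moreover have "good b u a" using good_rot[OF u] .
  ultimately have "linked u a" "linked b u" unfolding linked_def by blast+
  then show ?thesis unfolding chained_def using linked_sym by blast
qed

lemma chained_sym: "chained a b \<Longrightarrow> chained b a"
  unfolding chained_def using linked_sym by blast

text \<open>\<open>linked_trans\<close> needs distinct ranges at every composition. Both chains are
  therefore led to one germ of a star at \<open>b\<close> whose range avoids those of
  \<open>a\<close>, \<open>b\<close>, \<open>c\<close>, \<open>z\<close> and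
  \<open>w\<close>.\<close>

lemma chained_trans: assumes "chained a b" "chained b c" shows "chained a c"
proof -
  obtain z where z: "linked a z" "linked z b" using assms(1) unfolding chained_def by blast
  obtain w where w: "linked b w" "linked w c" using assms(2) unfolding chained_def by blast
  obtain e where e: "gstar b e" using gstar_ex[OF linkedD(1)[OF w(1)]] by blast
  have e0: "e 0 = b" using e unfolding gstar_def by blast
  obtain i where i: "i < 7" "\<r> (e i) \<notin> set [\<r> a, \<r> b, \<r> c, \<r> z, \<r> w]"
    using gstar_fresh[OF e, of "[\<r> a, \<r> b, \<r> c, \<r> z, \<r> w]"] by auto
  have "i \<noteq> 0" using i(2) e0 by (auto intro: ccontr)
  then have b: "linked b (e i)" using gstar_linked[OF e, of 0 i] e0 i(1) by simp
  have ne: "\<r> a \<noteq> \<r> (e i)" "\<r> z \<noteq> \<r> (e i)" "\<r> w \<noteq> \<r> (e i)" "\<r> c \<noteq> \<r> (e i)" using i(2) by auto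
  have "linked a (e i)" by (rule linked_trans[OF z(1) linked_trans[OF z(2) b ne(2)] ne(1)])
  moreover have "linked c (e i)" by (rule linked_trans[OF linked_sym[OF w(2)] linked_trans[OF linked_sym[OF w(1)] b ne(3)] ne(4)])
  ultimately show ?thesis unfolding chained_def using linked_sym by blast
qed

lemma chained_linked: "chained a b \<Longrightarrow> \<r> a \<noteq> \<r> b \<Longrightarrow> linked a b"
  unfolding chained_def using linked_trans by blast

lemma gstar_chained: assumes e: "gstar b e" and b: "b \<in> \<AA>" and i: "i < 7" shows "chained b (e i)"
proof (cases "i = 0")
  case True
  then show ?thesis using e chained_refl[OF b] unfolding gstar_def by simp
next
  case False
  then show ?thesis using linked_chained[OF gstar_linked[OF e, of 0 i]] i e unfolding gstar_def by simp
qed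

text \<open>Move from \<open>b\<close> to a germ of its star, cross by \<open>good_bridge\<close>
  shifted by \<open>b\<close> to a germ of the star at \<open>f \<star> b\<close>, and return to the
  centre of that star.\<close>

lemma chained_step: assumes F: "F \<in> \<T>" "f \<in> F" and b: "b \<in> \<AA>" "\<s> f = \<r> b" shows "chained b (f \<star> b)"
proof -
  have fA: "f \<in> \<AA>" using slice_subset[OF bisection_slice[OF bisT[OF F(1)]] F(2)] .
  have "\<s> f \<in> \<UU>" "\<r> f \<in> \<UU>" using fA by auto
  then obtain p q where p: "p \<in> P" "\<s> f \<in> pdom p" and q: "q \<in> P" "\<r> f \<in> pdom q" using cover by blast
  obtain a c d where n: "a < 7" "c < 7" "d < 7" and g: "good (psec q d (\<r> f) \<star> f) (psec p a (\<s> f)) (psec q c (\<r> f) \<star> f)"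
    using good_bridge[OF F(1) p(1) q(1) F(2) p(2) q(2)] by blast
  note S = pieceD(4,5)[OF pieces[OF q(1)] n(3) q(2)]
  have "\<r> b = \<s> (psec q d (\<r> f) \<star> f)" using S fA b(2) by simp
  from good_shift[OF g b(1) this]
  have "linked ((psec q d (\<r> f) \<star> f) \<star> b) (psec p a (\<s> f) \<star> b)" unfolding linked_def by blast
  moreover have "(psec q d (\<r> f) \<star> f) \<star> b = psec q d (\<r> (f \<star> b)) \<star> (f \<star> b)"
    using S fA b by (simp add: assoc)
  ultimately have 1: "linked (psec q d (\<r> (f \<star> b)) \<star> (f \<star> b)) (psec p a (\<r> b) \<star> b)" using b(2) by simp
  have fb: "f \<star> b \<in> \<AA>" "\<r> (f \<star> b) \<in> pdom q" using fA b q(2) by auto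
  have "\<r> b \<in> pdom p" using p(2) b(2) by simp
  from gstar_chained[OF gstar_piece[OF p(1) b(1) this] b(1) n(1)] have 2: "chained b (psec p a (\<r> b) \<star> b)" .
  have 3: "chained (f \<star> b) (psec q d (\<r> (f \<star> b)) \<star> (f \<star> b))"
    by (rule gstar_chained[OF gstar_piece[OF q(1) fb] fb(1) n(3)])
  show ?thesis by (rule chained_trans[OF 2 chained_trans[OF linked_chained[OF linked_sym[OF 1]] chained_sym[OF 3]]])
qed

lemma chained_family: "Q \<in> family_pow G \<T> n \<Longrightarrow> g \<in> Q \<Longrightarrow> b \<in> \<AA> \<Longrightarrow> \<s> g = \<r> b \<Longrightarrow> chained b (g \<star> b)"
proof (induction n arbitrary: Q g b)
  case 0
  then have "g = \<r> b" using unitD(2)[of g] by simp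
  then show ?case using chained_refl[OF 0(3)] 0(3) by simp
next
  case (Suc n)
  then obtain R F where R: "R \<in> family_pow G \<T> n" and F: "F \<in> \<T>" and Q: "Q = gset_mult G R F" by auto
  obtain h f where h: "h \<in> R" "f \<in> F" "h \<in> \<AA>" "f \<in> \<AA>" "\<s> h = \<r> f" "g = h \<star> f"
    using Suc.prems(2) unfolding Q by (elim gset_multE)
  have s: "\<s> f = \<r> b" using Suc.prems(4) h by simp
  have "chained b (f \<star> b)" by (rule chained_step[OF F h(2) Suc.prems(3) s])
  moreover have "chained (f \<star> b) (h \<star> (f \<star> b))" by (rule Suc.IH[OF R h(1)]) (use h s Suc.prems(3) in auto)
  moreover have "h \<star> (f \<star> b) = g \<star> b" using h s Suc.prems(3) by (simp add: assoc)
  ultimately show ?case using chained_trans by simp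
qed

text \<open>The arrow \<open>b \<star> \<i> a\<close> lies in some product of members of the cover,
  since these products form a basis. \<open>chained_family\<close> then leads from \<open>a\<close>
  to \<open>b\<close>.\<close>

lemma linked_all: assumes "a \<in> \<AA>" "b \<in> \<AA>" "\<s> a = \<s> b" "\<r> a \<noteq> \<r> b" shows "linked a b"
proof -
  let ?g = "b \<star> \<i> a"
  have g: "?g \<in> \<AA>" "\<s> ?g = \<r> a" "?g \<star> a = b" using assms by auto
  have "openin T \<AA>" using openin_topspace[of T] by simp
  then obtain Q where "Q \<in> (\<Union>n\<in>{1..}. family_pow G \<T> n)" "?g \<in> Q"
    by (rule topology_basisD[OF basisT _ g(1)])
  then obtain n where "Q \<in> family_pow G \<T> n" by blast
  from chained_family[OF this \<open>?g \<in> Q\<close> assms(1) g(2)] have "chained a b" unfolding g(3) .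
  then show ?thesis using assms(4) by (rule chained_linked)
qed

text \<open>Both pairs at \<open>a\<close> are linked; with fresh third germs,
  \<open>[(b u a), (a d v)] = (b d a)\<close>.\<close>

lemma good_all: assumes "a \<in> \<AA>" "b \<in> \<AA>" "d \<in> \<AA>" "\<s> b = \<s> a" "\<s> d = \<s> a" "\<r> a \<noteq> \<r> b" "\<r> b \<noteq> \<r> d" "\<r> a \<noteq> \<r> d"
  shows "good a b d"
proof -
  have "linked a b" "linked a d" using assms by (auto intro: linked_all)
  obtain u where u: "\<r> u \<notin> set [\<r> d]" "good a b u" using linked_fresh'[OF \<open>linked a b\<close>, of "[\<r> d]"] by auto
  obtain v where v: "\<r> v \<notin> set [\<r> b, \<r> u]" "good a d v" using linked_fresh'[OF \<open>linked a d\<close>, of "[\<r> b, \<r> u]"] by auto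
  have "distinct [\<r> b, \<r> u, \<r> a, \<r> d, \<r> v]" using u v goodD(6-8)[OF u(2)] goodD(6-8)[OF v(2)] assms(6-8) by auto
  from good_commutator[OF good_rot[OF u(2)] v(2) this] have "good b d a" .
  from good_rot[OF good_rot[OF this]] show ?thesis .
qed

section \<open>From germs back to multisections\<close>

text \<open>\<open>good_all\<close> applies at every point of the base. Compactness selects finitely
  many neighbourhoods, and the cycles over disjoint small pieces are multiplied together.\<close>

lemma has_cycle_multisection:
  assumes F: "multisection G 3 F" and p: "{i, j} \<subseteq> {1..3}" "distinct [1, i, j]"
  shows "has_cycle H (tuples (sec (F 1 1)) (sec (F 1 i)) (sec (F 1 j)) (F 1 1))"
proof -
  note M = multisectionD[OF F]
  have 1: "1 \<in> {1..3::nat}" by simp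
  have dis: "disjoint_family_on (\<lambda>i. F i i) {1..3}" using F by (simp add: multisection_def)
  let ?b = "\<lambda>i. sec (F 1 i)" and ?V = "F 1 1"
  have secl: "?b l y \<in> F 1 l" "\<s> (?b l y) = y" "?b l y \<in> \<AA>" "\<r> (?b l y) \<in> F l l" if l: "l \<in> {1..3}" and y: "y \<in> ?V" for l y
  proof -
    have "y \<in> \<s> ` F 1 l" using y M(5)[OF 1 l] by simp
    note S = secD[OF M(2)[OF 1 l] this]
    show "?b l y \<in> F 1 l" "\<s> (?b l y) = y" "?b l y \<in> \<AA>" by (rule S)+
    show "\<r> (?b l y) \<in> F l l" using S(1) M(6)[OF 1 l] by blast
  qed
  have ne: "\<r> (?b l y) \<noteq> \<r> (?b m z)" if "l \<in> {1..3}" "m \<in> {1..3}" "y \<in> ?V" "z \<in> ?V" "l \<noteq> m" for l m y z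
    using disjoint_family_onD[OF dis that(1,2,5)] secl(4)[OF that(1,3)] secl(4)[OF that(2,4)] by auto
  have st: "star ?b {1..3} ?V" unfolding star_def
  proof (intro conjI ballI impI)
    show "section_on (?b l) ?V" if "l \<in> {1..3}" for l unfolding section_on_def using secl[OF that] by blast
    fix l m y z assume *: "l \<in> {1..3}" "m \<in> {1..3}" "y \<in> ?V" "z \<in> ?V" "\<r> (?b l y) = \<r> (?b m z)"
    show "l = m" using ne[OF *(1-4)] *(5) by blast
    then have "?b l y = ?b l z" using slice_rng_inj[OF M(2)[OF 1 *(1)] secl(1)[OF *(1,3)] secl(1)[OF *(1,4)]] *(5) by simp
    then show "y = z" using secl(2)[OF *(1,3)] secl(2)[OF *(1,4)] by simp
  qed
  have ijs: "i \<in> {1..3}" "j \<in> {1..3}" "i \<noteq> 1" "j \<noteq> 1" "i \<noteq> j" using p by auto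
  \<comment> \<open>Quantifying over all clopen subsets lets the induction on the cover split
    \<open>W\<close> into the disjoint parts \<open>W \<inter> C\<close> and
    \<open>W - C\<close>.\<close>
  define hered where "hered C \<longleftrightarrow> (\<forall>W. clop W \<longrightarrow> W \<subseteq> C \<longrightarrow> W \<subseteq> ?V \<longrightarrow> has_cycle H (tuples (?b 1) (?b i) (?b j) W))" for C
  have cV: "clop ?V" using M(4)[OF 1 1] .
  have "\<exists>C. clop C \<and> x \<in> C \<and> hered C" if x: "x \<in> ?V" for x
  proof -
    have "good (?b 1 x) (?b i x) (?b j x)"
      by (rule good_all) (use secl[OF 1 x] secl[OF ijs(1) x] secl[OF ijs(2) x] ne[OF _ _ x x] ijs in auto)
    from goodD(9)[OF this] obtain C where C: "clop C" "x \<in> C" 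
      "\<forall>W. clop W \<longrightarrow> W \<subseteq> C \<longrightarrow> has_cycle H (tuples (gsec (?b 1 x)) (gsec (?b i x)) (gsec (?b j x)) W)"
      unfolding secl(2)[OF 1 x] by blast
    have nr: "near x (\<lambda>y. ?b l y = gsec (?b l x) y)" if l: "l \<in> {1..3}" for l
      using near_mono[OF near_gsec[OF M(1)[OF 1 l] secl(1)[OF l x]], of "\<lambda>y. ?b l y = gsec (?b l x) y"]
      unfolding secl(2)[OF l x] by blast
    from near_conj[OF near_clop[OF C(1,2)] near_conj[OF nr[OF 1] near_conj[OF nr[OF ijs(1)] nr[OF ijs(2)]]]]
    obtain Z where Z: "clop Z" "x \<in> Z" and Ze: "\<forall>y\<in>Z. y \<in> C \<and> ?b 1 y = gsec (?b 1 x) y \<and>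
        ?b i y = gsec (?b i x) y \<and> ?b j y = gsec (?b j x) y"
      unfolding near_def by blast
    have "hered Z" unfolding hered_def
    proof (intro allI impI)
      fix W assume W: "clop W" "W \<subseteq> Z" "W \<subseteq> ?V"
      have "W \<subseteq> C" using W(2) Ze by blast
      then have "has_cycle H (tuples (gsec (?b 1 x)) (gsec (?b i x)) (gsec (?b j x)) W)" using C(3) W(1) by blast
      then show "has_cycle H (tuples (?b 1) (?b i) (?b j) W)"
      proof (rule has_cycle_tuples_cong)
        fix y assume "y \<in> W"
        then have "y \<in> Z" using W(2) by blast
        then show "gsec (?b 1 x) y = ?b 1 y \<and> gsec (?b i x) y = ?b i y \<and> gsec (?b j x) y = ?b j y"
          using Ze by metis
      qed
    qed
    then show ?thesis using Z by blast
  qed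
  from clop_compact_ex[OF cV this]
  obtain \<V> where \<V>: "finite \<V>" "\<forall>C\<in>\<V>. clop C \<and> hered C" "?V \<subseteq> \<Union>\<V>" by blast
  have "hered (\<Union>\<V>)" using \<V>(1,2)
  proof (induction \<V> rule: finite_induct)
    case empty
    show ?case unfolding hered_def by (simp add: has_cycle_tuples_empty[OF subH])
  next
    case (insert C \<C>)
    have C: "clop C" "hered C" and h: "hered (\<Union>\<C>)" using insert by simp_all
    show ?case unfolding hered_def
    proof (intro allI impI)
      fix W assume W: "clop W" "W \<subseteq> \<Union>(insert C \<C>)" "W \<subseteq> ?V"
      have a: "has_cycle H (tuples (?b 1) (?b i) (?b j) (W \<inter> C))"
        using C(2) clop_ops(3)[OF W(1) C(1)] W(3) unfolding hered_def by blast
      have "W - C \<subseteq> \<Union>\<C>" using W(2) by blast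
      then have b: "has_cycle H (tuples (?b 1) (?b i) (?b j) (W - C))"
        using h clop_ops(5)[OF W(1) C(1)] W(3) unfolding hered_def by blast
      have "has_cycle H (tuples (?b 1) (?b i) (?b j) ((W \<inter> C) \<union> (W - C)))"
        by (rule has_cycle_star_Un[OF subH st _ _ a b]) (use W(3) ijs in auto)
      moreover have "(W \<inter> C) \<union> (W - C) = W" by blast
      ultimately show "has_cycle H (tuples (?b 1) (?b i) (?b j) W)" by simp
    qed
  qed
  then show ?thesis using cV \<V>(3) unfolding hered_def by blast
qed

text \<open>For a nontrivial even \<open>\<pi>\<close>, \<open>H\<close> contains an element with
  the same triples as the multisection element, and uniqueness makes the two equal.\<close>

lemma alt_subset: "alt \<subseteq> H"
  unfolding alt_def
proof (rule group.generate_subgroup_incl[OF group_full_group _ subH], safe)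
  fix c F assume F: "multisection G 3 F" and c: "c \<in> multisection_alt G 3 F"
  then obtain \<pi> where \<pi>: "\<pi> permutes {1..3}" "evenperm \<pi>" "c = multisection_perm G 3 F \<pi>"
    unfolding multisection_alt_def by blast
  show "c \<in> H"
  proof (cases "\<pi> = id")
    case True
    then have "c = \<UU>" using multisection_perm_id[OF F] \<pi>(3) by simp
    then show ?thesis using subgroup.one_closed[OF subH] by simp
  next
    case False
    then have orb: "{1, \<pi> 1, \<pi> (\<pi> 1)} = {1..3}" "\<pi> (\<pi> (\<pi> 1)) = 1" using even_perm_3[OF \<pi>(1,2)] by blast+
    let ?\<Theta> = "tuples (sec (F 1 1)) (sec (F 1 (\<pi> 1))) (sec (F 1 (\<pi> (\<pi> 1)))) (F 1 1)"
    have mem: "\<pi> 1 \<in> {1..3}" "\<pi> (\<pi> 1) \<in> {1..3}" using orb(1) by blast+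
    have "distinct [1, \<pi> 1, \<pi> (\<pi> 1)]"
    proof (rule card_distinct)
      show "card (set [1, \<pi> 1, \<pi> (\<pi> 1)]) = length [1, \<pi> 1, \<pi> (\<pi> 1)]" using orb(1) by simp
    qed
    then have "has_cycle H ?\<Theta>" using has_cycle_multisection[OF F] mem by simp
    then obtain c' where c': "c' \<in> H" "is_cycle c' ?\<Theta>" unfolding has_cycle_def by blast
    have cc: "is_cycle c ?\<Theta>" unfolding \<pi>(3) by (rule multisection_perm_is_cycle[OF F \<pi>(1) orb])
    have fc: "full c" using multisection_perm_full[OF F \<pi>(1)] \<pi>(3) by simp
    have fc': "full c'" using subgroup.mem_carrier[OF subH c'(1)] by simp
    have "section_on (sec (F 1 l)) (F 1 1)" if l: "l \<in> {1..3}" for l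
      unfolding section_on_def
    proof
      fix y assume "y \<in> F 1 1"
      then have "y \<in> \<s> ` F 1 l" using multisectionD(5)[OF F _ l, of 1] by simp
      then show "sec (F 1 l) y \<in> \<AA> \<and> \<s> (sec (F 1 l) y) = y"
        using secD(2,3)[OF multisectionD(2)[OF F _ l, of 1]] by simp
    qed
    then have "same_source ?\<Theta>" using mem by (intro same_source_tuples) simp_all
    then have "c = c'" by (rule is_cycle_unique[OF cc c'(2) _ fc fc'])
    then show ?thesis using c'(1) by simp
  qed
qed

end

section \<open>Finite generation\<close>

context cantor_groupoid
begin

text \<open>Distinct constant colours make the three ranges disjoint, which is what
  \<open>has_cycle_alt\<close> asks for.\<close>

lemma has_cycle_alt_colored:
  assumes A: "bisection G A\<^sub>1" "bisection G A\<^sub>2" "bisection G A\<^sub>3" "\<s> ` A\<^sub>1 = V" "\<s> ` A\<^sub>2 = V" "\<s> ` A\<^sub>3 = V"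
    and k: "\<And>f. f \<in> A\<^sub>1 \<Longrightarrow> \<kappa> (\<r> f) = c\<^sub>1" "\<And>f. f \<in> A\<^sub>2 \<Longrightarrow> \<kappa> (\<r> f) = c\<^sub>2" "\<And>f. f \<in> A\<^sub>3 \<Longrightarrow> \<kappa> (\<r> f) = c\<^sub>3"
    and c: "distinct [c\<^sub>1, c\<^sub>2, c\<^sub>3]"
  shows "has_cycle alt (tuples (sec A\<^sub>1) (sec A\<^sub>2) (sec A\<^sub>3) V)"
proof -
  define B where "B n = (if n = 1 then A\<^sub>1 else if n = 2 then A\<^sub>2 else A\<^sub>3)" for n :: nat
  define col where "col n = (if n = 1 then c\<^sub>1 else if n = 2 then c\<^sub>2 else c\<^sub>3)" for n :: nat
  have v: "B 1 = A\<^sub>1" "B 2 = A\<^sub>2" "B 3 = A\<^sub>3" unfolding B_def by simp_all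
  have "has_cycle alt (tuples (sec (B 1)) (sec (B 2)) (sec (B 3)) V)"
  proof (rule has_cycle_alt)
    fix i :: nat assume "i \<in> {1, 2, 3}"
    then show "bisection G (B i)" "\<s> ` B i = V" using A unfolding B_def by auto
  next
    have col: "\<kappa> (\<r> f) = col n" if "f \<in> B n" for f n
      using that k unfolding B_def col_def by (simp split: if_splits)
    show "disjoint_family_on (\<lambda>i. \<r> ` B i) {1, 2, 3}" unfolding disjoint_family_on_def
    proof (intro ballI impI)
      fix m n :: nat assume mn: "m \<in> {1, 2, 3}" "n \<in> {1, 2, 3}" "m \<noteq> n"
      then have ne: "col m \<noteq> col n" using c unfolding col_def by auto
      show "\<r> ` B m \<inter> \<r> ` B n = {}"
      proof (rule ccontr)
        assume "\<r> ` B m \<inter> \<r> ` B n \<noteq> {}"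
        then obtain f g where "f \<in> B m" "g \<in> B n" "\<r> f = \<r> g" by blast
        then show False using col[of f m] col[of g n] ne by simp
      qed
    qed
  qed
  then show ?thesis unfolding v .
qed

lemma has_cycle_alt_star: assumes p: "piece \<kappa> N p" and i: "i < N" "j < N" "k < N" and d: "distinct [i, j, k]"
  shows "has_cycle alt (tuples (psec p i) (psec p j) (psec p k) (pdom p))"
proof -
  obtain V B col where pq: "p = (V, B, col)" by (cases p) auto
  have col: "\<kappa> (\<r> f) = pcol p l" if "l < N" "f \<in> fst (snd p) l" for l f
    using p that unfolding pq piece_def by auto
  note Pp = pieceD[OF p]
  have "pcol p l \<noteq> pcol p m" if "l < N" "m < N" "l \<noteq> m" for l m
    using inj_onD[OF Pp(9)[OF i(1)], of l m] that by auto
  then have dc: "distinct [pcol p i, pcol p j, pcol p k]" using i d by simp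
  show ?thesis
    by (rule has_cycle_alt_colored[where \<kappa> = \<kappa> and c\<^sub>1 = "pcol p i" and c\<^sub>2 = "pcol p j" and c\<^sub>3 = "pcol p k", OF Pp(2)[OF i(1)] Pp(2)[OF i(2)] Pp(2)[OF i(3)] Pp(3)[OF i(1)] Pp(3)[OF i(2)] Pp(3)[OF i(3)]
      col[OF i(1)] col[OF i(2)] col[OF i(3)] dc])
qed

text \<open>Multiplying by \<open>F\<close> on the right leaves ranges, hence colours, unchanged, so
  the prolonged section is again a bisection of constant colour.\<close>

lemma has_cycle_alt_bridge: assumes p: "piece \<kappa> N p" and q: "piece \<kappa> N q" and F: "bisection G F"
    and n: "a < N" "b < N" "c < N" and d: "distinct [pcol q c, pcol p a, pcol p b]"
  shows "has_cycle alt (tuples (via F (psec q c)) (psec p a) (psec p b)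
    (pull F (pdom p) (pdom q)))" (is "has_cycle alt (tuples ?c _ _ ?W)")
proof -
  note Pp = pieceD[OF p] note Pq = pieceD[OF q]
  obtain V B col where pp: "p = (V, B, col)" by (cases p) auto
  obtain V' B' col' where qq: "q = (V', B', col')" by (cases q) auto
  have kp: "\<kappa> (\<r> f) = pcol p l" if "l < N" "f \<in> fst (snd p) l" for l f
    using p that unfolding pp piece_def by auto
  have kq: "\<kappa> (\<r> f) = pcol q c" if "f \<in> fst (snd q) c" for f
    using q that n(3) unfolding qq piece_def by auto
  let ?M = "gset_mult G (fst (snd q) c) F"
  have bM: "bisection G ?M" by (rule bisection_mult[OF Pq(2)[OF n(3)] F])
  have sl: "slice (fst (snd q) c)" "slice F" using Pq(2)[OF n(3)] F bisection_slice by blast+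
  have "?W = pdom p \<inter> {y \<in> \<s> ` F. \<r> (sec F y) \<in> pdom q}" by blast
  then have cW: "clop ?W" using clop_ops(3)[OF Pp(1)[OF n(1)] clop_preimage[OF F Pq(1)[OF n(3)]]] by simp
  have WM: "?W \<subseteq> \<s> ` ?M" unfolding src_image_mult[OF sl] Pq(3)[OF n(3)] by blast
  have Wp: "?W \<subseteq> \<s> ` fst (snd p) l" if "l < N" for l unfolding Pp(3)[OF that] by blast
  have "has_cycle alt (tuples (sec (restr ?M ?W)) (sec (restr (fst (snd p) a) ?W)) (sec (restr (fst (snd p) b) ?W)) ?W)"
  proof (rule has_cycle_alt_colored[where \<kappa> = \<kappa>, OF _ _ _ _ _ _ _ _ _ d])
    show "bisection G (restr ?M ?W)" by (rule bisection_restr[OF bM cW])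
    show "bisection G (restr (fst (snd p) a) ?W)" by (rule bisection_restr[OF Pp(2)[OF n(1)] cW])
    show "bisection G (restr (fst (snd p) b) ?W)" by (rule bisection_restr[OF Pp(2)[OF n(2)] cW])
    show "\<s> ` restr ?M ?W = ?W" by (rule restr_facts(1)[OF bM WM])
    show "\<s> ` restr (fst (snd p) a) ?W = ?W" by (rule restr_facts(1)[OF Pp(2)[OF n(1)] Wp[OF n(1)]])
    show "\<s> ` restr (fst (snd p) b) ?W = ?W" by (rule restr_facts(1)[OF Pp(2)[OF n(2)] Wp[OF n(2)]])
    show "\<kappa> (\<r> f) = pcol p a" if "f \<in> restr (fst (snd p) a) ?W" for f
      using kp[OF n(1)] that unfolding restr_def by blast
    show "\<kappa> (\<r> f) = pcol p b" if "f \<in> restr (fst (snd p) b) ?W" for f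
      using kp[OF n(2)] that unfolding restr_def by blast
    show "\<kappa> (\<r> f) = pcol q c" if f: "f \<in> restr ?M ?W" for f
    proof -
      have "f \<in> ?M" using f unfolding restr_def by blast
      then obtain g h where g: "g \<in> fst (snd q) c" "g \<in> \<AA>" "h \<in> \<AA>" "\<s> g = \<r> h" "f = g \<star> h" by (elim gset_multE)
      then have "\<r> f = \<r> g" by simp
      then show ?thesis using kq[OF g(1)] by simp
    qed
  qed
  then show ?thesis
  proof (rule has_cycle_tuples_cong)
    fix y assume y: "y \<in> ?W"
    have "sec (restr ?M ?W) y = ?c y"
      using restr_facts(2)[OF bM WM y] sec_mult[OF sl, of y] y unfolding Pq(3)[OF n(3)] by simp
    then show "sec (restr ?M ?W) y = ?c y \<and> sec (restr (fst (snd p) a) ?W) y = psec p a y \<and>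
      sec (restr (fst (snd p) b) ?W) y = psec p b y"
      using restr_facts(2)[OF Pp(2)[OF n(1)] Wp[OF n(1)] y] restr_facts(2)[OF Pp(2)[OF n(2)] Wp[OF n(2)] y] by blast
  qed
qed

text \<open>The finite index sets \<open>J\<^sub>1\<close> and \<open>J\<^sub>2\<close> list the
  cycles that \<open>generating_system\<close> asks for: those inside one piece, and those linking
  two pieces along a member of the cover.\<close>

lemma finite_generators:
  assumes fT: "finite \<T>" and bT: "\<And>F. F \<in> \<T> \<Longrightarrow> bisection G F"
    and basis: "topology_basis T (\<Union>n\<in>{1..}. family_pow G \<T> n)" and inf: "infinite_orbits G"
  shows "\<exists>T\<^sub>0. finite T\<^sub>0 \<and> T\<^sub>0 \<subseteq> alt \<and> generate (full_group G) T\<^sub>0 = alt"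
proof -
  obtain \<kappa> :: "'a \<Rightarrow> ('a set \<times> nat \<times> nat) set" and P where
    P: "finite P" "\<And>p. p \<in> P \<Longrightarrow> piece \<kappa> 7 p" "\<UU> \<subseteq> \<Union>(fst ` P)"
    using coloring[OF inf, of 7] by metis
  define I where "I = {..<7::nat}"
  have fI: "finite I" unfolding I_def by simp
  define \<Theta>\<^sub>1 :: "('a set \<times> (nat \<Rightarrow> 'a set) \<times> (nat \<Rightarrow> ('a set \<times> nat \<times> nat) set)) \<times> nat \<times> nat \<times> nat \<Rightarrow> ('a \<times> 'a \<times> 'a) set"
    where "\<Theta>\<^sub>1 = (\<lambda>(p, i, j, k). tuples (psec p i) (psec p j) (psec p k) (pdom p))"
  define J\<^sub>1 where "J\<^sub>1 = {(p, i, j, k). (p, i, j, k) \<in> P \<times> I \<times> I \<times> I \<and> distinct [i, j, k]}"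
  define \<Theta>\<^sub>2 :: "'a set \<times> ('a set \<times> (nat \<Rightarrow> 'a set) \<times> (nat \<Rightarrow> ('a set \<times> nat \<times> nat) set)) \<times> ('a set \<times> (nat \<Rightarrow> 'a set) \<times> (nat \<Rightarrow> ('a set \<times> nat \<times> nat) set)) \<times> nat \<times> nat \<times> nat \<Rightarrow> ('a \<times> 'a \<times> 'a) set"
    where "\<Theta>\<^sub>2 = (\<lambda>(F, p, q, a, b, c). tuples (via F (psec q c)) (psec p a) (psec p b)
      (pull F (pdom p) (pdom q)))"
  define J\<^sub>2 where "J\<^sub>2 = {(F, p, q, a, b, c). (F, p, q, a, b, c) \<in> \<T> \<times> P \<times> P \<times> I \<times> I \<times> I \<and>
      distinct [pcol q c, pcol p a, pcol p b]}"
  let ?Th = "\<Theta>\<^sub>1 ` J\<^sub>1 \<union> \<Theta>\<^sub>2 ` J\<^sub>2"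
  have "J\<^sub>1 \<subseteq> P \<times> I \<times> I \<times> I" "J\<^sub>2 \<subseteq> \<T> \<times> P \<times> P \<times> I \<times> I \<times> I" unfolding J\<^sub>1_def J\<^sub>2_def by blast+
  then have "finite J\<^sub>1" "finite J\<^sub>2" using P(1) fT fI by (meson finite_SigmaI finite_subset)+
  then have fin: "finite ?Th" by simp
  have "has_cycle alt (\<Theta>\<^sub>1 t)" if t: "t \<in> J\<^sub>1" for t
  proof -
    obtain p i j k where t': "t = (p, i, j, k)" by (rule prod_cases4)
    have m: "p \<in> P" "i < 7" "j < 7" "k < 7" "distinct [i, j, k]"
      using t unfolding J\<^sub>1_def I_def t' by simp_all
    show ?thesis unfolding t' \<Theta>\<^sub>1_def prod.case by (rule has_cycle_alt_star[OF P(2)[OF m(1)] m(2-5)])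
  qed
  moreover have "has_cycle alt (\<Theta>\<^sub>2 t)" if t: "t \<in> J\<^sub>2" for t
  proof -
    obtain F p q a b c where t': "t = (F, p, q, a, b, c)" by (rule prod_cases6)
    have m: "F \<in> \<T>" "p \<in> P" "q \<in> P" "a < 7" "b < 7" "c < 7" "distinct [pcol q c, pcol p a, pcol p b]"
      using t unfolding J\<^sub>2_def I_def t' by simp_all
    show ?thesis unfolding t' \<Theta>\<^sub>2_def prod.case
      by (rule has_cycle_alt_bridge[OF P(2)[OF m(2)] P(2)[OF m(3)] bT[OF m(1)] m(4-7)])
  qed
  ultimately have "\<forall>\<Theta>\<in>?Th. \<exists>c. c \<in> alt \<and> is_cycle c \<Theta>" unfolding has_cycle_def by blast
  \<comment> \<open>One element of \<open>alt\<close> is chosen for each of the finitely many sets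
    of triples; these are the generators.\<close>
  then obtain gen where gen: "\<And>\<Theta>. \<Theta> \<in> ?Th \<Longrightarrow> gen \<Theta> \<in> alt \<and> is_cycle (gen \<Theta>) \<Theta>" by metis
  let ?T = "gen ` ?Th"
  let ?H = "generate (full_group G) ?T"
  have Talt: "?T \<subseteq> alt" using gen by blast
  have altc: "alt \<subseteq> carrier (full_group G)" using subgroup.subset[OF subgroup_alt] .
  have subH: "subgroup ?H (full_group G)"
    by (rule group.generate_is_subgroup[OF group_full_group]) (use Talt altc in blast)
  have HCH: "has_cycle ?H \<Theta>" if "\<Theta> \<in> ?Th" for \<Theta>
    unfolding has_cycle_def using gen[OF that] generate.incl[of "gen \<Theta>" ?T "full_group G"] that by blast
  interpret GS: generating_system G ?H P \<kappa> \<T>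
  proof (intro generating_system.intro generating_system_axioms.intro)
    fix p and i j k :: nat assume "p \<in> P" "{i, j, k} \<subseteq> {..<7}" "distinct [i, j, k]"
    then have "(p, i, j, k) \<in> J\<^sub>1" unfolding J\<^sub>1_def I_def by simp
    then have "has_cycle ?H (\<Theta>\<^sub>1 (p, i, j, k))" by (intro HCH) blast
    then show "has_cycle ?H (tuples (psec p i) (psec p j) (psec p k) (pdom p))" unfolding \<Theta>\<^sub>1_def by simp
  next
    fix F p q and a b c :: nat assume "F \<in> \<T>" "p \<in> P" "q \<in> P" "{a, b, c} \<subseteq> {..<7}" "distinct [pcol q c, pcol p a, pcol p b]"
    then have "(F, p, q, a, b, c) \<in> J\<^sub>2" unfolding J\<^sub>2_def I_def by simp
    then have "has_cycle ?H (\<Theta>\<^sub>2 (F, p, q, a, b, c))" by (intro HCH) blast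
    then show "has_cycle ?H (tuples (via F (psec q c)) (psec p a) (psec p b)
      (pull F (pdom p) (pdom q)))" unfolding \<Theta>\<^sub>2_def by simp
  next
    show "cantor_groupoid G" by (rule cantor_groupoid_axioms)
    show "\<And>p. p \<in> P \<Longrightarrow> piece \<kappa> 7 p" by (rule P(2))
    show "\<And>F. F \<in> \<T> \<Longrightarrow> bisection G F" by (rule bT)
  qed (fact subH P(1) P(3) basis)+
  have "?H \<subseteq> alt" by (rule group.generate_subgroup_incl[OF group_full_group Talt subgroup_alt])
  then have "?H = alt" using GS.alt_subset by blast
  then show ?thesis using fin Talt by (intro exI[of _ ?T]) simp
qed

end

theorem theorem1p2:
  fixes G :: "'a topgpd"
  assumes "etale_groupoid G"
    and "unit_topology G homeomorphic_space cantor_space"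
    and "expansive G"
    and "infinite_orbits G"
  shows "finitely_generated_group (alt_full_group G)"
proof -
  interpret cantor_groupoid G
    by (intro cantor_groupoid.intro cantor_groupoid_axioms.intro assms)
  obtain S \<S> where "expansive_cover G S \<S>" using assms(3) unfolding expansive_def by blast
  then have \<S>: "finite \<S>" "\<And>F. F \<in> \<S> \<Longrightarrow> bisection G F"
    "topology_basis T (\<Union>n\<in>{1..}. family_pow G (\<S> \<union> gset_inv G ` \<S>) n)"
    unfolding expansive_cover_def by blast+
  \<comment> \<open>The family handed to \<open>finite_generators\<close> includes the inverses, as
    in the definition of an expansive cover, and stays finite.\<close>
  have "bisection G F" if "F \<in> \<S> \<union> gset_inv G ` \<S>" for F
    using that \<S>(2) bisection_inv by blast
  then obtain T\<^sub>0 where T\<^sub>0: "finite T\<^sub>0" "T\<^sub>0 \<subseteq> alt" "generate (full_group G) T\<^sub>0 = alt"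
    using finite_generators[OF _ _ \<S>(3) assms(4)] \<S>(1) by blast
  have alt_eq: "alt_full_group G = (full_group G)\<lparr>carrier := alt\<rparr>"
    unfolding alt_full_group_def alt_def ..
  \<comment> \<open>Generation inside the subgroup agrees with generation in the full group.\<close>
  have "generate (alt_full_group G) T\<^sub>0 = alt"
    unfolding alt_eq using group.generate_consistent[OF group_full_group T\<^sub>0(2) subgroup_alt] T\<^sub>0(3) by simp
  then show ?thesis unfolding finitely_generated_group_def using T\<^sub>0 by (auto simp: alt_eq)
qed

end
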